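(* For every choice of fundamental domains of the sublattices of $\Lambda$, the resulting function $\mu$ on rational cones in $V$ is a local formula for Ehrhart coefficients. That is, for every lattice polytope $\mathcal{P}\subset V$ with $d=\dim\mathcal{P}$ and Ehrhart polynomial $|t\mathcal{P}\cap\Lambda|=e_dt^d+e_{d-1}t^{d-1}+\dots+e_1t+e_0$ ($t\in\mathbb{Z}_{\ge0}$), one has $$e_i=\sum_{\substack{f\le\mathcal{P}\\ \dim f=i}}\mu(N_f)\,\mathrm{vol}(f)\qquad\text{for all } i\in\{0,\dots,d\}.$$
   Context: Setting. $V$ is a finite-dimensional Euclidean space with inner product $\langle\cdot,\cdot\rangle$ and $\Lambda\subset V$ is a lattice of full rank $\dim V$. A rational cone is a subset of $V$ defined by finitely many homogeneous linear inequalities with rational coefficients with respect to a basis of $\Lambda$; it is pointed if it contains no nontrivial linear subspace. For a cone $C$ put $C^\vee=\{x\in V:\langle x,y\rangle\le 0\ \forall y\in C\}$ and $C^\perp=\{x\in V:\langle x,y\rangle=0\ \forall y\in C\}$. Standing assumption: for every rational cone $C$ the lattice $L(C):=\Lambda\cap C^\perp$ has rank $\dim C^\perp$. "Face" always means nonempty face; $f\le g$ means $f$ is a face of $g$ (possibly equal), $f<g$ means $f\le g$ and $f\ne g$. A ray of a cone is a one-dimensional face. Two faces are incomparable if neither is a face of the other. Volumes. For a subset $A$ of an affine space $x+S$ with $x\in\Lambda$ and $S$ a linear subspace in which $\Lambda\cap S$ has full rank, $\mathrm{vol}(A)$ is the relative (lattice) volume: Lebesgue measure on $x+S$ normalized so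 that a fundamental domain of $\Lambda\cap S$ has volume $1$ (a point has volume $1$ if $\dim S=0$). The volume of a face $f$ of a lattice polytope is taken in its affine hull. Fundamental domains. A fundamental domain of a sublattice $L\subseteq\Lambda$ is a connected bounded set $T\subseteq\mathrm{lin}(L)$ (linear hull) containing $0$, such that the translates $x+T$, $x\in L$, are pairwise disjoint and cover $\mathrm{lin}(L)$, and such that the intersection of $T$ with every affine subspace is measurable. For every sublattice $L\subseteq\Lambda$ an arbitrary fundamental domain is chosen and fixed; for a pointed rational cone $C$, $T(C)\subseteq C^\perp$ denotes the chosen fundamental domain of $L(C)$. With $C_0=\{0\}$ put $T:=T(C_0)$, the chosen fundamental domain of $\Lambda$. For a polyhedron $Q\subseteq V$ put $\mathrm{DC}(Q)=(\Lambda\cap Q)+T$ and $\mathrm{CDC}(Q)=\bigcup_{x\in\Lambda,\,(x+T)\cap Q\neq\varnothing}(x+T)$. Regions. For pointed rational cones $C$, the region $R(C)\subseteq V$ is defined inductively on dimension. $R(C_0):=T(C_0)$. If $\dim C\ge1$ and $R(K)$ is defined for all faces $K<C$, let $X^C_K$ (for $K<C$) be the set of all $x\in L(K)$ such that (I) $x+R(K)\subseteq\mathrm{int}(M^\vee)$ for all rays $M\le C$ with $M\not\le K$; and (II) $(x+R(K))\cap(x'+R(K'))=\varnothing$ for all faces $K'<C$ incomparable to $K$ and all $x'\in L(K')$. Then $$R(C):=\Big(V\setminus\bigcup_{K<C}(X^C_K+R(K))\Big)\cap\big(T(C)+\mathrm{lin}(C)\big)\cap\mathrm{CDC}(C^\vee).$$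 The function $\mu$. For a pointed rational cone $C$ define the DC-volume $v_C:=\mathrm{vol}(R(C)\cap\mathrm{DC}(C^\vee))$ (relative volume in $V$) and, for faces $K<C$, the correction volume $w^C_K:=\mathrm{vol}(R(C)\cap K^\perp\cap C^\vee)$ (relative volume in $K^\perp$ with respect to $\Lambda\cap K^\perp$). Put $\mu(C_0):=1$ and, for pointed rational $C$ with $\dim C\ge1$, inductively on dimension, $\mu(C):=v_C-\sum_{K<C}w^C_K\,\mu(K)$. If a rational cone $C$ is not pointed, let $U$ be its maximal linear subspace and $C':=C\cap U^\perp$, a pointed cone in the Euclidean space $U^\perp$ with the induced inner product and the lattice $\Lambda\cap U^\perp$; carry out the whole construction inside $U^\perp$ (using the chosen fundamental domains of sublattices of $\Lambda\cap U^\perp$, with polars and orthogonal spaces taken in $U^\perp$) and set $\mu(C):=\mu(C')$. Polytopes. A lattice polytope is the convex hull of finitely many points of $\Lambda$ (nonempty, not necessarily full-dimensional). For a face $f$ of $\mathcal{P}$, the normal cone is $N_f=\{x\in V:\langle x,y-s\rangle\le0\ \forall y\in\mathcal{P}\}$ for any $s$ in the relative interior of $f$. *)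

theory Defs
  imports "HOL-Analysis.Analysis"
begin

definition lattice_basis :: "'a::euclidean_space set \<Rightarrow> 'a set \<Rightarrow> bool" where
  "lattice_basis B L \<longleftrightarrow>
     independent B \<and> L = range (\<lambda>c. \<Sum>b\<in>B. real_of_int (c b) *\<^sub>R b)"

definition is_lattice :: "'a::euclidean_space set \<Rightarrow> bool" where
  "is_lattice L \<longleftrightarrow> (\<exists>B. lattice_basis B L)"

text \<open>
  For independent \<open>B\<close>, the affine space \<open>x + span B\<close> is identified with \<open>B \<rightarrow>\<^sub>E \<real>\<close> through the
  coordinates with respect to \<open>B\<close>; a subset of it is Lebesgue measurable iff its coordinate set is
  (which does not depend on \<open>x\<close> and \<open>B\<close>).  For \<open>B = {}\<close> the space is a point of measure 1.
\<close>

definition coord_lebesgue :: "'a::euclidean_space set \<Rightarrow> ('a \<Rightarrow> real) measure" where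
  "coord_lebesgue B = completion (\<Pi>\<^sub>M b\<in>B. lborel)"

definition coord_set :: "'a::euclidean_space set \<Rightarrow> 'a \<Rightarrow> 'a set \<Rightarrow> ('a \<Rightarrow> real) set" where
  "coord_set B x A = {c \<in> extensional B. x + (\<Sum>b\<in>B. c b *\<^sub>R b) \<in> A}"

text \<open>
  In the last condition \<open>x + span B\<close> runs through all (nonempty) affine subspaces.
\<close>

definition fundamental_domain :: "'a::euclidean_space set \<Rightarrow> 'a set \<Rightarrow> bool" where
  "fundamental_domain L D \<longleftrightarrow>
     connected D \<and> bounded D \<and> D \<subseteq> span L \<and> 0 \<in> D \<and>
     disjoint_family_on (\<lambda>x. (+) x ` D) L \<and> (\<Union>x\<in>L. (+) x ` D) = span L \<and>
     (\<forall>x B. independent B \<longrightarrow> coord_set B x D \<in> sets (coord_lebesgue B))"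

text \<open>
  Volume of \<open>A \<subseteq> E\<close>, where \<open>E\<close> is an affine space through a point of \<open>\<Lambda>\<close> whose direction space \<open>S\<close>
  is spanned by \<open>\<Lambda> \<inter> S\<close>: Lebesgue measure in coordinates with respect to a basis of
  \<open>\<Lambda> \<inter> S\<close>, so that a fundamental domain of \<open>\<Lambda> \<inter> S\<close> has volume 1.  The value does not
  depend on the chosen origin and basis.
\<close>

definition rel_vol :: "'a::euclidean_space set \<Rightarrow> 'a set \<Rightarrow> 'a set \<Rightarrow> real" where
  "rel_vol \<Lambda> E A =
     (let x = (SOME x. x \<in> \<Lambda> \<inter> E);
          B = (SOME B. lattice_basis B (\<Lambda> \<inter> (\<lambda>y. y - x) ` E))
      in measure (coord_lebesgue B) (coord_set B x A))"

definition face_le :: "'a::real_vector set \<Rightarrow> 'a set \<Rightarrow> bool" where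
  "face_le f g \<longleftrightarrow> f face_of g \<and> f \<noteq> {}"

definition face_less :: "'a::real_vector set \<Rightarrow> 'a set \<Rightarrow> bool" where
  "face_less f g \<longleftrightarrow> face_le f g \<and> f \<noteq> g"

definition pointed :: "'a::real_vector set \<Rightarrow> bool" where
  "pointed C \<longleftrightarrow> (\<forall>S. subspace S \<and> S \<subseteq> C \<longrightarrow> S = {0})"

definition rational_cone :: "'a::euclidean_space set \<Rightarrow> 'a set \<Rightarrow> bool" where
  "rational_cone \<Lambda> C \<longleftrightarrow>
     (\<exists>B F. lattice_basis B \<Lambda> \<and> finite F \<and> (\<forall>a\<in>F. \<forall>b\<in>B. a b \<in> \<rat>) \<and>
        C = {\<Sum>b\<in>B. c b *\<^sub>R b | c. \<forall>a\<in>F. (\<Sum>b\<in>B. a b * c b) \<le> 0})"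

lemma convex_rational_cone:
  assumes "rational_cone \<Lambda> C"
  shows "convex C"
proof -
  obtain B :: "'a set" and F :: "('a \<Rightarrow> real) set" where
    C: "C = {\<Sum>b\<in>B. c b *\<^sub>R b | c. \<forall>a\<in>F. (\<Sum>b\<in>B. a b * c b) \<le> 0}"
    using assms by (auto simp: rational_cone_def)
  show ?thesis
  proof (rule convexI)
    fix x y and u v :: real
    assume "x \<in> C" "y \<in> C" and uv: "0 \<le> u" "0 \<le> v" "u + v = 1"
    then obtain c d where
      x: "x = (\<Sum>b\<in>B. c b *\<^sub>R b)" and c: "\<And>a. a \<in> F \<Longrightarrow> (\<Sum>b\<in>B. a b * c b) \<le> 0" and
      y: "y = (\<Sum>b\<in>B. d b *\<^sub>R b)" and d: "\<And>a. a \<in> F \<Longrightarrow> (\<Sum>b\<in>B. a b * d b) \<le> 0"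
      unfolding C by blast
    let ?e = "\<lambda>b. u * c b + v * d b"
    have eq: "u *\<^sub>R x + v *\<^sub>R y = (\<Sum>b\<in>B. ?e b *\<^sub>R b)"
      by (simp add: x y scaleR_sum_right scaleR_add_left sum.distrib)
    have "(\<Sum>b\<in>B. a b * ?e b) \<le> 0" if "a \<in> F" for a
    proof -
      have "(\<Sum>b\<in>B. a b * ?e b) = u * (\<Sum>b\<in>B. a b * c b) + v * (\<Sum>b\<in>B. a b * d b)"
        by (simp add: sum_distrib_left sum.distrib algebra_simps)
      also have "\<dots> \<le> 0"
        using uv c[OF that] d[OF that] by (intro add_nonpos_nonpos mult_nonneg_nonpos)
      finally show ?thesis .
    qed
    then show "u *\<^sub>R x + v *\<^sub>R y \<in> C"
      unfolding C eq by (intro CollectI exI[of _ ?e] conjI ballI refl)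
  qed
qed

lemma face_less_aff_dim:
  assumes "face_less K C" "rational_cone \<Lambda> C"
  shows "nat (aff_dim K) < nat (aff_dim C)"
proof -
  have "aff_dim K < aff_dim C"
    using assms face_of_aff_dim_lt[of C K] convex_rational_cone[of \<Lambda> C]
    by (auto simp: face_less_def face_le_def)
  moreover have "0 \<le> aff_dim K"
    using assms(1) aff_dim_geq[of K] aff_dim_empty[of K]
    by (simp add: face_less_def face_le_def)
  ultimately show ?thesis by simp
qed

text \<open>
  From here on, \<open>\<Lambda>\<close> is a lattice of full rank in the subspace \<open>V\<close> of the ambient type (so
  \<open>dim V = 0\<close> is allowed), and \<open>T L\<close> is the chosen fundamental domain of the sublattice \<open>L\<close>.
  Polars, orthogonal spaces and interiors are taken in \<open>V\<close>, so that the construction can be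
  repeated inside a subspace of \<open>V\<close>, as is done for cones that are not pointed.
  Note that \<open>perp_lattice {0} = \<Lambda>\<close>.
\<close>

context
  fixes V :: "'a::euclidean_space set" and \<Lambda> :: "'a set" and T :: "'a set \<Rightarrow> 'a set"
begin

definition polar :: "'a set \<Rightarrow> 'a set" where
  "polar C = {x \<in> V. \<forall>y\<in>C. x \<bullet> y \<le> 0}"

definition perp :: "'a set \<Rightarrow> 'a set" where
  "perp C = V \<inter> C\<^sup>\<bottom>"

definition perp_lattice :: "'a set \<Rightarrow> 'a set" where
  "perp_lattice C = \<Lambda> \<inter> perp C"

definition DC :: "'a set \<Rightarrow> 'a set" where
  "DC Q = (\<Lambda> \<inter> Q) + T (perp_lattice {0})"

definition CDC :: "'a set \<Rightarrow> 'a set" where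
  "CDC Q = (\<Union>x\<in>{x\<in>\<Lambda>. (+) x ` T (perp_lattice {0}) \<inter> Q \<noteq> {}}. (+) x ` T (perp_lattice {0}))"

text \<open>
  The set \<open>X\<^sup>C\<^sub>K\<close>, where \<open>R\<close> assigns regions to the proper faces of \<open>C\<close>; the interior is taken
  in \<open>V\<close>.
\<close>

definition translation_set :: "('a set \<Rightarrow> 'a set) \<Rightarrow> 'a set \<Rightarrow> 'a set \<Rightarrow> 'a set" where
  "translation_set R C K =
     {x \<in> perp_lattice K.
        (\<forall>M. M edge_of C \<and> \<not> face_le M K \<longrightarrow>
           (+) x ` R K \<subseteq> (top_of_set V) interior_of (polar M)) \<and>
        (\<forall>K'. face_less K' C \<and> \<not> face_le K' K \<and> \<not> face_le K K' \<longrightarrow>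
           (\<forall>x' \<in> perp_lattice K'. (+) x ` R K \<inter> (+) x' ` R K' = {}))}"

lemma translation_set_cong [fundef_cong]:
  assumes "C = C'" "K = K'" "\<And>J. J = K' \<or> face_less J C' \<Longrightarrow> R J = R' J"
  shows "translation_set R C K = translation_set R' C' K'"
  using assms by (simp add: translation_set_def cong: conj_cong)

function region :: "'a set \<Rightarrow> 'a set" where
  "region C =
     (if rational_cone \<Lambda> C \<and> pointed C then
        if C = {0} then T (perp_lattice {0})
        else (V - (\<Union>K\<in>{K. face_less K C}. translation_set region C K + region K))
               \<inter> (T (perp_lattice C) + span C) \<inter> CDC (polar C)
      else undefined)"
  by auto
termination
  by (relation "Wellfounded.measure (\<lambda>C. nat (aff_dim C))")
     (auto simp del: zless_nat_conj intro: face_less_aff_dim)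

declare region.simps [simp del]

definition dc_volume :: "'a set \<Rightarrow> real" where
  "dc_volume C = rel_vol \<Lambda> V (region C \<inter> DC (polar C))"

definition correction_volume :: "'a set \<Rightarrow> 'a set \<Rightarrow> real" where
  "correction_volume C K = rel_vol \<Lambda> (perp K) (region C \<inter> perp K \<inter> polar C)"

function mu_pointed :: "'a set \<Rightarrow> real" where
  "mu_pointed C =
     (if rational_cone \<Lambda> C \<and> pointed C then
        if C = {0} then 1
        else dc_volume C - (\<Sum>K\<in>{K. face_less K C}. correction_volume C K * mu_pointed K)
      else undefined)"
  by auto
termination
  by (relation "Wellfounded.measure (\<lambda>C. nat (aff_dim C))")
     (auto simp del: zless_nat_conj intro: face_less_aff_dim)

declare mu_pointed.simps [simp del]

end

definition lineality_space :: "'a::real_vector set \<Rightarrow> 'a set" where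
  "lineality_space C = (GREATEST S. subspace S \<and> S \<subseteq> C)"

definition mu :: "'a::euclidean_space set \<Rightarrow> 'a set \<Rightarrow> ('a set \<Rightarrow> 'a set) \<Rightarrow> 'a set \<Rightarrow> real" where
  "mu V \<Lambda> T C =
     (if pointed C then mu_pointed V \<Lambda> T C
      else let W = perp V (lineality_space C) in mu_pointed W (\<Lambda> \<inter> W) T (C \<inter> W))"

definition lattice_polytope :: "'a::euclidean_space set \<Rightarrow> 'a set \<Rightarrow> bool" where
  "lattice_polytope \<Lambda> P \<longleftrightarrow> (\<exists>S. finite S \<and> S \<noteq> {} \<and> S \<subseteq> \<Lambda> \<and> P = convex hull S)"

text \<open>
  For a nonempty face \<open>f\<close> of \<open>P\<close>, the inequalities define the same cone for every single \<open>s\<close> in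
  the relative interior of \<open>f\<close>.
\<close>

definition normal_cone :: "'a::euclidean_space set \<Rightarrow> 'a set \<Rightarrow> 'a set \<Rightarrow> 'a set" where
  "normal_cone V P f = {x \<in> V. \<forall>s \<in> rel_interior f. \<forall>y \<in> P. x \<bullet> (y - s) \<le> 0}"

end

theory Submission
  imports Defs
begin

text \<open>
  The translates \<open>x + R(K)\<close> with \<open>K \<le> C\<close> and \<open>x \<in> X\<^sub>K\<close> tile \<open>CDC(C\<^sup>\<or>)\<close>.  As the regions are bounded and
  a large dilate \<open>tP\<close> looks locally like the cone at one of its faces, translates of the regions of
  its normal cones also tile \<open>CDC(tP)\<close>.  Inside \<open>x + R(N\<^sub>f)\<close>, the sets \<open>tP\<close> and \<open>DC(tP)\<close> agree with
  \<open>x + N\<^sub>f\<^sup>\<or>\<close> and \<open>x + DC(N\<^sub>f\<^sup>\<or>)\<close>.  If \<open>n\<^sub>f\<close> translates of \<open>R(N\<^sub>f)\<close> occur, then adding volumes gives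
  \<open>|tP \<inter> \<Lambda>| = \<Sum>\<^sub>f n\<^sub>f v\<close> with \<open>v\<close> the DC-volume of \<open>N\<^sub>f\<close>, and \<open>vol(tg) = \<Sum>\<^sub>f n\<^sub>f w\<close> over the faces \<open>f\<close> of
  \<open>g\<close>, with \<open>w\<close> the correction volume of \<open>N\<^sub>f\<close> at \<open>N\<^sub>g\<close>.  The recursion for \<open>\<mu>\<close> turns this into
  \<open>|tP \<inter> \<Lambda>| = \<Sum>\<^sub>g \<mu>(N\<^sub>g) vol(g) t\<^bsup>dim g\<^esup>\<close> for all large \<open>t\<close>, and it remains to compare coefficients.
\<close>

section \<open>Volumes in lattice coordinates\<close>

text \<open>Both tilings are instances of one construction: a finite family of pointed rational
  cones, each with a lattice point as anchor. The faces of \<open>C\<close> with all anchors 0 give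
  the polar of \<open>C\<close>, the normal fan with anchors \<open>t\<close> times a lattice point
  of each face gives \<open>tP\<close>; disjointness, covering and the comparison of DC-sets are
  proved once for both. Boundedness of \<open>R(C)\<close> is itself deduced from the covering
  argument. To avoid a circle, that argument asks for bounds only on regions of cones that do not
  strictly contain the face at hand. The rank assumption enters by making inner products with a
  lattice vector rational up to a factor, so that normal cones are rational cones. Correction
  volumes live in lower dimension, and measurability in \<open>V\<close> says nothing about slices,
  so measurability on every affine subspace is carried through the recursion for regions. A polytope
  of lower dimension is moved by a lattice vector until its affine hull is a linear subspace; inside
  it the normal cones are pointed, in accordance with the definition of \<mu> on cones that are not
  pointed.\<close>

lemma emeasure_lborel_vimage_affine:
  fixes k t :: real
  assumes k: "k \<noteq> 0" and A: "A \<in> sets borel"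
  shows "emeasure lborel A = ennreal \<bar>k\<bar> * emeasure lborel ((\<lambda>x. t + k * x) -` A)"
proof -
  have "emeasure lborel A = emeasure (density (distr lborel borel (\<lambda>x. t + k * x)) (\<lambda>_. ennreal \<bar>k\<bar>)) A"
    using lborel_real_affine[OF k, of t] by simp
  also have "\<dots> = ennreal \<bar>k\<bar> * emeasure (distr lborel borel (\<lambda>x. t + k * x)) A"
    using A by (simp add: emeasure_density_const)
  also have "\<dots> = ennreal \<bar>k\<bar> * emeasure lborel ((\<lambda>x. t + k * x) -` A)"
    using A by (simp add: emeasure_distr)
  finally show ?thesis .
qed

abbreviation cmeas :: "'i set \<Rightarrow> ('i \<Rightarrow> real) measure" where
  "cmeas B \<equiv> (\<Pi>\<^sub>M b\<in>B. lborel)"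

interpretation lborel_prod: product_sigma_finite "\<lambda>_::'i. lborel :: real measure"
  by standard

lemma space_cmeas [simp]: "space (cmeas B) = extensional B"
  by (simp add: space_PiM PiE_def)

lemma measurable_affine_coords:
  "(\<lambda>c. \<lambda>b\<in>B. n b + k * c (h b)) \<in> cmeas (h ` B) \<rightarrow>\<^sub>M cmeas B"
  by (intro measurable_restrict) simp

text \<open>A product measure is determined by its values on boxes, where the one-dimensional affine
  rule applies to each factor. The reindexing \<open>h\<close> lets the same statement serve
  translations and dilations (\<open>h = id\<close>) and also the translations that remain when a
  linear map is read in coordinates indexed by another set.\<close>

lemma emeasure_vimage_affine_coords:
  fixes k :: real and B :: "'i set" and h :: "'i \<Rightarrow> 'j"
  assumes B: "finite B" and h: "inj_on h B" and k: "k \<noteq> 0" and A: "A \<in> sets (cmeas B)"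
  shows "emeasure (cmeas (h ` B)) ((\<lambda>c. \<lambda>b\<in>B. n b + k * c (h b)) -` A \<inter> space (cmeas (h ` B))) =
         ennreal (1 / \<bar>k\<bar> ^ card B) * emeasure (cmeas B) A"
proof -
  let ?f = "\<lambda>c. \<lambda>b\<in>B. n b + k * c (h b)" and ?M = "cmeas B" and ?N = "cmeas (h ` B)"
  let ?P = "scale_measure (ennreal (\<bar>k\<bar> ^ card B)) (distr ?N ?M ?f)"
  have f: "?f \<in> ?N \<rightarrow>\<^sub>M ?M" by (rule measurable_affine_coords)
  define g where "g = inv_into B h"
  have g: "g (h b) = b" if "b \<in> B" for b using that h by (simp add: g_def)
  have "?P = ?M"
  proof (rule lborel_prod.PiM_eqI[OF B])
    fix A :: "'i \<Rightarrow> real set" assume A: "\<And>b. b \<in> B \<Longrightarrow> A b \<in> sets lborel"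
    have m: "Pi\<^sub>E B A \<in> sets ?M" using A B by (intro sets_PiM_I_finite) auto
    have "emeasure ?P (Pi\<^sub>E B A) = ennreal (\<bar>k\<bar> ^ card B) * emeasure ?N (?f -` Pi\<^sub>E B A \<inter> space ?N)"
      using m f by (simp add: emeasure_distr del: space_cmeas)
    also have "?f -` Pi\<^sub>E B A \<inter> space ?N = Pi\<^sub>E (h ` B) (\<lambda>j. (\<lambda>x. n (g j) + k * x) -` A (g j))"
      by (auto simp: PiE_def Pi_def g)
    also have "emeasure ?N \<dots> = (\<Prod>j\<in>h ` B. emeasure lborel ((\<lambda>x. n (g j) + k * x) -` A (g j)))"
    proof (rule lborel_prod.emeasure_PiM)
      fix j assume "j \<in> h ` B"
      then show "(\<lambda>x. n (g j) + k * x) -` A (g j) \<in> sets lborel"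
        using A[of "g j"] measurable_sets[of "\<lambda>x. n (g j) + k * x" lborel borel "A (g j)"] g by auto
    qed (use B in auto)
    also have "\<dots> = (\<Prod>b\<in>B. emeasure lborel ((\<lambda>x. n b + k * x) -` A b))"
      by (simp add: prod.reindex[OF h] g)
    also have "ennreal (\<bar>k\<bar> ^ card B) * \<dots> = (\<Prod>b\<in>B. ennreal \<bar>k\<bar> * emeasure lborel ((\<lambda>x. n b + k * x) -` A b))"
      by (simp add: prod.distrib ennreal_power)
    also have "\<dots> = (\<Prod>b\<in>B. emeasure lborel (A b))"
      using A emeasure_lborel_vimage_affine[OF k] by (intro prod.cong) auto
    finally show "emeasure ?P (Pi\<^sub>E B A) = (\<Prod>b\<in>B. emeasure lborel (A b))" .
  qed simp
  then have "emeasure ?M A = emeasure ?P A" by simp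
  also have "\<dots> = ennreal (\<bar>k\<bar> ^ card B) * emeasure ?N (?f -` A \<inter> space ?N)"
    using A f by (simp add: emeasure_distr del: space_cmeas)
  finally have "emeasure ?M A = ennreal (\<bar>k\<bar> ^ card B) * emeasure ?N (?f -` A \<inter> space ?N)" .
  then have "ennreal (1 / \<bar>k\<bar> ^ card B) * emeasure ?M A =
     (ennreal (1 / \<bar>k\<bar> ^ card B) * ennreal (\<bar>k\<bar> ^ card B)) * emeasure ?N (?f -` A \<inter> space ?N)"
    by (simp only: mult.assoc)
  also have "ennreal (1 / \<bar>k\<bar> ^ card B) * ennreal (\<bar>k\<bar> ^ card B) = 1"
    using k by (simp add: ennreal_mult[symmetric])
  finally show ?thesis by (simp only: mult_1_left)
qed

lemma vimage_completion_sets: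
  assumes f: "f \<in> M \<rightarrow>\<^sub>M N"
    and null: "\<And>A. A \<in> null_sets N \<Longrightarrow> emeasure M (f -` A \<inter> space M) = 0"
    and A: "A \<in> sets (completion N)"
  shows "f -` A \<inter> space M \<in> sets (completion M)"
proof -
  have fc: "f \<in> completion M \<rightarrow>\<^sub>M N" by (rule measurable_completion[OF f])
  have "null_sets N \<subseteq> null_sets (distr (completion M) N f)"
    using null f fc by (auto simp: null_sets_def emeasure_distr)
  from completion.measurable_completion2[OF fc this] A show ?thesis
    by (metis measurable_sets space_completion)
qed

lemma emeasure_vimage_nn_integral:
  assumes "f \<in> M \<rightarrow>\<^sub>M N" "A \<in> sets N"
  shows "emeasure M (f -` A \<inter> space M) = (\<integral>\<^sup>+x. indicator A (f x) \<partial>M)"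
proof -
  have "(\<integral>\<^sup>+x. indicator A (f x) \<partial>M) = (\<integral>\<^sup>+x. indicator (f -` A \<inter> space M) x \<partial>M)"
    by (rule nn_integral_cong) (simp add: indicator_def)
  then show ?thesis using measurable_sets[OF assms] by simp
qed

text \<open>A set of the completion is squeezed between measurable sets \<open>S\<close> and
  \<open>S \<union> Z'\<close> of equal measure, for which the rule is given.\<close>

lemma emeasure_completion_vimage:
  assumes f: "f \<in> M \<rightarrow>\<^sub>M N"
    and eq: "\<And>A. A \<in> sets N \<Longrightarrow> emeasure M (f -` A \<inter> space M) = k * emeasure N A"
    and A: "A \<in> sets (completion N)"
  shows "emeasure (completion M) (f -` A \<inter> space M) = k * emeasure (completion N) A"
proof -
  obtain S Z Z' where AS: "A = S \<union> Z" "Z \<subseteq> Z'" "Z' \<in> null_sets N" "S \<in> sets N"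
    using A by (rule sets_completionE)
  have m: "f -` A \<inter> space M \<in> sets (completion M)"
    using A eq by (intro vimage_completion_sets[OF f]) (auto simp: null_sets_def)
  have 1: "emeasure (completion M) (f -` X \<inter> space M) = k * emeasure (completion N) X" if "X \<in> sets N" for X
    using that f eq by simp
  have "k * emeasure (completion N) S \<le> emeasure (completion M) (f -` A \<inter> space M)"
    unfolding 1[OF AS(4), symmetric] using m AS by (intro emeasure_mono) auto
  moreover have "emeasure (completion M) (f -` A \<inter> space M) \<le> emeasure (completion M) (f -` (S \<union> Z') \<inter> space M)"
    using AS f by (intro emeasure_mono) auto
  moreover have "\<dots> = k * emeasure (completion N) (S \<union> Z')"
    using AS by (intro 1) auto
  moreover have "emeasure (completion N) (S \<union> Z') = emeasure (completion N) S"
    using AS by (intro emeasure_Un_null_set) (auto simp: null_sets_completion_iff null_sets_def)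
  moreover have "emeasure (completion N) A = emeasure (completion N) S"
  proof (rule antisym)
    show "emeasure (completion N) S \<le> emeasure (completion N) A"
      using AS A by (intro emeasure_mono) auto
    have "emeasure (completion N) A \<le> emeasure (completion N) (S \<union> Z')"
      using AS by (intro emeasure_mono) auto
    then show "emeasure (completion N) A \<le> emeasure (completion N) S"
      using \<open>emeasure (completion N) (S \<union> Z') = emeasure (completion N) S\<close> by simp
  qed
  ultimately show ?thesis by (auto intro: antisym)
qed

section \<open>Measurability and measure of affine slices in coordinates\<close>

lemma space_coord_lebesgue [simp]: "space (coord_lebesgue B) = extensional B"
  by (simp add: coord_lebesgue_def)

text \<open>The measurability clause of \<open>fundamental_domain\<close> on its own. All affine
  subspaces are included because correction volumes measure slices of a region in lower dimension,
  and Lebesgue measurability in the whole space does not pass to such slices.\<close>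

definition lebesgue_sliced :: "'a::euclidean_space set \<Rightarrow> bool" where
  "lebesgue_sliced A \<longleftrightarrow> (\<forall>x B. independent B \<longrightarrow> coord_set B x A \<in> sets (coord_lebesgue B))"

lemma coord_set_Int: "coord_set B x (A \<inter> A') = coord_set B x A \<inter> coord_set B x A'"
  and coord_set_Diff: "coord_set B x (A - A') = coord_set B x A - coord_set B x A'"
  and coord_set_UN: "coord_set B x (\<Union>i\<in>I. F i) = (\<Union>i\<in>I. coord_set B x (F i))"
  by (auto simp: coord_set_def)

lemma coord_set_translation: "coord_set B x ((+) y ` A) = coord_set B (x - y) A"
proof -
  have "x + s \<in> (+) y ` A \<longleftrightarrow> x - y + s \<in> A" for s
    by (auto simp: image_iff algebra_simps) (metis add.commute diff_add_cancel)
  then show ?thesis by (simp add: coord_set_def)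
qed

lemma lebesgue_sliced_Int: "lebesgue_sliced A \<Longrightarrow> lebesgue_sliced A' \<Longrightarrow> lebesgue_sliced (A \<inter> A')"
  and lebesgue_sliced_Diff: "lebesgue_sliced A \<Longrightarrow> lebesgue_sliced A' \<Longrightarrow> lebesgue_sliced (A - A')"
  by (auto simp: lebesgue_sliced_def coord_set_Int coord_set_Diff)

lemma lebesgue_sliced_UN:
  "countable I \<Longrightarrow> (\<And>i. i \<in> I \<Longrightarrow> lebesgue_sliced (F i)) \<Longrightarrow> lebesgue_sliced (\<Union>i\<in>I. F i)"
  by (auto simp: lebesgue_sliced_def coord_set_UN intro!: sets.countable_UN')

lemma lebesgue_sliced_translation: "lebesgue_sliced A \<Longrightarrow> lebesgue_sliced ((+) y ` A)"
  by (simp add: lebesgue_sliced_def coord_set_translation)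

lemma lebesgue_sliced_borel:
  assumes "A \<in> sets borel" shows "lebesgue_sliced A"
  unfolding lebesgue_sliced_def
proof (intro allI impI)
  fix x :: 'a and B :: "'a set" assume "independent B"
  have "(\<lambda>c. x + (\<Sum>b\<in>B. c b *\<^sub>R b)) \<in> cmeas B \<rightarrow>\<^sub>M borel"
    by measurable
  from measurable_sets[OF this assms]
  have "coord_set B x A \<in> sets (cmeas B)"
    by (simp add: coord_set_def vimage_def Int_def conj_commute)
  then show "coord_set B x A \<in> sets (coord_lebesgue B)"
    by (simp add: coord_lebesgue_def)
qed

text \<open>Moving the origin along the span only shifts the coordinates. The factor
  \<open>1 *\<close> brings the shift into the affine form treated above.\<close>

lemma coord_set_affine_vimage:
  "coord_set B (x + (\<Sum>b\<in>B. n b *\<^sub>R b)) A =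
     (\<lambda>c. \<lambda>b\<in>B. n b + 1 * c b) -` coord_set B x A \<inter> space (cmeas B)"
  by (auto simp: coord_set_def scaleR_add_left sum.distrib algebra_simps)

lemma emeasure_coord_set_origin:
  assumes B: "finite B" and A: "coord_set B x A \<in> sets (coord_lebesgue B)" and y: "y - x \<in> span B"
  shows "emeasure (coord_lebesgue B) (coord_set B y A) = emeasure (coord_lebesgue B) (coord_set B x A)"
proof -
  obtain n where n: "y - x = (\<Sum>b\<in>B. n b *\<^sub>R b)"
    using y B by (auto simp: span_finite)
  then have y': "y = x + (\<Sum>b\<in>B. n b *\<^sub>R b)" by (simp add: algebra_simps)
  show ?thesis
    unfolding y' coord_set_affine_vimage unfolding coord_lebesgue_def
    using emeasure_completion_vimage[OF measurable_affine_coords[where h = id], of B n 1 1]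
      emeasure_vimage_affine_coords[OF B inj_on_id, of 1 _ n] A
    by (simp add: coord_lebesgue_def)
qed

lemma emeasure_coord_set_scaleR:
  assumes B: "finite B" and A: "coord_set B 0 A \<in> sets (coord_lebesgue B)" and k: "k \<noteq> 0"
  shows "emeasure (coord_lebesgue B) (coord_set B 0 ((*\<^sub>R) k ` A)) =
     ennreal (\<bar>k\<bar> ^ card B) * emeasure (coord_lebesgue B) (coord_set B 0 A)"
proof -
  have "x \<in> (*\<^sub>R) k ` A \<longleftrightarrow> (1/k) *\<^sub>R x \<in> A" for x
    using k by (auto simp: image_iff intro!: bexI[of _ "(1/k) *\<^sub>R x"])
  moreover have "(1/k) *\<^sub>R (\<Sum>b\<in>B. c b *\<^sub>R b) = (\<Sum>b\<in>B. ((1/k) * c b) *\<^sub>R b)" for c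
    by (simp add: scaleR_sum_right)
  ultimately have "coord_set B 0 ((*\<^sub>R) k ` A) = (\<lambda>c. \<lambda>b\<in>B. 0 + (1/k) * c b) -` coord_set B 0 A \<inter> space (cmeas B)"
    by (auto simp: coord_set_def)
  also have "emeasure (coord_lebesgue B) \<dots> = ennreal (1 / \<bar>1/k\<bar> ^ card B) * emeasure (coord_lebesgue B) (coord_set B 0 A)"
    unfolding coord_lebesgue_def
    using k emeasure_vimage_affine_coords[OF B inj_on_id, of "1/k" _ "\<lambda>_. 0"] A
      emeasure_completion_vimage[OF measurable_affine_coords[where h = id], of B "\<lambda>_. 0" "1/k"]
    by (simp add: coord_lebesgue_def)
  finally show ?thesis using k by (simp add: power_divide)
qed

text \<open>The dual basis of \<open>B\<close>, extended to linear functionals on the whole space.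
  It turns statements on coordinates (bounded, integral, rational) into statements on linear
  maps.\<close>

lemma dual_coords:
  fixes B :: "'a::euclidean_space set"
  assumes B: "independent B"
  obtains \<gamma> :: "'a \<Rightarrow> 'a \<Rightarrow> real"
  where "\<And>b. linear (\<gamma> b)"
    "\<And>b c. b \<in> B \<Longrightarrow> \<gamma> b (\<Sum>b'\<in>B. c b' *\<^sub>R b') = c b"
    "\<And>v. v \<in> span B \<Longrightarrow> v = (\<Sum>b\<in>B. \<gamma> b v *\<^sub>R b)"
proof -
  have fin: "finite B" using B by (rule finiteI_independent)
  have "\<exists>g :: 'a \<Rightarrow> real. linear g \<and> (\<forall>b'\<in>B. g b' = (if b' = b then 1 else 0))" for b
    using linear_independent_extend[OF B, of "\<lambda>b'. if b' = b then 1 else 0"] by blast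
  then obtain \<gamma> :: "'a \<Rightarrow> 'a \<Rightarrow> real"
    where \<gamma>: "\<And>b. linear (\<gamma> b)" "\<And>b b'. b' \<in> B \<Longrightarrow> \<gamma> b b' = (if b' = b then 1 else 0)"
    by metis
  have coord: "\<gamma> b (\<Sum>b'\<in>B. c b' *\<^sub>R b') = c b" if "b \<in> B" for b c
  proof -
    have "\<gamma> b (\<Sum>b'\<in>B. c b' *\<^sub>R b') = (\<Sum>b'\<in>B. c b' * \<gamma> b b')"
      by (simp add: linear_sum[OF \<gamma>(1)] linear_cmul[OF \<gamma>(1)])
    also have "\<dots> = c b"
      using fin that by (simp add: \<gamma>(2) if_distrib[of "(*) _"] cong: if_cong)
    finally show ?thesis .
  qed
  moreover have "v = (\<Sum>b\<in>B. \<gamma> b v *\<^sub>R b)" if v: "v \<in> span B" for v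
  proof -
    obtain c where c: "v = (\<Sum>b\<in>B. c b *\<^sub>R b)" using v fin by (auto simp: span_finite)
    then show ?thesis using coord[of _ c] by simp
  qed
  ultimately show ?thesis using that \<gamma>(1) by blast
qed

lemma bounded_coords:
  fixes B :: "'a::euclidean_space set"
  assumes B: "independent B" and A: "bounded A"
  obtains k where "\<And>b c. b \<in> B \<Longrightarrow> x + (\<Sum>b\<in>B. c b *\<^sub>R b) \<in> A \<Longrightarrow> \<bar>c b\<bar> \<le> k b"
proof -
  obtain \<gamma> :: "'a \<Rightarrow> 'a \<Rightarrow> real" where \<gamma>: "\<And>b. linear (\<gamma> b)"
    "\<And>b c. b \<in> B \<Longrightarrow> \<gamma> b (\<Sum>b'\<in>B. c b' *\<^sub>R b') = c b"
    using dual_coords[OF B] by metis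
  have "\<exists>k. \<forall>c. x + (\<Sum>b\<in>B. c b *\<^sub>R b) \<in> A \<longrightarrow> \<bar>c b\<bar> \<le> k" if b: "b \<in> B" for b
  proof -
    obtain K where K: "\<And>v. norm (\<gamma> b v) \<le> norm v * K"
      using linear_bounded[OF \<gamma>(1)] by (auto simp: mult.commute)
    obtain a where a: "\<And>v. v \<in> A \<Longrightarrow> norm v \<le> a" using A by (auto simp: bounded_iff)
    show ?thesis
    proof (intro exI allI impI)
      fix c assume m: "x + (\<Sum>b\<in>B. c b *\<^sub>R b) \<in> A"
      have "\<bar>c b\<bar> \<le> norm (\<Sum>b'\<in>B. c b' *\<^sub>R b') * K" using K[of "\<Sum>b'\<in>B. c b' *\<^sub>R b'"] \<gamma>(2)[OF b] by simp
      also have "norm (\<Sum>b'\<in>B. c b' *\<^sub>R b') \<le> norm x + a"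
        using a[OF m] norm_triangle_ineq4[of "x + (\<Sum>b\<in>B. c b *\<^sub>R b)" x] by simp
      then have "norm (\<Sum>b'\<in>B. c b' *\<^sub>R b') * K \<le> (norm x + a) * \<bar>K\<bar>"
        by (intro order_trans[OF mult_left_mono[OF abs_ge_self] mult_right_mono]) auto
      finally show "\<bar>c b\<bar> \<le> (norm x + a) * \<bar>K\<bar>" .
    qed
  qed
  then show ?thesis using that by metis
qed

lemma emeasure_coord_set_bounded:
  assumes B: "independent B" and A: "bounded A"
  shows "emeasure (coord_lebesgue B) (coord_set B x A) < \<infinity>"
proof -
  have fin: "finite B" using B by (rule finiteI_independent)
  obtain k where k: "\<And>b c. b \<in> B \<Longrightarrow> x + (\<Sum>b\<in>B. c b *\<^sub>R b) \<in> A \<Longrightarrow> \<bar>c b\<bar> \<le> k b"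
    using bounded_coords[OF assms] by metis
  let ?C = "Pi\<^sub>E B (\<lambda>b. {- k b..k b})"
  have C: "?C \<in> sets (cmeas B)" using fin by (intro sets_PiM_I_finite) auto
  have "coord_set B x A \<subseteq> ?C" using k by (force simp: coord_set_def PiE_def Pi_def abs_le_iff)
  then have "emeasure (coord_lebesgue B) (coord_set B x A) \<le> emeasure (coord_lebesgue B) ?C"
    using C by (intro emeasure_mono) (auto simp: coord_lebesgue_def)
  also have "\<dots> = (\<Prod>b\<in>B. emeasure lborel {- k b..k b})"
    using C fin by (simp add: coord_lebesgue_def lborel_prod.emeasure_PiM)
  also have "\<dots> < \<infinity>"
    by (simp add: less_top[symmetric] ennreal_prod_eq_top emeasure_lborel_Icc_eq del: emeasure_lborel_Icc)
  finally show ?thesis .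
qed

lemma coord_set_sets_origin:
  assumes B: "finite B" and A: "coord_set B x A \<in> sets (coord_lebesgue B)" and y: "y - x \<in> span B"
  shows "coord_set B y A \<in> sets (coord_lebesgue B)"
proof -
  obtain n where n: "y - x = (\<Sum>b\<in>B. n b *\<^sub>R b)"
    using y B by (auto simp: span_finite)
  then have y': "y = x + (\<Sum>b\<in>B. n b *\<^sub>R b)" by (simp add: algebra_simps)
  show ?thesis
    unfolding y' coord_set_affine_vimage unfolding coord_lebesgue_def
    using vimage_completion_sets[OF measurable_affine_coords[where h = id], of B n 1]
      emeasure_vimage_affine_coords[OF B inj_on_id, of 1 _ n] A
    by (simp add: coord_lebesgue_def null_sets_def)
qed

text \<open>After a shear in coordinates, the preimage becomes a cylinder, and Fubini applies.\<close>

lemma lebesgue_sliced_linear_vimage: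
  fixes \<pi> :: "'a::euclidean_space \<Rightarrow> 'a"
  assumes \<pi>: "linear \<pi>" and D: "lebesgue_sliced D"
  shows "lebesgue_sliced (\<pi> -` D)"
  unfolding lebesgue_sliced_def
proof (intro allI impI)
  fix x and B :: "'a set" assume iB: "independent B"
  then have fB: "finite B" by (rule finiteI_independent)
  obtain B' where B': "B' \<subseteq> \<pi> ` B" "independent B'" "\<pi> ` B \<subseteq> span B'"
    using maximal_independent_subset[of "\<pi> ` B"] by metis
  have fB': "finite B'" using B'(2) by (rule finiteI_independent)
  have "\<forall>b'\<in>B'. \<exists>b\<in>B. \<pi> b = b'" using B'(1) by force
  then obtain h where h: "\<And>b'. b' \<in> B' \<Longrightarrow> h b' \<in> B \<and> \<pi> (h b') = b'" by metis
  have hi: "inj_on h B'" by (rule inj_on_inverseI[of _ \<pi>]) (use h in auto)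
  define J where "J = B - h ` B'"
  have JB: "J \<inter> h ` B' = {}" "J \<union> h ` B' = B" "finite J" using h fB by (auto simp: J_def)
  have "\<forall>b\<in>J. \<exists>m. \<pi> b = (\<Sum>b'\<in>B'. m b' *\<^sub>R b')"
    using B'(3) fB' by (auto simp: span_finite J_def)
  then obtain m where m: "\<And>b. b \<in> J \<Longrightarrow> \<pi> b = (\<Sum>b'\<in>B'. m b b' *\<^sub>R b')" by metis
  \<comment> \<open>\<open>F\<close> is \<open>\<pi>\<close> in coordinates. For fixed coordinates
    in \<open>J\<close> it is a translation of the remaining ones, up to renaming by
    \<open>h\<close>.\<close>
  define F where "F = (\<lambda>c. \<lambda>b'\<in>B'. c (h b') + (\<Sum>b\<in>J. c b * m b b'))"
  have F: "F \<in> cmeas B \<rightarrow>\<^sub>M cmeas B'"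
    unfolding F_def using h by (intro measurable_restrict) (auto simp: J_def)
  have eq: "\<pi> (x + (\<Sum>b\<in>B. c b *\<^sub>R b)) = \<pi> x + (\<Sum>b'\<in>B'. F c b' *\<^sub>R b')" for c
  proof -
    have "\<pi> (\<Sum>b\<in>B. c b *\<^sub>R b) = (\<Sum>b\<in>B. c b *\<^sub>R \<pi> b)"
      by (simp add: linear_sum[OF \<pi>] linear_cmul[OF \<pi>])
    also have "\<dots> = (\<Sum>b\<in>J. c b *\<^sub>R \<pi> b) + (\<Sum>b\<in>h ` B'. c b *\<^sub>R \<pi> b)"
      using JB fB' by (subst JB(2)[symmetric], subst sum.union_disjoint) auto
    also have "(\<Sum>b\<in>h ` B'. c b *\<^sub>R \<pi> b) = (\<Sum>b'\<in>B'. c (h b') *\<^sub>R b')"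
      using h by (simp add: sum.reindex[OF hi])
    also have "(\<Sum>b\<in>J. c b *\<^sub>R \<pi> b) = (\<Sum>b'\<in>B'. (\<Sum>b\<in>J. c b * m b b') *\<^sub>R b')"
      by (simp add: m scaleR_sum_right scaleR_sum_left) (rule sum.swap)
    finally show ?thesis
      by (simp add: linear_add[OF \<pi>] F_def scaleR_add_left sum.distrib add.commute)
  qed
  have *: "coord_set B x (\<pi> -` D) = F -` coord_set B' (\<pi> x) D \<inter> space (cmeas B)"
    by (auto simp: coord_set_def eq F_def)
  \<comment> \<open>\<open>F\<close> is measurable for the product measures; to be so for the
    completions it only has to pull back null sets to null sets.\<close>
  have "emeasure (cmeas B) (F -` A \<inter> space (cmeas B)) = 0" if A: "A \<in> null_sets (cmeas B')" for A
  proof -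
    have A': "A \<in> sets (cmeas B')" "emeasure (cmeas B') A = 0" using A by auto
    have "emeasure (cmeas B) (F -` A \<inter> space (cmeas B)) = (\<integral>\<^sup>+c. indicator A (F c) \<partial>cmeas B)"
      by (rule emeasure_vimage_nn_integral[OF F A'(1)])
    also have "\<dots> = (\<integral>\<^sup>+ s. (\<integral>\<^sup>+ y. indicator A (F (merge J (h ` B') (s, y))) \<partial>cmeas (h ` B')) \<partial>cmeas J)"
    proof -
      have "(\<lambda>c. indicator A (F c) :: ennreal) \<in> borel_measurable (cmeas (J \<union> h ` B'))"
        unfolding JB(2) using F A' by measurable
      from lborel_prod.product_nn_integral_fold[OF JB(1,3) _ this] fB' show ?thesis
        by (simp add: JB(2))
    qed
    also have "\<dots> = (\<integral>\<^sup>+ s. 0 \<partial>cmeas J)"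
    proof (rule nn_integral_cong)
      fix s
      let ?n = "\<lambda>b'. \<Sum>b\<in>J. s b * m b b'"
      let ?G = "\<lambda>c. \<lambda>b'\<in>B'. ?n b' + 1 * c (h b')"
      have "F (merge J (h ` B') (s, y)) = ?G y" for y
        using JB(1) by (auto simp: F_def merge_def fun_eq_iff restrict_def disjoint_iff)
      then have "(\<integral>\<^sup>+ y. indicator A (F (merge J (h ` B') (s, y))) \<partial>cmeas (h ` B')) =
          (\<integral>\<^sup>+ y. indicator A (?G y) \<partial>cmeas (h ` B'))" by simp
      also have "\<dots> = emeasure (cmeas (h ` B')) (?G -` A \<inter> space (cmeas (h ` B')))"
        by (rule emeasure_vimage_nn_integral[OF measurable_affine_coords A'(1), symmetric])
      also have "\<dots> = 0"
        using emeasure_vimage_affine_coords[OF fB' hi _ A'(1), of 1 ?n] A'(2) by simp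
      finally show "(\<integral>\<^sup>+ y. indicator A (F (merge J (h ` B') (s, y))) \<partial>cmeas (h ` B')) = 0" .
    qed
    finally show ?thesis by simp
  qed
  then show "coord_set B x (\<pi> -` D) \<in> sets (coord_lebesgue B)"
    unfolding * coord_lebesgue_def using D B'(2)
    by (intro vimage_completion_sets[OF F]) (simp_all add: coord_lebesgue_def lebesgue_sliced_def)
qed

section \<open>Lattice bases and fundamental domains\<close>

lemma lattice_basisD:
  assumes "lattice_basis B L"
  shows "B \<subseteq> L" "L \<subseteq> span B" "0 \<in> L" "x \<in> L \<Longrightarrow> y \<in> L \<Longrightarrow> x - y \<in> L" "x \<in> L \<Longrightarrow> y \<in> L \<Longrightarrow> x + y \<in> L"
    "x \<in> L \<Longrightarrow> - x \<in> L" "countable L" "finite B" "independent B" "span L = span B"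
proof -
  show iB: "independent B" using assms by (simp add: lattice_basis_def)
  then show fB: "finite B" by (rule finiteI_independent)
  have L: "L = range (\<lambda>c. \<Sum>b\<in>B. real_of_int (c b) *\<^sub>R b)" using assms by (simp add: lattice_basis_def)
  show BL: "B \<subseteq> L"
  proof
    fix b assume "b \<in> B"
    then have "b = (\<Sum>b'\<in>B. real_of_int (if b' = b then 1 else 0) *\<^sub>R b')"
      using fB by (simp add: if_distrib[of "\<lambda>x. x *\<^sub>R _"] if_distrib[of real_of_int] cong: if_cong)
    then show "b \<in> L" unfolding L by (rule range_eqI[of _ _ "\<lambda>b'. if b' = b then 1 else 0"])
  qed
  show LB: "L \<subseteq> span B" unfolding L by (auto intro: span_sum span_scale span_base)
  show "span L = span B"
    by (simp add: LB BL span_mono span_subspace subset_antisym)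
  show z: "0 \<in> L" unfolding L by (rule range_eqI[of _ _ "\<lambda>_. 0"]) simp
  show d: "x - y \<in> L" if xL: "x \<in> L" and yL: "y \<in> L" for x y
  proof -
    obtain c where x: "x = (\<Sum>b\<in>B. real_of_int (c b) *\<^sub>R b)"
      using xL unfolding L by (rule rangeE)
    obtain d where y: "y = (\<Sum>b\<in>B. real_of_int (d b) *\<^sub>R b)"
      using yL unfolding L by (rule rangeE)
    have "x - y = (\<Sum>b\<in>B. real_of_int (c b - d b) *\<^sub>R b)"
      by (simp add: x y scaleR_diff_left sum_subtractf)
    then show ?thesis unfolding L by (rule range_eqI[of _ _ "\<lambda>b. c b - d b"])
  qed
  show m: "- x \<in> L" if "x \<in> L" for x using d[OF z that] by simp
  show "x + y \<in> L" if "x \<in> L" "y \<in> L" using d[OF that(1) m[OF that(2)]] by simp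
  have "L \<subseteq> (\<lambda>c. \<Sum>b\<in>B. real_of_int (c b) *\<^sub>R b) ` (Pi\<^sub>E B (\<lambda>_. UNIV))"
    unfolding L
  proof (rule image_subsetI)
    fix c :: "'a \<Rightarrow> int"
    show "(\<Sum>b\<in>B. real_of_int (c b) *\<^sub>R b) \<in> (\<lambda>c. \<Sum>b\<in>B. real_of_int (c b) *\<^sub>R b) ` (Pi\<^sub>E B (\<lambda>_. UNIV))"
      by (rule image_eqI[of _ _ "restrict c B"]) auto
  qed
  moreover have "countable (Pi\<^sub>E B (\<lambda>_. UNIV :: int set))" using fB by (simp add: countable_PiE)
  ultimately show "countable L" by (meson countable_image countable_subset)
qed

text \<open>Cut \<open>D\<close> along the tiling by \<open>E\<close> and move each piece
  \<open>D \<inter> (x + E)\<close> back by \<open>x\<close>. The results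
  \<open>E \<inter> (-x + D)\<close> are the pieces of \<open>E\<close> cut along the tiling by
  \<open>D\<close>, since negation permutes \<open>L\<close>.\<close>

lemma lattice_tilings_emeasure_eq:
  assumes B: "lattice_basis B L"
    and D: "D \<subseteq> span B" "coord_set B 0 D \<in> sets (coord_lebesgue B)"
      "disjoint_family_on (\<lambda>x. (+) x ` D) L" "(\<Union>x\<in>L. (+) x ` D) = span B"
    and E: "E \<subseteq> span B" "coord_set B 0 E \<in> sets (coord_lebesgue B)"
      "disjoint_family_on (\<lambda>x. (+) x ` E) L" "(\<Union>x\<in>L. (+) x ` E) = span B"
  shows "emeasure (coord_lebesgue B) (coord_set B 0 D) = emeasure (coord_lebesgue B) (coord_set B 0 E)"
proof -
  note L = lattice_basisD[OF B]
  let ?m = "\<lambda>A. emeasure (coord_lebesgue B) (coord_set B 0 A)"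
  have sets: "coord_set B 0 ((+) x ` A) \<in> sets (coord_lebesgue B)"
    if "x \<in> L" "coord_set B 0 A \<in> sets (coord_lebesgue B)" for x A
    unfolding coord_set_translation
    using that L(2) coord_set_sets_origin[OF L(8), of 0 A "0 - x"] by (auto simp: span_neg)
  have sum: "?m A = (\<integral>\<^sup>+x. ?m (A \<inter> (+) x ` F) \<partial>count_space L)"
    if "A \<subseteq> span B" "coord_set B 0 A \<in> sets (coord_lebesgue B)" "coord_set B 0 F \<in> sets (coord_lebesgue B)"
      "disjoint_family_on (\<lambda>x. (+) x ` F) L" "(\<Union>x\<in>L. (+) x ` F) = span B" for A F
  proof -
    have "A = A \<inter> (\<Union>x\<in>L. (+) x ` F)" using that by auto
    then have A: "A = (\<Union>x\<in>L. A \<inter> (+) x ` F)" by (simp only: Int_UN_distrib)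
    have "disjoint_family_on (\<lambda>x. coord_set B 0 (A \<inter> (+) x ` F)) L"
      using that(4) by (fastforce simp: disjoint_family_on_def coord_set_def)
    moreover have "coord_set B 0 (A \<inter> (+) x ` F) \<in> sets (coord_lebesgue B)" if "x \<in> L" for x
      using sets[OF that] \<open>coord_set B 0 A \<in> _\<close> \<open>coord_set B 0 F \<in> _\<close> by (simp add: coord_set_Int)
    ultimately have "emeasure (coord_lebesgue B) (\<Union>x\<in>L. coord_set B 0 (A \<inter> (+) x ` F)) =
        (\<integral>\<^sup>+x. ?m (A \<inter> (+) x ` F) \<partial>count_space L)"
      using L(7) by (intro emeasure_UN_countable)
    then show ?thesis by (metis A coord_set_UN)
  qed
  have "?m D = (\<integral>\<^sup>+x. ?m (D \<inter> (+) x ` E) \<partial>count_space L)" using D E by (intro sum)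
  also have "\<dots> = (\<integral>\<^sup>+x. ?m (E \<inter> (+) (- x) ` D) \<partial>count_space L)"
  proof (rule nn_integral_cong)
    fix x assume "x \<in> space (count_space L)"
    then have x: "x \<in> L" by simp
    have "E \<inter> (+) (- x) ` D = (+) (- x) ` (D \<inter> (+) x ` E)"
    proof (intro set_eqI iffI)
      fix v assume v: "v \<in> E \<inter> (+) (- x) ` D"
      then obtain d where d: "d \<in> D" "v = - x + d" "v \<in> E" by auto
      then have "d = x + v" by simp
      with d show "v \<in> (+) (- x) ` (D \<inter> (+) x ` E)" by blast
    next
      fix v assume "v \<in> (+) (- x) ` (D \<inter> (+) x ` E)"
      then show "v \<in> E \<inter> (+) (- x) ` D" by auto
    qed
    moreover have "coord_set B 0 (D \<inter> (+) x ` E) \<in> sets (coord_lebesgue B)"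
      using D E sets x by (simp add: coord_set_Int)
    moreover have "x \<in> span B" using x L(2) by auto
    ultimately show "?m (D \<inter> (+) x ` E) = ?m (E \<inter> (+) (- x) ` D)"
      using emeasure_coord_set_origin[OF L(8), of 0 "D \<inter> (+) x ` E" x]
      by (simp only: coord_set_translation diff_minus_eq_add add_0_left diff_0_right)
  qed
  also have "\<dots> = (\<integral>\<^sup>+x. ?m (E \<inter> (+) x ` D) \<partial>count_space L)"
  proof -
    have "bij_betw uminus L L"
      by (rule bij_betwI[of _ _ _ uminus]) (use L(6) in auto)
    from nn_integral_bij_count_space[OF this, of "\<lambda>x. ?m (E \<inter> (+) x ` D)"] show ?thesis .
  qed
  also have "\<dots> = ?m E" using D E by (intro sum[symmetric])
  finally show ?thesis .
qed

lemma unique_coords: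
  fixes B :: "'a::euclidean_space set"
  assumes "independent B" "(\<Sum>b\<in>B. c b *\<^sub>R b) = (\<Sum>b\<in>B. c' b *\<^sub>R b)" "b \<in> B"
  shows "c b = c' b"
proof -
  have "(\<Sum>b\<in>B. (c b - c' b) *\<^sub>R b) = 0"
    using assms(2) by (simp add: scaleR_diff_left sum_subtractf)
  then show ?thesis using independentD[OF assms(1) finiteI_independent[OF assms(1)] subset_refl _ assms(3)] by force
qed

text \<open>Any fundamental domain has the volume of the half-open parallelepiped of a lattice
  basis, whose coordinate set is the unit cube. This justifies the normalization of
  \<open>rel_vol\<close>.\<close>

lemma emeasure_fundamental_domain:
  assumes B: "lattice_basis B L" and D: "fundamental_domain L D"
  shows "emeasure (coord_lebesgue B) (coord_set B 0 D) = 1"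
proof -
  note L = lattice_basisD[OF B]
  define f where "f = (\<lambda>c. \<Sum>b\<in>B. c b *\<^sub>R b)"
  define E where "E = f ` {c. \<forall>b\<in>B. 0 \<le> c b \<and> c b < 1}"
  have inj: "c b = c' b" if "f c = f c'" "b \<in> B" for c c' b
    using unique_coords[OF L(9)] that by (simp add: f_def)
  have Lf: "L = range (\<lambda>n. f (\<lambda>b. real_of_int (n b)))" using B by (simp add: lattice_basis_def f_def)
  have add: "f c + f c' = f (\<lambda>b. c b + c' b)" for c c' by (simp add: f_def scaleR_add_left sum.distrib)
  have spn: "span B = range f" using L(8) by (simp add: span_finite f_def)
  have EC: "coord_set B 0 E = Pi\<^sub>E B (\<lambda>_. {0..<1})"
  proof -
    have "c \<in> Pi\<^sub>E B (\<lambda>_. {0..<1})" if cE: "c \<in> coord_set B 0 E" for c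
    proof -
      obtain c' where "f c = f c'" "\<And>b. b\<in>B \<Longrightarrow> 0 \<le> c' b \<and> c' b < 1" "c \<in> extensional B"
        using cE by (auto simp: coord_set_def E_def f_def)
      then show ?thesis using inj[of c c'] by (auto simp: PiE_def)
    qed
    moreover have "c \<in> coord_set B 0 E" if "c \<in> Pi\<^sub>E B (\<lambda>_. {0..<1})" for c
      using that by (auto simp: coord_set_def E_def f_def PiE_def Pi_def)
    ultimately show ?thesis by blast
  qed
  have box: "Pi\<^sub>E B (\<lambda>_. {0..<1::real}) \<in> sets (cmeas B)"
    using L(8) by (intro sets_PiM_I_finite) auto
  have "emeasure (coord_lebesgue B) (coord_set B 0 D) = emeasure (coord_lebesgue B) (coord_set B 0 E)"
  proof (rule lattice_tilings_emeasure_eq[OF B])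
    show "D \<subseteq> span B" "coord_set B 0 D \<in> sets (coord_lebesgue B)"
      "disjoint_family_on (\<lambda>x. (+) x ` D) L" "(\<Union>x\<in>L. (+) x ` D) = span B"
      using D L(9,10) by (auto simp: fundamental_domain_def)
    show "E \<subseteq> span B" unfolding spn E_def by auto
    show "coord_set B 0 E \<in> sets (coord_lebesgue B)"
      using box by (simp add: EC coord_lebesgue_def)
    show "disjoint_family_on (\<lambda>x. (+) x ` E) L"
      unfolding disjoint_family_on_def
    proof (intro ballI impI, rule ccontr)
      fix x y assume xy: "x \<in> L" "y \<in> L" "x \<noteq> y" "(+) x ` E \<inter> (+) y ` E \<noteq> {}"
      obtain n m :: "'a \<Rightarrow> int" where nm: "x = f (\<lambda>b. real_of_int (n b))" "y = f (\<lambda>b. real_of_int (m b))"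
        using xy(1,2) unfolding Lf by blast
      obtain c d where cd: "\<And>b. b \<in> B \<Longrightarrow> 0 \<le> c b \<and> c b < 1" "\<And>b. b \<in> B \<Longrightarrow> 0 \<le> d b \<and> d b < 1" "x + f c = y + f d"
        using xy(4) by (auto simp: E_def)
      have "n b = m b" if "b \<in> B" for b
        using inj[OF cd(3)[unfolded nm add] that] cd(1,2)[OF that] by linarith
      then have "x = y" by (simp add: nm f_def)
      with xy show False by simp
    qed
    show "(\<Union>x\<in>L. (+) x ` E) = span B"
    proof
      show "(\<Union>x\<in>L. (+) x ` E) \<subseteq> span B"
        using L(2) \<open>E \<subseteq> span B\<close> by (auto intro!: span_add)
      show "span B \<subseteq> (\<Union>x\<in>L. (+) x ` E)"
      proof
        fix v assume "v \<in> span B"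
        then obtain c where c: "v = f c" using spn by auto
        have "v = f (\<lambda>b. real_of_int \<lfloor>c b\<rfloor>) + f (\<lambda>b. frac (c b))"
          unfolding c add by (simp add: frac_def)
        moreover have "f (\<lambda>b. real_of_int \<lfloor>c b\<rfloor>) \<in> L"
          unfolding Lf by (rule range_eqI[of _ _ "\<lambda>b. \<lfloor>c b\<rfloor>"]) (rule refl)
        moreover have "f (\<lambda>b. frac (c b)) \<in> E" unfolding E_def by (rule imageI) (simp add: frac_lt_1)
        ultimately show "v \<in> (\<Union>x\<in>L. (+) x ` E)" by blast
      qed
    qed
  qed
  also have "\<dots> = 1"
    using L(8) box by (simp add: EC coord_lebesgue_def lborel_prod.emeasure_PiM)
  finally show ?thesis .
qed

section \<open>Volumes relative to a lattice subspace\<close>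

definition lattice_subspace :: "'a::euclidean_space set \<Rightarrow> 'a set \<Rightarrow> bool" where
  "lattice_subspace \<Lambda> S \<longleftrightarrow> subspace S \<and> is_lattice (\<Lambda> \<inter> S) \<and> span (\<Lambda> \<inter> S) = S"

text \<open>Chosen by the same \<open>SOME\<close> term as in \<open>rel_vol\<close>, so that the
  two volumes can be identified by rewriting.\<close>

definition subspace_basis :: "'a::euclidean_space set \<Rightarrow> 'a set \<Rightarrow> 'a set" where
  "subspace_basis \<Lambda> S = (SOME B. lattice_basis B (\<Lambda> \<inter> S))"

definition subspace_vol :: "'a::euclidean_space set \<Rightarrow> 'a set \<Rightarrow> 'a set \<Rightarrow> real" where
  "subspace_vol \<Lambda> S A = measure (coord_lebesgue (subspace_basis \<Lambda> S)) (coord_set (subspace_basis \<Lambda> S) 0 A)"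

lemma subspace_basis:
  assumes "lattice_subspace \<Lambda> S"
  shows "lattice_basis (subspace_basis \<Lambda> S) (\<Lambda> \<inter> S)"
    "independent (subspace_basis \<Lambda> S)" "finite (subspace_basis \<Lambda> S)" "span (subspace_basis \<Lambda> S) = S"
proof -
  show *: "lattice_basis (subspace_basis \<Lambda> S) (\<Lambda> \<inter> S)"
    using assms unfolding lattice_subspace_def is_lattice_def subspace_basis_def by (metis someI_ex)
  show "independent (subspace_basis \<Lambda> S)" "finite (subspace_basis \<Lambda> S)" "span (subspace_basis \<Lambda> S) = S"
    using lattice_basisD[OF *] assms by (auto simp: lattice_subspace_def)
qed

lemma subspace_vol_translation:
  assumes "lattice_subspace \<Lambda> S" "lebesgue_sliced A" "y \<in> S"
  shows "subspace_vol \<Lambda> S ((+) y ` A) = subspace_vol \<Lambda> S A"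
proof -
  note B = subspace_basis[OF assms(1)]
  have "emeasure (coord_lebesgue (subspace_basis \<Lambda> S)) (coord_set (subspace_basis \<Lambda> S) (0 - y) A) =
      emeasure (coord_lebesgue (subspace_basis \<Lambda> S)) (coord_set (subspace_basis \<Lambda> S) 0 A)"
    using assms B by (intro emeasure_coord_set_origin) (auto simp: lebesgue_sliced_def lattice_subspace_def subspace_neg)
  then show ?thesis by (simp add: subspace_vol_def measure_def coord_set_translation)
qed

text \<open>Boundedness keeps the measures finite, which additivity of the real-valued
  \<open>measure\<close> requires.\<close>

lemma subspace_vol_UN:
  assumes S: "lattice_subspace \<Lambda> S" and I: "finite I"
    and A: "\<And>i. i \<in> I \<Longrightarrow> lebesgue_sliced (A i)" "\<And>i. i \<in> I \<Longrightarrow> bounded (A i)" "disjoint_family_on A I"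
  shows "subspace_vol \<Lambda> S (\<Union>i\<in>I. A i) = (\<Sum>i\<in>I. subspace_vol \<Lambda> S (A i))"
  unfolding subspace_vol_def coord_set_UN
proof (rule measure_finite_Union[OF I])
  note B = subspace_basis[OF S]
  show "(\<lambda>i. coord_set (subspace_basis \<Lambda> S) 0 (A i)) ` I \<subseteq> sets (coord_lebesgue (subspace_basis \<Lambda> S))"
    using A(1) B by (auto simp: lebesgue_sliced_def)
  show "disjoint_family_on (\<lambda>i. coord_set (subspace_basis \<Lambda> S) 0 (A i)) I"
    using A(3) unfolding disjoint_family_on_def coord_set_def by blast
  show "emeasure (coord_lebesgue (subspace_basis \<Lambda> S)) (coord_set (subspace_basis \<Lambda> S) 0 (A i)) \<noteq> \<infinity>"
    if "i \<in> I" for i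
    using emeasure_coord_set_bounded[OF B(2) A(2)[OF that], of 0] by simp
qed

lemma subspace_vol_fundamental_domain:
  assumes "lattice_subspace \<Lambda> S" "fundamental_domain (\<Lambda> \<inter> S) D"
  shows "subspace_vol \<Lambda> S D = 1"
  using emeasure_fundamental_domain[OF subspace_basis(1)[OF assms(1)] assms(2)]
  by (simp add: subspace_vol_def measure_def)

lemma subspace_vol_scaleR:
  assumes S: "lattice_subspace \<Lambda> S" and A: "lebesgue_sliced A" and k: "k > 0"
  shows "subspace_vol \<Lambda> S ((*\<^sub>R) k ` A) = k ^ dim S * subspace_vol \<Lambda> S A"
proof -
  note B = subspace_basis[OF S]
  have "card (subspace_basis \<Lambda> S) = dim S"
    using dim_span_eq_card_independent[OF B(2)] B(4) by simp
  then show ?thesis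
    using emeasure_coord_set_scaleR[OF B(3), of A k] A B(2) k
    by (simp add: subspace_vol_def measure_def lebesgue_sliced_def enn2real_mult)
qed

text \<open>The origin picked by \<open>rel_vol\<close> differs from \<open>x\<close> by an element
  of \<open>S\<close>, so changing it to \<open>x\<close> only translates coordinates.\<close>

lemma rel_vol_eq_subspace_vol:
  assumes S: "lattice_subspace \<Lambda> S" and L: "is_lattice \<Lambda>" and A: "lebesgue_sliced A" and x: "x \<in> \<Lambda>"
    and E: "E = (+) x ` S"
  shows "rel_vol \<Lambda> E A = subspace_vol \<Lambda> S ((+) (- x) ` A)"
proof -
  obtain B0 where B0: "lattice_basis B0 \<Lambda>" using L by (auto simp: is_lattice_def)
  have sS: "subspace S" using S by (simp add: lattice_subspace_def)
  define y where "y = (SOME y. y \<in> \<Lambda> \<inter> E)"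
  have "x \<in> \<Lambda> \<inter> E" using x subspace_0[OF sS] by (force simp: E)
  then have "y \<in> \<Lambda> \<inter> E" unfolding y_def by (rule someI)
  then have yx: "y - x \<in> S" by (auto simp: E)
  have "(\<lambda>z. z - y) ` E = S"
  proof
    show "(\<lambda>z. z - y) ` E \<subseteq> S"
      using subspace_diff[OF sS _ yx] by (auto simp: E algebra_simps)
    show "S \<subseteq> (\<lambda>z. z - y) ` E"
    proof
      fix s assume "s \<in> S"
      then have "s + (y - x) \<in> S" using yx sS by (simp add: subspace_add)
      then show "s \<in> (\<lambda>z. z - y) ` E" unfolding E image_image
        by (intro image_eqI[of _ _ "s + (y - x)"]) auto
    qed
  qed
  then have "rel_vol \<Lambda> E A = measure (coord_lebesgue (subspace_basis \<Lambda> S)) (coord_set (subspace_basis \<Lambda> S) y A)"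
    by (simp add: rel_vol_def Let_def subspace_basis_def y_def)
  also have "\<dots> = measure (coord_lebesgue (subspace_basis \<Lambda> S)) (coord_set (subspace_basis \<Lambda> S) x A)"
    using emeasure_coord_set_origin[OF subspace_basis(3)[OF S], of x A y] yx A subspace_basis[OF S]
    by (simp add: measure_def lebesgue_sliced_def)
  finally show ?thesis
    by (simp only: subspace_vol_def coord_set_translation diff_minus_eq_add add_0_left)
qed

section \<open>Lattices and rational cones\<close>

lemma scaleR_int_closed:
  fixes L :: "'a::real_vector set"
  assumes "0 \<in> L" "\<And>x y. x \<in> L \<Longrightarrow> y \<in> L \<Longrightarrow> x - y \<in> L" "x \<in> L"
  shows "real_of_int n *\<^sub>R x \<in> L"
proof -
  have m: "- y \<in> L" if "y \<in> L" for y using assms(2)[OF assms(1) that] by simp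
  have a: "y + z \<in> L" if "y \<in> L" "z \<in> L" for y z using assms(2)[OF that(1) m[OF that(2)]] by simp
  have "real k *\<^sub>R x \<in> L" for k :: nat
    by (induction k) (simp_all add: assms(1,3) scaleR_add_left a)
  then show ?thesis
    by (cases n rule: int_cases2) (use m in auto)
qed

text \<open>Induction on \<open>B\<close>: the kernel \<open>L0\<close> of one coordinate functional
  \<open>g\<close> is a lattice by the induction hypothesis. The values of \<open>g\<close> on
  \<open>L\<close> are integers; unless all are 0, division with remainder makes them multiples of
  the least positive one, attained at \<open>x0\<close>. Hence a basis of \<open>L0\<close> together
  with \<open>x0\<close> is a basis of \<open>L\<close>.\<close>

lemma subgroup_of_lattice_is_lattice:
  fixes B :: "'a::euclidean_space set"
  assumes "finite B" "independent B" "L \<subseteq> range (\<lambda>c. \<Sum>b\<in>B. real_of_int (c b) *\<^sub>R b)"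
    "0 \<in> L" "\<And>x y. x \<in> L \<Longrightarrow> y \<in> L \<Longrightarrow> x - y \<in> L"
  shows "is_lattice L"
  using assms
proof (induction B arbitrary: L rule: finite_induct)
  case empty
  then have "L = {0}" by auto
  then have "lattice_basis {} L" by (simp add: lattice_basis_def independent_empty)
  then show ?case unfolding is_lattice_def by blast
next
  case (insert b B)
  obtain \<gamma> :: "'a \<Rightarrow> 'a \<Rightarrow> real" where \<gamma>: "\<And>b. linear (\<gamma> b)"
    "\<And>b' c. b' \<in> insert b B \<Longrightarrow> \<gamma> b' (\<Sum>b''\<in>insert b B. c b'' *\<^sub>R b'') = c b'"
    using dual_coords[OF insert.prems(1)] by metis
  define g where "g = \<gamma> b"
  have lg: "linear g" using \<gamma> by (simp add: g_def)
  have gint: "\<exists>n. g x = real_of_int n" if x: "x \<in> L" for x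
  proof -
    obtain c where "x = (\<Sum>b\<in>insert b B. real_of_int (c b) *\<^sub>R b)" using insert.prems(2) x by blast
    then have "g x = real_of_int (c b)" unfolding g_def using \<gamma>(2)[of b "\<lambda>b. real_of_int (c b)"] by simp
    then show ?thesis by blast
  qed
  define L0 where "L0 = {x \<in> L. g x = 0}"
  have "is_lattice L0"
  proof (rule insert.IH)
    show "independent B" using insert.prems(1) by (rule independent_mono) auto
    show "0 \<in> L0" using insert.prems(3) by (simp add: L0_def linear_0[OF lg])
    show "x - y \<in> L0" if "x \<in> L0" "y \<in> L0" for x y
      using that insert.prems(4) by (simp add: L0_def linear_diff[OF lg])
    show "L0 \<subseteq> range (\<lambda>c. \<Sum>b\<in>B. real_of_int (c b) *\<^sub>R b)"
    proof
      fix x assume x: "x \<in> L0"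
      then obtain c where c: "x = (\<Sum>b\<in>insert b B. real_of_int (c b) *\<^sub>R b)" using insert.prems(2) by (auto simp: L0_def)
      then have "g x = real_of_int (c b)" unfolding g_def using \<gamma>(2)[of b "\<lambda>b. real_of_int (c b)"] by simp
      then have "c b = 0" using x by (simp add: L0_def)
      then have h: "x = (\<Sum>b\<in>B. real_of_int (c b) *\<^sub>R b)" using c insert.hyps by simp
      show "x \<in> range (\<lambda>c. \<Sum>b\<in>B. real_of_int (c b) *\<^sub>R b)"
        by (rule image_eqI[where x = c], rule h, simp)
    qed
  qed
  then obtain B0 where B0: "lattice_basis B0 L0" by (auto simp: is_lattice_def)
  note b0 = lattice_basisD[OF B0]
  show ?case
  proof (cases "L = L0")
    case True
    then show ?thesis using \<open>is_lattice L0\<close> by simp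
  next
    case False
    then obtain x1 where x1: "x1 \<in> L" "g x1 \<noteq> 0" by (auto simp: L0_def)
    define P where "P = (\<lambda>n::nat. n > 0 \<and> (\<exists>x\<in>L. g x = real n))"
    obtain n1 where n1: "g x1 = real_of_int n1" using gint x1 by blast
    have "P (nat \<bar>n1\<bar>)"
    proof (cases "n1 > 0")
      case True
      then show ?thesis using x1 n1 by (auto simp: P_def intro!: bexI[of _ x1])
    next
      case False
      have "- x1 \<in> L" using insert.prems(4)[OF insert.prems(3) x1(1)] by simp
      moreover have "g (- x1) = real (nat \<bar>n1\<bar>)" using False n1 by (simp add: linear_neg[OF lg])
      ultimately show ?thesis using False x1 n1 by (auto simp: P_def)
    qed
    then have PL: "P (Least P)" by (rule LeastI)
    define m where "m = Least P"
    obtain x0 where x0: "x0 \<in> L" "g x0 = real m" "m > 0" using PL by (auto simp: P_def m_def)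
    have decomp: "\<exists>q. x - real_of_int q *\<^sub>R x0 \<in> L0" if x: "x \<in> L" for x
    proof -
      obtain n where n: "g x = real_of_int n" using gint x by blast
      let ?y = "x - real_of_int (n div int m) *\<^sub>R x0"
      have yL: "?y \<in> L" using insert.prems x x0 by (intro insert.prems(4) scaleR_int_closed)
      have "g ?y = real_of_int n - real_of_int (n div int m) * real m"
        by (simp add: linear_diff[OF lg] linear_cmul[OF lg] n x0)
      also have "\<dots> = real_of_int (n - n div int m * int m)" by simp
      also have "n - n div int m * int m = n mod int m" by (simp add: minus_div_mult_eq_mod)
      finally have gy: "g ?y = real_of_int (n mod int m)" .
      have "n mod int m = 0"
      proof (rule ccontr)
        assume "n mod int m \<noteq> 0"
        moreover have "0 \<le> n mod int m" "n mod int m < int m" using x0(3) by auto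
        ultimately have "P (nat (n mod int m))" "nat (n mod int m) < m"
          using gy yL by (auto simp: P_def)
        then show False unfolding m_def using not_less_Least by blast
      qed
      then show ?thesis using gy yL by (auto simp: L0_def)
    qed
    have nspan: "x0 \<notin> span B0"
    proof
      have "subspace {x. g x = 0}" by (auto simp: subspace_def linear_0[OF lg] linear_add[OF lg] linear_cmul[OF lg])
      moreover assume "x0 \<in> span B0"
      moreover have "B0 \<subseteq> {x. g x = 0}" using b0(1) by (auto simp: L0_def)
      ultimately have "g x0 = 0" using span_minimal by blast
      then show False using x0 by simp
    qed
    have nB0: "x0 \<notin> B0" using nspan span_base by blast
    have "lattice_basis (insert x0 B0) L"
      unfolding lattice_basis_def
    proof (intro conjI set_eqI iffI)
      show "independent (insert x0 B0)" using nspan b0(9) nB0 by (simp add: independent_insert)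
    next
      fix x assume "x \<in> L"
      then obtain q where "x - real_of_int q *\<^sub>R x0 \<in> L0" using decomp by blast
      then obtain c where c: "x - real_of_int q *\<^sub>R x0 = (\<Sum>b\<in>B0. real_of_int (c b) *\<^sub>R b)"
        using B0 unfolding lattice_basis_def by blast
      have "(\<Sum>b\<in>insert x0 B0. real_of_int ((c(x0 := q)) b) *\<^sub>R b) =
          real_of_int q *\<^sub>R x0 + (\<Sum>b\<in>B0. real_of_int (c b) *\<^sub>R b)"
        using b0(8) nB0 by (auto intro!: sum.cong)
      then have h: "x = (\<Sum>b\<in>insert x0 B0. real_of_int ((c(x0 := q)) b) *\<^sub>R b)" using c by (simp add: algebra_simps)
      show "x \<in> range (\<lambda>c. \<Sum>b\<in>insert x0 B0. real_of_int (c b) *\<^sub>R b)"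
        by (rule image_eqI[where x = "c(x0 := q)"], rule h, simp)
    next
      fix x assume "x \<in> range (\<lambda>c. \<Sum>b\<in>insert x0 B0. real_of_int (c b) *\<^sub>R b)"
      then obtain c where "x = (\<Sum>b\<in>insert x0 B0. real_of_int (c b) *\<^sub>R b)" by blast
      then have c: "x = real_of_int (c x0) *\<^sub>R x0 + (\<Sum>b\<in>B0. real_of_int (c b) *\<^sub>R b)"
        using b0(8) nB0 by simp
      have "(\<Sum>b\<in>B0. real_of_int (c b) *\<^sub>R b) \<in> L0" using B0 unfolding lattice_basis_def by blast
      then have "(\<Sum>b\<in>B0. real_of_int (c b) *\<^sub>R b) \<in> L" by (simp add: L0_def)
      moreover have "- (real_of_int (c x0) *\<^sub>R x0) \<in> L"
        using scaleR_int_closed[of L x0 "- c x0"] insert.prems x0 by simp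
      ultimately have "(\<Sum>b\<in>B0. real_of_int (c b) *\<^sub>R b) - - (real_of_int (c x0) *\<^sub>R x0) \<in> L" by (rule insert.prems(4))
      then show "x \<in> L" unfolding c by (simp add: add.commute)
    qed
    then show ?thesis unfolding is_lattice_def by blast
  qed
qed

lemma is_lattice_subgroup:
  assumes "is_lattice \<Lambda>" "L \<subseteq> \<Lambda>" "0 \<in> L" "\<And>x y. x \<in> L \<Longrightarrow> y \<in> L \<Longrightarrow> x - y \<in> L"
  shows "is_lattice L"
proof -
  obtain B where B: "lattice_basis B \<Lambda>" using assms(1) by (auto simp: is_lattice_def)
  show ?thesis
    using subgroup_of_lattice_is_lattice[of B L] lattice_basisD(8,9)[OF B] B assms(2-)
    unfolding lattice_basis_def by blast
qed

lemma lattice_closed: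
  assumes "is_lattice \<Lambda>"
  shows "0 \<in> \<Lambda>" "x \<in> \<Lambda> \<Longrightarrow> y \<in> \<Lambda> \<Longrightarrow> x - y \<in> \<Lambda>" "x \<in> \<Lambda> \<Longrightarrow> y \<in> \<Lambda> \<Longrightarrow> x + y \<in> \<Lambda>" "x \<in> \<Lambda> \<Longrightarrow> - x \<in> \<Lambda>"
    "countable \<Lambda>"
  using assms lattice_basisD unfolding is_lattice_def by metis+

lemma is_lattice_Int_subspace:
  assumes "is_lattice \<Lambda>" "subspace S"
  shows "is_lattice (\<Lambda> \<inter> S)"
  using lattice_closed[OF assms(1)] assms
  by (intro is_lattice_subgroup[OF assms(1)]) (auto simp: subspace_0 subspace_diff)

lemma finite_lattice_Int_bounded:
  fixes \<Lambda> :: "'a::euclidean_space set"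
  assumes "is_lattice \<Lambda>" "bounded A"
  shows "finite (\<Lambda> \<inter> A)"
proof -
  obtain B where B: "lattice_basis B \<Lambda>" using assms(1) by (auto simp: is_lattice_def)
  note b = lattice_basisD[OF B]
  obtain k where k: "\<And>b c. b \<in> B \<Longrightarrow> 0 + (\<Sum>b\<in>B. c b *\<^sub>R b) \<in> A \<Longrightarrow> \<bar>c b\<bar> \<le> k b"
    using bounded_coords[OF b(9) assms(2)] by metis
  have "\<Lambda> \<inter> A \<subseteq> (\<lambda>c. \<Sum>b\<in>B. real_of_int (c b) *\<^sub>R b) ` (Pi\<^sub>E B (\<lambda>b. {- \<lceil>k b\<rceil>..\<lceil>k b\<rceil>}))"
  proof
    fix x assume x: "x \<in> \<Lambda> \<inter> A"
    then obtain c where c: "x = (\<Sum>b\<in>B. real_of_int (c b) *\<^sub>R b)" using B unfolding lattice_basis_def by blast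
    have "- \<lceil>k b\<rceil> \<le> c b \<and> c b \<le> \<lceil>k b\<rceil>" if "b \<in> B" for b
    proof -
      have "\<bar>real_of_int (c b)\<bar> \<le> k b" using k[OF that, of "\<lambda>b. real_of_int (c b)"] x c by simp
      then show ?thesis by linarith
    qed
    then show "x \<in> (\<lambda>c. \<Sum>b\<in>B. real_of_int (c b) *\<^sub>R b) ` (Pi\<^sub>E B (\<lambda>b. {- \<lceil>k b\<rceil>..\<lceil>k b\<rceil>}))"
      by (intro image_eqI[of _ _ "restrict c B"]) (auto simp: c)
  qed
  moreover have "finite (Pi\<^sub>E B (\<lambda>b. {- \<lceil>k b\<rceil>..\<lceil>k b\<rceil>}))" using b(8) by (intro finite_PiE) auto
  ultimately show ?thesis by (meson finite_imageI finite_subset)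
qed

section \<open>Rational cones and rationality of inner products\<close>

lemma linear_weighted_sum:
  fixes \<gamma> :: "'b \<Rightarrow> 'a::real_vector \<Rightarrow> real"
  assumes "\<And>b. linear (\<gamma> b)"
  shows "linear (\<lambda>v. \<Sum>b\<in>B. a b * \<gamma> b v)"
  by (rule linearI)
    (simp_all add: linear_add[OF assms] linear_cmul[OF assms] sum.distrib sum_distrib_left algebra_simps)

lemma rational_cone_eq_halfspaces:
  fixes \<gamma> :: "'a::euclidean_space \<Rightarrow> 'a \<Rightarrow> real"
  assumes "finite B" "\<And>b c. b \<in> B \<Longrightarrow> \<gamma> b (\<Sum>b'\<in>B. c b' *\<^sub>R b') = c b"
    "\<And>v. v \<in> span B \<Longrightarrow> v = (\<Sum>b\<in>B. \<gamma> b v *\<^sub>R b)"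
  shows "{\<Sum>b\<in>B. c b *\<^sub>R b | c. \<forall>a\<in>F. R (\<Sum>b\<in>B. a b * c b)} =
         {v \<in> span B. \<forall>a\<in>F. R (\<Sum>b\<in>B. a b * \<gamma> b v)}"
proof (intro set_eqI iffI)
  fix v assume "v \<in> {\<Sum>b\<in>B. c b *\<^sub>R b | c. \<forall>a\<in>F. R (\<Sum>b\<in>B. a b * c b)}"
  then obtain c where c: "v = (\<Sum>b\<in>B. c b *\<^sub>R b)" "\<And>a. a \<in> F \<Longrightarrow> R (\<Sum>b\<in>B. a b * c b)" by blast
  have "(\<Sum>b\<in>B. a b * \<gamma> b v) = (\<Sum>b\<in>B. a b * c b)" for a
    unfolding c(1) using assms(2) by (intro sum.cong) auto
  then show "v \<in> {v \<in> span B. \<forall>a\<in>F. R (\<Sum>b\<in>B. a b * \<gamma> b v)}"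
    using c assms(1) by (auto intro: span_sum span_scale span_base)
next
  fix v assume v: "v \<in> {v \<in> span B. \<forall>a\<in>F. R (\<Sum>b\<in>B. a b * \<gamma> b v)}"
  then show "v \<in> {\<Sum>b\<in>B. c b *\<^sub>R b | c. \<forall>a\<in>F. R (\<Sum>b\<in>B. a b * c b)}"
    using assms(3)[of v] by (intro CollectI exI[of _ "\<lambda>b. \<gamma> b v"]) auto
qed

lemma rational_cone_basic:
  assumes "rational_cone \<Lambda> C"
  shows "closed C" "convex C" "conic C" "0 \<in> C" "C \<subseteq> span \<Lambda>"
proof -
  obtain B F where BF: "lattice_basis B \<Lambda>" "finite F"
    "C = {\<Sum>b\<in>B. c b *\<^sub>R b | c. \<forall>a\<in>F. (\<Sum>b\<in>B. a b * c b) \<le> 0}"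
    using assms unfolding rational_cone_def by blast
  note b = lattice_basisD[OF BF(1)]
  obtain \<gamma> :: "'a \<Rightarrow> 'a \<Rightarrow> real" where \<gamma>: "\<And>b. linear (\<gamma> b)"
    "\<And>b c. b \<in> B \<Longrightarrow> \<gamma> b (\<Sum>b'\<in>B. c b' *\<^sub>R b') = c b"
    "\<And>v. v \<in> span B \<Longrightarrow> v = (\<Sum>b\<in>B. \<gamma> b v *\<^sub>R b)"
    using dual_coords[OF b(9)] by blast
  define l where "l = (\<lambda>a v. \<Sum>b\<in>B. a b * \<gamma> b v)"
  have C: "C = span B \<inter> (\<Inter>a\<in>F. {v. l a v \<le> 0})"
    using rational_cone_eq_halfspaces[OF b(8) \<gamma>(2,3), of F "\<lambda>x. x \<le> 0"] BF(3) by (auto simp: l_def)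
  have l: "linear (l a)" for a
    unfolding l_def by (rule linear_weighted_sum[OF \<gamma>(1)])
  have "closed {v. l a v \<le> 0}" for a
    by (intro closed_Collect_le linear_continuous_on continuous_on_const)
      (use l in \<open>simp add: linear_conv_bounded_linear\<close>)
  then show "closed C" unfolding C by (intro closed_Int closed_INT closed_span) auto
  show "convex C" using assms by (rule convex_rational_cone)
  show "conic C" unfolding C
    by (auto simp: conic_def span_scale linear_cmul[OF l] mult_nonneg_nonpos)
  show "0 \<in> C" unfolding C by (auto simp: span_0 linear_0[OF l])
  show "C \<subseteq> span \<Lambda>" unfolding C using b(10) by auto
qed

text \<open>A half-space does not change when its normal is divided by \<open>k > 0\<close>, so a
  normal has to be rational against the lattice only up to a positive factor. This is the form in
  which \<open>inner_lattice_rational\<close> supplies it.\<close>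

lemma rational_coneI:
  fixes \<Lambda> :: "'a::euclidean_space set"
  assumes L: "is_lattice \<Lambda>" and G: "finite G" and C: "C = {x \<in> span \<Lambda>. \<forall>u\<in>G. x \<bullet> u \<le> 0}"
    and rat: "\<And>u. u \<in> G \<Longrightarrow> \<exists>k>0. \<forall>z\<in>\<Lambda>. z \<bullet> u / k \<in> \<rat>"
  shows "rational_cone \<Lambda> C"
proof -
  obtain B where B: "lattice_basis B \<Lambda>" using L by (auto simp: is_lattice_def)
  note b = lattice_basisD[OF B]
  obtain k where k: "\<And>u. u \<in> G \<Longrightarrow> k u > 0" "\<And>u z. u \<in> G \<Longrightarrow> z \<in> \<Lambda> \<Longrightarrow> z \<bullet> u / k u \<in> \<rat>"
    using rat by metis
  obtain \<gamma> :: "'a \<Rightarrow> 'a \<Rightarrow> real" where \<gamma>: "\<And>b. linear (\<gamma> b)"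
    "\<And>b c. b \<in> B \<Longrightarrow> \<gamma> b (\<Sum>b'\<in>B. c b' *\<^sub>R b') = c b"
    "\<And>v. v \<in> span B \<Longrightarrow> v = (\<Sum>b\<in>B. \<gamma> b v *\<^sub>R b)"
    using dual_coords[OF b(9)] by blast
  let ?F = "(\<lambda>u b. b \<bullet> u / k u) ` G"
  have "(\<Sum>b\<in>B. (b \<bullet> u / k u) * \<gamma> b v) \<le> 0 \<longleftrightarrow> v \<bullet> u \<le> 0" if "u \<in> G" "v \<in> span B" for u v
  proof -
    have "v \<bullet> u = (\<Sum>b\<in>B. \<gamma> b v *\<^sub>R b) \<bullet> u" using \<gamma>(3)[OF that(2)] by simp
    also have "\<dots> = k u * (\<Sum>b\<in>B. (b \<bullet> u / k u) * \<gamma> b v)"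
      using k(1)[OF that(1)] by (simp add: inner_sum_left sum_distrib_left mult.commute)
    finally show ?thesis using k(1)[OF that(1)] by (simp add: mult_le_0_iff)
  qed
  then have "C = {v \<in> span B. \<forall>a\<in>?F. (\<Sum>b\<in>B. a b * \<gamma> b v) \<le> 0}"
    unfolding C b(10) by auto
  then have "C = {\<Sum>b\<in>B. c b *\<^sub>R b | c. \<forall>a\<in>?F. (\<Sum>b\<in>B. a b * c b) \<le> 0}"
    using rational_cone_eq_halfspaces[OF b(8) \<gamma>(2,3), of ?F "\<lambda>x. x \<le> 0"] by simp
  moreover have "\<forall>a\<in>?F. \<forall>b\<in>B. a b \<in> \<rat>" using k(2) b(1) by auto
  ultimately show ?thesis unfolding rational_cone_def using B G by blast
qed

text \<open>One Gauss elimination step per spanning vector.\<close>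

lemma rational_span_equations:
  fixes B :: "'a::euclidean_space set"
  assumes \<gamma>: "\<And>b. linear (\<gamma> b)"
    "\<And>v. v \<in> span B \<Longrightarrow> v = (\<Sum>b\<in>B. \<gamma> b v *\<^sub>R b)"
    and B: "finite B" and F: "finite F" "F \<subseteq> span B" "\<And>v b. v \<in> F \<Longrightarrow> b \<in> B \<Longrightarrow> \<gamma> b v \<in> \<rat>"
  shows "\<exists>A. finite A \<and> (\<forall>a\<in>A. \<forall>b\<in>B. a b \<in> \<rat>) \<and>
           span F = {v \<in> span B. \<forall>a\<in>A. (\<Sum>b\<in>B. a b * \<gamma> b v) = 0}"
  using F
proof (induction F rule: finite_induct)
  case empty
  let ?A = "(\<lambda>b b'. if b' = b then 1 else 0) ` B"
  have "v = 0" if "v \<in> span B" "\<forall>a\<in>?A. (\<Sum>b\<in>B. a b * \<gamma> b v) = 0" for v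
  proof -
    have "\<gamma> b v = 0" if "b \<in> B" for b
      using \<open>\<forall>a\<in>?A. _\<close> B that by (simp add: if_distrib[of "\<lambda>x. x * _"] cong: if_cong)
    then show ?thesis using \<gamma>(2)[OF that(1)] by simp
  qed
  then have "span {} = {v \<in> span B. \<forall>a\<in>?A. (\<Sum>b\<in>B. a b * \<gamma> b v) = 0}"
    by (auto simp: span_0 linear_0[OF \<gamma>(1)])
  moreover have "finite ?A" "\<forall>a\<in>?A. \<forall>b\<in>B. a b \<in> \<rat>" using B by auto
  ultimately show ?case by blast
next
  case (insert w F)
  then obtain A where A: "finite A" "\<And>a b. a \<in> A \<Longrightarrow> b \<in> B \<Longrightarrow> a b \<in> \<rat>"
    "span F = {v \<in> span B. \<forall>a\<in>A. (\<Sum>b\<in>B. a b * \<gamma> b v) = 0}" by (metis (no_types, lifting) insert_iff insert_subset)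
  define l where "l = (\<lambda>a v. \<Sum>b\<in>B. a b * \<gamma> b v)"
  have l: "linear (l a)" for a
    unfolding l_def by (rule linear_weighted_sum[OF \<gamma>(1)])
  have sF: "span F = {v \<in> span B. \<forall>a\<in>A. l a v = 0}" using A(3) by (simp add: l_def)
  have w: "w \<in> span B" using insert.prems by auto
  show ?case
  proof (cases "w \<in> span F")
    case True
    then have *: "span (insert w F) = span F" by (simp add: span_redundant)
    show ?thesis unfolding * by (intro exI[of _ A] conjI ballI A)
  next
    case False
    then obtain a0 where a0: "a0 \<in> A" "l a0 w \<noteq> 0" using sF w by blast
    \<comment> \<open>\<open>a0\<close> is the pivot. The functional of \<open>h a\<close> vanishes
      at \<open>w\<close> by construction, and on \<open>span F\<close> as a combination of two
      functionals that vanish there.\<close>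
    define h where "h = (\<lambda>a b. l a0 w * a b - l a w * a0 b)"
    have lh: "l (h a) v = l a0 w * l a v - l a w * l a0 v" for a v
      unfolding l_def h_def by (simp add: left_diff_distrib sum_subtractf sum_distrib_left mult.assoc)
    have "span (insert w F) = {v \<in> span B. \<forall>a\<in>h ` A. l a v = 0}"
    proof (intro set_eqI iffI)
      fix v assume "v \<in> span (insert w F)"
      then obtain t where t: "v - t *\<^sub>R w \<in> span F" by (auto simp: span_insert)
      then have "v \<in> span B" using sF w by (metis (no_types, lifting) diff_add_cancel mem_Collect_eq span_add span_scale)
      moreover have "l a v = t * l a w" if "a \<in> A" for a
        using t that by (simp add: sF linear_diff[OF l] linear_cmul[OF l])
      ultimately show "v \<in> {v \<in> span B. \<forall>a\<in>h ` A. l a v = 0}" using a0 by (auto simp: lh)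
    next
      fix v assume v: "v \<in> {v \<in> span B. \<forall>a\<in>h ` A. l a v = 0}"
      let ?t = "l a0 v / l a0 w"
      have "v - ?t *\<^sub>R w \<in> span F"
        unfolding sF using v w a0 by (auto simp: span_diff span_scale lh linear_diff[OF l] linear_cmul[OF l] field_simps)
      then show "v \<in> span (insert w F)" by (auto simp: span_insert)
    qed
    moreover have "finite (h ` A)" using A by simp
    moreover have "\<forall>a\<in>h ` A. \<forall>b\<in>B. a b \<in> \<rat>"
      using A(2) a0 insert.prems by (auto simp: h_def l_def intro!: Rats_diff Rats_mult Rats_sum)
    ultimately show ?thesis unfolding l_def by blast
  qed
qed

text \<open>The line through \<open>w\<close> is itself a rational cone, so by the rank assumption
  the vectors of \<open>V\<close> orthogonal to \<open>w\<close> are spanned by lattice vectors and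
  hence cut out by rational equations. One of these, \<open>l a\<close>, does not vanish at
  \<open>w\<close>. Evaluated at the component of \<open>z\<close> orthogonal to \<open>w\<close> it
  gives \<open>z \<bullet> w / (w \<bullet> w) = l a z / l a w\<close>, so
  \<open>k = w \<bullet> w\<close> works for \<open>w \<noteq> 0\<close>.\<close>

lemma inner_lattice_rational:
  fixes \<Lambda> V :: "'a::euclidean_space set"
  assumes V: "subspace V" and L: "is_lattice \<Lambda>" and sp: "span \<Lambda> = V"
    and rank: "\<And>C. rational_cone \<Lambda> C \<Longrightarrow> dim (perp_lattice V \<Lambda> C) = dim (perp V C)"
    and w: "w \<in> \<Lambda>"
  shows "\<exists>k>0. \<forall>z\<in>\<Lambda>. z \<bullet> w / k \<in> \<rat>"
proof (cases "w = 0")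
  case True
  then show ?thesis by (auto intro!: exI[of _ 1])
next
  case False
  obtain B where B: "lattice_basis B \<Lambda>" using L by (auto simp: is_lattice_def)
  note b = lattice_basisD[OF B]
  obtain \<gamma> :: "'a \<Rightarrow> 'a \<Rightarrow> real" where \<gamma>: "\<And>b. linear (\<gamma> b)"
    "\<And>b c. b \<in> B \<Longrightarrow> \<gamma> b (\<Sum>b'\<in>B. c b' *\<^sub>R b') = c b"
    "\<And>v. v \<in> span B \<Longrightarrow> v = (\<Sum>b\<in>B. \<gamma> b v *\<^sub>R b)"
    using dual_coords[OF b(9)] by blast
  have rat: "\<gamma> b z \<in> \<rat>" if z: "z \<in> \<Lambda>" and bB: "b \<in> B" for z b
  proof -
    obtain c where "z = (\<Sum>b\<in>B. real_of_int (c b) *\<^sub>R b)" using z B unfolding lattice_basis_def by blast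
    then show ?thesis using \<gamma>(2)[OF bB, of "\<lambda>b. real_of_int (c b)"] by simp
  qed
  define l where "l = (\<lambda>a v. \<Sum>b\<in>B. a b * \<gamma> b v)"
  have l: "linear (l a)" for a
    unfolding l_def by (rule linear_weighted_sum[OF \<gamma>(1)])
  have VB: "V = span B" using b(10) sp by simp
  have "rational_cone \<Lambda> (span {w})"
  proof -
    have "{w} \<subseteq> span B" "\<And>v b. v \<in> {w} \<Longrightarrow> b \<in> B \<Longrightarrow> \<gamma> b v \<in> \<rat>" using w b(2) rat by auto
    from rational_span_equations[OF \<gamma>(1,3) b(8) _ this]
    obtain A where A: "finite A" "\<forall>a\<in>A. \<forall>b\<in>B. a b \<in> \<rat>" "span {w} = {v \<in> span B. \<forall>a\<in>A. l a v = 0}"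
      unfolding l_def by blast
    let ?F = "A \<union> (\<lambda>a b. - a b) ` A"
    have "l (\<lambda>b. - a b) v = - l a v" for a v by (simp add: l_def sum_negf)
    then have "(\<forall>a\<in>A. l a v = 0) \<longleftrightarrow> (\<forall>a\<in>?F. l a v \<le> 0)" for v by (auto simp: ball_Un intro: order_antisym)
    then have "span {w} = {v \<in> span B. \<forall>a\<in>?F. (\<Sum>b\<in>B. a b * \<gamma> b v) \<le> 0}"
      using A(3) unfolding l_def by simp
    also have "\<dots> = {\<Sum>b\<in>B. c b *\<^sub>R b | c. \<forall>a\<in>?F. (\<Sum>b\<in>B. a b * c b) \<le> 0}"
      using rational_cone_eq_halfspaces[OF b(8) \<gamma>(2,3), of ?F "\<lambda>x. x \<le> 0"] by simp
    finally show ?thesis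
      unfolding rational_cone_def using A B by (intro exI[of _ B] exI[of _ ?F]) auto
  qed
  from rank[OF this] have d: "dim (perp_lattice V \<Lambda> (span {w})) = dim (perp V (span {w}))" .
  have perp: "perp V (span {w}) = {v \<in> V. v \<bullet> w = 0}"
    by (auto simp: perp_def orthogonal_comp_def orthogonal_def span_singleton inner_commute)
  have sperp: "subspace (perp V (span {w}))"
    unfolding perp_def using V by (intro subspace_inter subspace_orthogonal_comp)
  have sub: "perp_lattice V \<Lambda> (span {w}) \<subseteq> perp V (span {w})" by (auto simp: perp_lattice_def)
  have span_perp: "span (perp_lattice V \<Lambda> (span {w})) = perp V (span {w})"
    using d sub sperp by (metis dim_span span_minimal subspace_dim_equal subspace_span order_refl)
  obtain F where F: "F \<subseteq> perp_lattice V \<Lambda> (span {w})" "independent F" "span F = perp V (span {w})"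
    using maximal_independent_subset[of "perp_lattice V \<Lambda> (span {w})"] span_perp
    by (metis span_mono span_minimal subspace_span subset_antisym)
  obtain A where A: "finite A" "\<forall>a\<in>A. \<forall>b\<in>B. a b \<in> \<rat>" "span F = {v \<in> span B. \<forall>a\<in>A. l a v = 0}"
  proof -
    have "finite F" using F(2) by (rule finiteI_independent)
    moreover have "F \<subseteq> \<Lambda>" using F(1) by (auto simp: perp_lattice_def)
    ultimately show ?thesis
      using rational_span_equations[OF \<gamma>(1,3) b(8), of F] rat b(2) that unfolding l_def by blast
  qed
  have wV: "w \<in> V" using w sp span_base by blast
  have "w \<notin> span F" using F(3) perp False by simp
  then obtain a where a: "a \<in> A" "l a w \<noteq> 0" using A(3) wV VB by auto
  have lrat: "l a z \<in> \<rat>" if "z \<in> \<Lambda>" for z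
    unfolding l_def using A(2) a(1) rat that by (auto intro!: Rats_sum Rats_mult)
  have "z \<bullet> w / (w \<bullet> w) \<in> \<rat>" if z: "z \<in> \<Lambda>" for z
  proof -
    let ?t = "z \<bullet> w / (w \<bullet> w)"
    have "z \<in> V" using z sp span_base by blast
    then have "z - ?t *\<^sub>R w \<in> perp V (span {w})"
      unfolding perp using wV V False by (simp add: subspace_diff subspace_scale inner_diff_left)
    then have "l a (z - ?t *\<^sub>R w) = 0" using F(3) A(3) a(1) by auto
    then have "?t = l a z / l a w" using a(2) by (simp add: linear_diff[OF l] linear_cmul[OF l] field_simps)
    then show ?thesis using lrat[OF z] lrat[OF w] by (simp add: Rats_divide)
  qed
  then show ?thesis using False by (intro exI[of _ "w \<bullet> w"]) auto
qed

section \<open>Pointed cones\<close>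

lemma pointedD:
  assumes "pointed C" "convex C" "conic C" "x \<in> C" "- x \<in> C"
  shows "x = 0"
proof -
  have "span {x} \<subseteq> C"
  proof
    fix y assume "y \<in> span {x}"
    then obtain r where r: "y = r *\<^sub>R x" by (auto simp: span_singleton)
    show "y \<in> C"
    proof (cases "r \<ge> 0")
      case True
      then show ?thesis using assms(3,4) r by (simp add: conicD)
    next
      case False
      then have "(- r) *\<^sub>R (- x) \<in> C" using assms(3,5) by (intro conicD) auto
      then show ?thesis using r by simp
    qed
  qed
  then have "span {x} = {0}" using assms(1) subspace_span unfolding pointed_def by blast
  then show ?thesis using span_base[of x "{x}"] by auto
qed

text \<open>A point of an open segment between members of a cone is the sum of two members, so the
  face condition reduces to one on summands.\<close>

lemma face_of_coneI:
  assumes C: "conic C" and F: "F \<subseteq> C" "convex F" "conic F"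
    and sum: "\<And>a b. a \<in> C \<Longrightarrow> b \<in> C \<Longrightarrow> a + b \<in> F \<Longrightarrow> a \<in> F \<and> b \<in> F"
  shows "F face_of C"
  unfolding face_of_def
proof (intro conjI ballI impI F)
  fix a b x assume ab: "a \<in> C" "b \<in> C" "x \<in> F" "x \<in> open_segment a b"
  then obtain u where u: "0 < u" "u < 1" "x = (1 - u) *\<^sub>R a + u *\<^sub>R b" by (auto simp: in_segment)
  have "(1 - u) *\<^sub>R a \<in> F \<and> u *\<^sub>R b \<in> F" using ab u by (intro sum conicD[OF C]) auto
  then have "(1 / (1 - u)) *\<^sub>R ((1 - u) *\<^sub>R a) \<in> F" "(1 / u) *\<^sub>R (u *\<^sub>R b) \<in> F"
    using u F(3) by (auto intro!: conicD simp del: scaleR_scaleR)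
  then show "a \<in> F" "b \<in> F" using u by auto
qed

text \<open>Segments are stretched until the given point becomes interior: \<open>x\<close> lies
  between 0 and \<open>2 x\<close>, and \<open>a + b\<close> between \<open>2 a\<close> and
  \<open>2 b\<close>.\<close>

lemma face_of_cone:
  assumes C: "convex C" "conic C" and F: "F face_of C" "F \<noteq> {}"
  shows "0 \<in> F" "conic F" "a \<in> C \<Longrightarrow> b \<in> C \<Longrightarrow> a + b \<in> F \<Longrightarrow> a \<in> F"
proof -
  have seg: "a \<in> F" "b \<in> F" if "a \<in> C" "b \<in> C" "x \<in> F" "x \<in> open_segment a b" for a b x
    using F(1) that unfolding face_of_def by blast+
  have FC: "F \<subseteq> C" "convex F" using F(1) by (auto simp: face_of_def)
  have C0: "0 \<in> C" using C F FC by (auto simp: conic_contains_0)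
  show F0: "0 \<in> F"
  proof -
    obtain x where x: "x \<in> F" using F by auto
    show ?thesis
    proof (cases "x = 0")
      case False
      then have "x \<in> open_segment 0 (2 *\<^sub>R x)" by (auto simp: in_segment intro!: exI[of _ "1/2"])
      then show ?thesis using seg(1)[OF C0 _ x] FC x C by (meson conicD subsetD zero_le_numeral)
    qed (use x in simp)
  qed
  show cF: "conic F"
    unfolding conic_def
  proof (intro allI impI)
    fix x and r :: real assume x: "x \<in> F" and r: "0 \<le> r"
    show "r *\<^sub>R x \<in> F"
    proof (cases "r \<le> 1")
      case True
      then have "(1 - r) *\<^sub>R 0 + r *\<^sub>R x \<in> F" using r x F0 FC by (intro convexD) auto
      then show ?thesis by simp
    next
      case False
      show ?thesis
      proof (cases "x = 0")
        case False
        then have "x \<in> open_segment 0 (r *\<^sub>R x)"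
          using \<open>\<not> r \<le> 1\<close> by (auto simp: in_segment intro!: exI[of _ "1/r"])
        then show ?thesis using seg(2)[OF C0 _ x] FC x C r by (meson conicD subsetD)
      qed (use F0 in simp)
    qed
  qed
  show "a \<in> F" if ab: "a \<in> C" "b \<in> C" "a + b \<in> F"
  proof (cases "a = b")
    case True
    then have "a + b = 2 *\<^sub>R a" by (simp add: scaleR_2)
    with ab(3) have "2 *\<^sub>R a \<in> F" by simp
    from conicD[OF cF this, where c = "1/2"] show ?thesis by simp
  next
    case False
    then have "a + b \<in> open_segment (2 *\<^sub>R a) (2 *\<^sub>R b)"
      by (auto simp: in_segment intro!: exI[of _ "1/2"])
    then have "2 *\<^sub>R a \<in> F" using seg(1)[of "2 *\<^sub>R a" "2 *\<^sub>R b"] ab C by (simp add: conicD)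
    from conicD[OF cF this, where c = "1/2"] show ?thesis by simp
  qed
qed

text \<open>Pointedness makes \<open>C - {0}\<close> convex, so the convex hull of the compact slice
  of \<open>C\<close> by the unit sphere misses 0 and can be strictly separated from it. Homogeneity
  extends the bound to \<open>C\<close>.\<close>

lemma pointed_cone_functional:
  fixes C :: "'a::euclidean_space set"
  assumes C: "closed C" "convex C" "conic C" "pointed C"
  obtains u :: 'a and c where "c > 0" "\<And>x. x \<in> C \<Longrightarrow> c * norm x \<le> u \<bullet> x"
proof -
  let ?S = "C \<inter> sphere 0 1"
  have "convex (C - {0})"
  proof (rule convexI)
    fix x y and u v :: real assume xy: "x \<in> C - {0}" "y \<in> C - {0}" and uv: "0 \<le> u" "0 \<le> v" "u + v = 1"
    have "u *\<^sub>R x + v *\<^sub>R y \<in> C" using C(2) xy uv by (intro convexD) auto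
    moreover have "u *\<^sub>R x + v *\<^sub>R y \<noteq> 0"
    proof
      assume eq: "u *\<^sub>R x + v *\<^sub>R y = 0"
      have "u *\<^sub>R x \<in> C" "v *\<^sub>R y \<in> C" using xy uv C(3) by (auto intro: conicD)
      moreover have "v *\<^sub>R y = - (u *\<^sub>R x)" using eq by (simp add: add_eq_0_iff)
      ultimately have "u *\<^sub>R x = 0" using pointedD[OF C(4,2,3)] by metis
      then have "u = 0" using xy by simp
      then show False using uv xy eq by simp
    qed
    ultimately show "u *\<^sub>R x + v *\<^sub>R y \<in> C - {0}" by simp
  qed
  then have "convex hull ?S \<subseteq> C - {0}" by (intro hull_minimal) auto
  then have "0 \<notin> convex hull ?S" by blast
  moreover have "closed (convex hull ?S)"
    using closed_Int_compact[OF C(1) compact_sphere] by (intro compact_imp_closed compact_convex_hull)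
  ultimately obtain u b where ub: "0 < b" "\<And>x. x \<in> convex hull ?S \<Longrightarrow> b < u \<bullet> x"
    using separating_hyperplane_closed_0[of "convex hull ?S"] convex_convex_hull by metis
  have "b * norm x \<le> u \<bullet> x" if "x \<in> C" for x
  proof (cases "x = 0")
    case False
    then have "(1 / norm x) *\<^sub>R x \<in> ?S" using that C(3) by (auto intro: conicD)
    then have "b < u \<bullet> ((1 / norm x) *\<^sub>R x)" using ub(2) hull_inc by metis
    then show ?thesis using False by (simp add: field_simps)
  qed simp
  then show ?thesis using that ub(1) by blast
qed

text \<open>
  The extreme points of the compact slice of the cone by a hyperplane span its rays.
\<close>

lemma pointed_cone_subset_of_rays:
  fixes C K :: "'a::euclidean_space set"
  assumes C: "closed C" "convex C" "conic C" "pointed C"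
    and K: "convex K" "conic K" "0 \<in> K" and rays: "\<And>M. M edge_of C \<Longrightarrow> M \<subseteq> K"
  shows "C \<subseteq> K"
proof -
  obtain u c where u: "c > 0" "\<And>x. x \<in> C \<Longrightarrow> c * norm x \<le> u \<bullet> x"
    using pointed_cone_functional[OF C] by metis
  have upos: "u \<bullet> x > 0" if "x \<in> C" "x \<noteq> 0" for x
    using u(2)[OF that(1)] that(2) u(1) by (meson less_le_trans mult_pos_pos zero_less_norm_iff)
  define D where "D = C \<inter> {x. u \<bullet> x = 1}"
  have "compact D"
  proof -
    have "norm x \<le> 1 / c" if "x \<in> D" for x
      using u(2)[of x] that u(1) by (auto simp: D_def field_simps)
    then have "bounded D" by (auto simp: bounded_iff)
    moreover have "closed D" unfolding D_def using C(1) by (intro closed_Int closed_hyperplane)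
    ultimately show ?thesis by (simp add: compact_eq_bounded_closed)
  qed
  moreover have "convex D" unfolding D_def using C(2) by (intro convex_Int convex_hyperplane)
  ultimately have D: "D = convex hull {x. x extreme_point_of D}" by (rule Krein_Milman_Minkowski)
  have "e \<in> K" if e: "e extreme_point_of D" for e
  proof -
    have eD: "e \<in> C" "u \<bullet> e = 1" using e by (auto simp: extreme_point_of_def D_def)
    then have e0: "e \<noteq> 0" by auto
    let ?M = "(\<lambda>r. r *\<^sub>R e) ` {0..}"
    have MC: "?M \<subseteq> C" using eD C(3) by (auto intro: conicD)
    have "?M face_of C"
    proof (rule face_of_coneI[OF C(3) MC])
      show "conic ?M" by (auto simp: conic_def)
      show "convex ?M"
      proof (rule convexI)
        fix x y and a b :: real assume "x \<in> ?M" "y \<in> ?M" "0 \<le> a" "0 \<le> b" "a + b = 1"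
        then obtain r s where "x = r *\<^sub>R e" "y = s *\<^sub>R e" "0 \<le> r" "0 \<le> s" by auto
        then show "a *\<^sub>R x + b *\<^sub>R y \<in> ?M" using \<open>0 \<le> a\<close> \<open>0 \<le> b\<close>
          by (intro image_eqI[of _ _ "a * r + b * s"]) (auto simp: scaleR_add_left)
      qed
      fix a b assume ab: "a \<in> C" "b \<in> C" "a + b \<in> ?M"
      then obtain s where s: "a + b = s *\<^sub>R e" "0 \<le> s" by auto
      have z: "0 \<in> ?M" by (auto intro!: image_eqI[of _ _ 0])
      consider "a = 0" | "b = 0" | "a \<noteq> 0" "b \<noteq> 0" by blast
      then show "a \<in> ?M \<and> b \<in> ?M"
      proof cases
        case 3
        \<comment> \<open>Scaled to height 1 with respect to \<open>u\<close>, both \<open>a\<close>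
          and \<open>b\<close> become points of \<open>D\<close> with \<open>e\<close> on the
          segment between them, and extremality makes both equal to \<open>e\<close>.\<close>
        define \<alpha> \<beta> where "\<alpha> = u \<bullet> a" and "\<beta> = u \<bullet> b"
        have pos: "\<alpha> > 0" "\<beta> > 0" using upos ab 3 by (auto simp: \<alpha>_def \<beta>_def)
        have sum: "\<alpha> + \<beta> = s"
          using arg_cong[OF s(1), of "\<lambda>x. u \<bullet> x"] eD(2) by (simp add: inner_add_right \<alpha>_def \<beta>_def)
        let ?a = "(1 / \<alpha>) *\<^sub>R a" and ?b = "(1 / \<beta>) *\<^sub>R b"
        have aD: "?a \<in> D" "?b \<in> D" using ab pos C(3) by (auto simp: D_def \<alpha>_def \<beta>_def intro: conicD)
        have "e = (1 - \<beta> / s) *\<^sub>R ?a + (\<beta> / s) *\<^sub>R ?b"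
        proof -
          have "1 - \<beta> / s = \<alpha> / s" using sum pos by (auto simp: field_simps)
          then have "(1 - \<beta> / s) *\<^sub>R ?a + (\<beta> / s) *\<^sub>R ?b = (1 / s) *\<^sub>R (a + b)"
            using pos by (simp add: scaleR_add_right)
          also have "\<dots> = e" using s(1) sum pos by simp
          finally show ?thesis ..
        qed
        moreover have "0 < \<beta> / s" "\<beta> / s < 1" using sum pos by auto
        ultimately have "?a \<noteq> ?b \<Longrightarrow> e \<in> open_segment ?a ?b" by (auto simp: in_segment)
        then have "?a = ?b" using e aD unfolding extreme_point_of_def by blast
        moreover have "(1 - \<beta> / s) *\<^sub>R ?a + (\<beta> / s) *\<^sub>R ?a = ?a"
          by (simp only: scaleR_add_left[symmetric]) simp
        ultimately have "e = ?a" "e = ?b"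
          using \<open>e = (1 - \<beta> / s) *\<^sub>R ?a + (\<beta> / s) *\<^sub>R ?b\<close> by simp_all
        have "\<alpha> *\<^sub>R e = a" by (subst \<open>e = ?a\<close>) (use pos in simp)
        moreover have "\<beta> *\<^sub>R e = b" by (subst \<open>e = ?b\<close>) (use pos in simp)
        ultimately show ?thesis using pos by (auto intro: image_eqI[of _ _ \<alpha>] image_eqI[of _ _ \<beta>])
      qed (use ab s z in auto)
    qed
    moreover have "aff_dim ?M = 1"
    proof (rule antisym)
      have "aff_dim ?M \<le> aff_dim (span {e})" by (intro aff_dim_subset) (auto simp: span_singleton)
      also have "\<dots> = 1" using e0 by (simp add: aff_dim_subspace)
      finally show "aff_dim ?M \<le> 1" .
      have "{0, e} \<subseteq> ?M" by (auto intro!: image_eqI[of _ _ 0] image_eqI[of e _ 1])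
      then have "aff_dim {0, e} \<le> aff_dim ?M" by (rule aff_dim_subset)
      then show "1 \<le> aff_dim ?M" using e0 by (simp add: aff_dim_2)
    qed
    ultimately have "?M edge_of C" by (simp add: edge_of_def)
    then have "?M \<subseteq> K" by (rule rays)
    moreover have "e \<in> ?M" by (rule image_eqI[of _ _ 1]) auto
    ultimately show ?thesis by blast
  qed
  then have "D \<subseteq> K" by (subst D) (intro hull_minimal K, auto)
  show "C \<subseteq> K"
  proof
    fix x assume x: "x \<in> C"
    show "x \<in> K"
    proof (cases "x = 0")
      case False
      then have p: "u \<bullet> x > 0" using upos x by simp
      then have "(1 / (u \<bullet> x)) *\<^sub>R x \<in> D" using x C(3) by (auto simp: D_def intro: conicD)
      then have "(1 / (u \<bullet> x)) *\<^sub>R x \<in> K" using \<open>D \<subseteq> K\<close> by blast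
      from conicD[OF K(2) this, where c = "u \<bullet> x"] show ?thesis using p by simp
    qed (use K in simp)
  qed
qed

lemma pointed_ray:
  fixes M :: "'a::euclidean_space set"
  assumes M: "convex M" "conic M" "pointed M" "aff_dim M = 1"
  obtains m where "m \<noteq> 0" "M = (\<lambda>r. r *\<^sub>R m) ` {0..}"
proof -
  have "M \<noteq> {}" using M(4) by auto
  then have z: "0 \<in> M" using M(2) by (simp add: conic_contains_0)
  have d: "dim M = 1" using M(4) aff_dim_zero[of M] z hull_inc[of 0 M affine] by simp
  then have "M \<noteq> {0}" by auto
  then obtain m where m: "m \<in> M" "m \<noteq> 0" using z by blast
  have "dim (span {m}) = 1" using m by (simp add: dim_span)
  then have "span {m} = span M" using d m
    by (intro subspace_dim_equal subspace_span span_mono) (auto simp: dim_span)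
  have "x \<in> (\<lambda>r. r *\<^sub>R m) ` {0..}" if x: "x \<in> M" for x
  proof -
    obtain r where r: "x = r *\<^sub>R m" using span_base[OF x] \<open>span {m} = span M\<close> by (auto simp: span_singleton)
    have "r \<ge> 0"
    proof (rule ccontr)
      assume "\<not> r \<ge> 0"
      then have "(- 1 / r) *\<^sub>R x \<in> M" using x M(2) by (intro conicD) auto
      then have "- m \<in> M" using r \<open>\<not> r \<ge> 0\<close> by simp
      then show False using pointedD[OF M(3,1,2) m(1)] m(2) by simp
    qed
    then show ?thesis using r by auto
  qed
  moreover have "r *\<^sub>R m \<in> M" if "r \<ge> 0" for r using that m M(2) by (simp add: conicD)
  ultimately have "M = (\<lambda>r. r *\<^sub>R m) ` {0..}" by auto
  then show ?thesis using that m by blast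
qed

text \<open>A point of the polar on its boundary hyperplane leaves the polar when moved slightly
  along \<open>m\<close>, and this motion stays in \<open>V\<close>. The lemma turns the interior in
  condition (I) into strict inequalities.\<close>

lemma interior_polar_ray:
  fixes V :: "'a::euclidean_space set"
  assumes V: "subspace V" and M: "M \<subseteq> V" "M = (\<lambda>r. r *\<^sub>R m) ` {0..}" "m \<noteq> 0"
  shows "(top_of_set V) interior_of (polar V M) = {x \<in> V. \<forall>y\<in>M - {0}. x \<bullet> y < 0}"
proof -
  have pol: "polar V M = {x \<in> V. x \<bullet> m \<le> 0}"
    unfolding polar_def M(2) by (auto simp: mult_nonneg_nonpos dest: bspec[of _ _ 1])
  have mM: "m \<in> M" unfolding M(2) by (auto intro: image_eqI[of _ _ 1])
  then have mV: "m \<in> V" using M(1) by blast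
  have "(\<forall>y\<in>M - {0}. x \<bullet> y < 0) \<longleftrightarrow> x \<bullet> m < 0" for x
  proof
    show "\<forall>y\<in>M - {0}. x \<bullet> y < 0 \<Longrightarrow> x \<bullet> m < 0" using mM M(3) by blast
    show "x \<bullet> m < 0 \<Longrightarrow> \<forall>y\<in>M - {0}. x \<bullet> y < 0" unfolding M(2) by (auto simp: mult_less_0_iff)
  qed
  then have eq: "{x \<in> V. \<forall>y\<in>M - {0}. x \<bullet> y < 0} = {x \<in> V. x \<bullet> m < 0}" by blast
  show ?thesis
    unfolding eq
  proof (rule interior_of_unique)
    show "{x \<in> V. x \<bullet> m < 0} \<subseteq> polar V M" unfolding pol by auto
    have "open {x. x \<bullet> m < 0}" by (intro open_Collect_less continuous_intros)
    then show "openin (top_of_set V) {x \<in> V. x \<bullet> m < 0}"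
      by (auto simp: openin_open intro!: exI[of _ "{x. x \<bullet> m < 0}"])
    fix S assume S: "S \<subseteq> polar V M" "openin (top_of_set V) S"
    show "S \<subseteq> {x \<in> V. x \<bullet> m < 0}"
    proof
      fix x assume x: "x \<in> S"
      obtain U where U: "open U" "S = V \<inter> U" using S by (auto simp: openin_open)
      then obtain e where e: "e > 0" "ball x e \<subseteq> U" using x open_contains_ball by blast
      let ?y = "x + (e / (2 * norm m)) *\<^sub>R m"
      have "?y \<in> ball x e" using e M(3) by (simp add: dist_norm)
      moreover have "?y \<in> V" using x U mV V by (simp add: subspace_add subspace_scale)
      ultimately have "?y \<in> polar V M" using U e S by auto
      then have "x \<bullet> m + (e / (2 * norm m)) * (m \<bullet> m) \<le> 0" by (simp add: pol inner_add_left)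
      moreover have "(e / (2 * norm m)) * (m \<bullet> m) > 0" using e M(3) by simp
      ultimately show "x \<in> {x \<in> V. x \<bullet> m < 0}" using x U by auto
    qed
  qed
qed

text \<open>Without a uniform \<open>\<delta>\<close>, the sets \<open>B n\<close> of points that
  have no \<open>K\<close> with margin above \<open>1 / (n + 1)\<close> would be nonempty, nested
  and compact, and a common point would contradict \<open>pos\<close>. In the applications
  \<open>K\<close> is a cone, \<open>G K\<close> are the rays outside \<open>K\<close>, and
  \<open>h\<close> measures the slack in the inequality of a ray.\<close>

lemma compact_uniform_margin:
  fixes S :: "'a::euclidean_space set" and h :: "'i \<Rightarrow> 'a \<Rightarrow> real"
  assumes S: "compact S" and F: "finite F" and G: "\<And>K. K \<in> F \<Longrightarrow> finite (G K)"
    and h: "\<And>i. continuous_on S (h i)"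
    and pos: "\<And>q. q \<in> S \<Longrightarrow> \<exists>K\<in>F. \<forall>i\<in>G K. h i q > 0"
  obtains \<delta> where "\<delta> > 0" "\<And>q. q \<in> S \<Longrightarrow> \<exists>K\<in>F. \<forall>i\<in>G K. h i q \<ge> \<delta>"
proof -
  define c where "c = (\<lambda>n::nat. 1 / real (Suc n))"
  define B where "B = (\<lambda>n::nat. S \<inter> (\<Inter>K\<in>F. \<Union>i\<in>G K. {q \<in> S. h i q \<le> c n}))"
  show ?thesis
  proof (cases "\<exists>n. B n = {}")
    case True
    then obtain n where n: "B n = {}" by blast
    have "\<exists>K\<in>F. \<forall>i\<in>G K. h i q \<ge> c n" if "q \<in> S" for q
    proof (rule ccontr)
      assume "\<not> ?thesis"
      then have "q \<in> B n" using that unfolding B_def by (force simp: not_le)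
      then show False using n by simp
    qed
    then show ?thesis using that[of "c n"] by (simp add: c_def)
  next
    case False
    have cS: "closed S" using S by (rule compact_imp_closed)
    have cl: "closed {q \<in> S. h i q \<le> t}" for i t
    proof -
      have "{q \<in> S. h i q \<le> t} = S \<inter> h i -` {..t}" by auto
      then show ?thesis using continuous_closed_preimage[OF h cS closed_atMost] by simp
    qed
    have comp: "compact (B n)" for n
      unfolding B_def using S F G cl by (intro compact_Int_closed closed_INT ballI closed_UN)
    have dec: "B n \<subseteq> B m" if "m \<le> n" for m n
    proof -
      have "c n \<le> c m" using that by (simp add: c_def frac_le)
      then show ?thesis unfolding B_def by (fastforce intro: order_trans)
    qed
    have "(\<Inter>n. B n) \<noteq> {}"
      by (rule compact_nest) (use False comp dec in auto)
    then obtain q where q: "\<And>n. q \<in> B n" by blast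
    then have qS: "q \<in> S" by (auto simp: B_def)
    obtain K where K: "K \<in> F" "\<And>i. i \<in> G K \<Longrightarrow> h i q > 0" using pos[OF qS] by blast
    define t where "t = Min (insert 1 ((\<lambda>i. h i q) ` G K))"
    have t: "t > 0" "\<And>i. i \<in> G K \<Longrightarrow> t \<le> h i q" using K G[OF K(1)] by (auto simp: t_def)
    obtain n where "1 / real (Suc n) < t" using t(1) nat_approx_posE by blast
    then have n: "c n < t" by (simp add: c_def)
    have "q \<in> (\<Union>i\<in>G K. {q \<in> S. h i q \<le> c n})" using q[of n] K(1) unfolding B_def by blast
    then obtain i where "i \<in> G K" "h i q \<le> c n" by blast
    then show ?thesis using t(2)[of i] n by simp
  qed
qed

section \<open>Regions of a fan of cones\<close>

lemma mem_perp: "x \<in> perp V C \<longleftrightarrow> x \<in> V \<and> (\<forall>m\<in>C. x \<bullet> m = 0)"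
  by (auto simp: perp_def orthogonal_comp_def orthogonal_def inner_commute)

lemma mem_polar: "x \<in> polar V C \<longleftrightarrow> x \<in> V \<and> (\<forall>m\<in>C. x \<bullet> m \<le> 0)"
  by (simp add: polar_def)

lemma perp_antimono: "J \<subseteq> K \<Longrightarrow> perp V K \<subseteq> perp V J"
  unfolding subset_iff mem_perp by blast

lemma subspace_perp: "subspace V \<Longrightarrow> subspace (perp V C)"
  unfolding perp_def by (intro subspace_inter subspace_orthogonal_comp)

text \<open>
  For \<open>F\<close> the set of faces of a cone \<open>C\<close> and \<open>a = 0\<close> this is \<open>X\<^sup>C\<^sub>K\<close> (and \<open>L(C)\<close> for \<open>K = C\<close>); for
  \<open>F\<close> the normal fan of a polytope and \<open>a K\<close> a lattice point of the face with normal cone \<open>K\<close>, it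
  is the analogous set of translations for the polytope.
\<close>

definition anchored_translations ::
    "'a::euclidean_space set \<Rightarrow> 'a set \<Rightarrow> ('a set \<Rightarrow> 'a set) \<Rightarrow> 'a set set \<Rightarrow> ('a set \<Rightarrow> 'a) \<Rightarrow> 'a set \<Rightarrow> 'a set" where
  "anchored_translations V \<Lambda> R F a K =
     {x \<in> \<Lambda>. x - a K \<in> perp V K \<and>
        (\<forall>M\<in>F. aff_dim M = 1 \<and> \<not> M \<subseteq> K \<longrightarrow> (\<forall>y\<in>R K. \<forall>m\<in>M - {0}. (x + y - a M) \<bullet> m < 0)) \<and>
        (\<forall>K'\<in>F. \<not> K' \<subseteq> K \<and> \<not> K \<subseteq> K' \<longrightarrow>
           (\<forall>x'\<in>\<Lambda>. x' - a K' \<in> perp V K' \<longrightarrow> (\<forall>p. \<not> (p - x \<in> R K \<and> p - x' \<in> R K'))))}"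

locale lattice_tiling =
  fixes V \<Lambda> :: "'a::euclidean_space set" and T :: "'a set \<Rightarrow> 'a set"
  assumes V: "subspace V" and L: "is_lattice \<Lambda>" and span_L: "span \<Lambda> = V"
    and domain: "\<And>L. is_lattice L \<Longrightarrow> L \<subseteq> \<Lambda> \<Longrightarrow> fundamental_domain L (T L)"
begin

abbreviation "R \<equiv> region V \<Lambda> T"

lemma L_V: "\<Lambda> \<subseteq> V" using span_L span_superset by blast

lemmas L_closed = lattice_closed[OF L]

lemma perp_lattice_0 [simp]: "perp_lattice V \<Lambda> {0} = \<Lambda>"
  using L_V by (auto simp: perp_lattice_def mem_perp)

lemma is_lattice_perp_lattice: "is_lattice (perp_lattice V \<Lambda> C)"
  unfolding perp_lattice_def using L V by (intro is_lattice_Int_subspace subspace_perp)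

lemma domain_perp: "fundamental_domain (perp_lattice V \<Lambda> C) (T (perp_lattice V \<Lambda> C))"
  using is_lattice_perp_lattice by (rule domain) (auto simp: perp_lattice_def)

lemma domain_L: "fundamental_domain \<Lambda> (T \<Lambda>)"
  using L by (rule domain) auto

lemma fundamental_domain_unique:
  assumes "fundamental_domain L D" "x \<in> L" "x' \<in> L" "d \<in> D" "d' \<in> D" "x + d = x' + d'"
  shows "x = x'" "d = d'"
proof -
  have "x + d \<in> (+) x ` D \<inter> (+) x' ` D" using assms(4,5) by (auto simp: assms(6)) (metis assms(6) imageI)
  then show "x = x'" using assms(1-3) unfolding fundamental_domain_def disjoint_family_on_def by blast
  then show "d = d'" using assms(6) by simp
qed

lemma fundamental_domain_cover:
  assumes "fundamental_domain L D" "v \<in> span L"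
  obtains x d where "x \<in> L" "d \<in> D" "v = x + d"
  using assms unfolding fundamental_domain_def by blast

lemma mem_CDC: "p \<in> CDC V \<Lambda> T Q \<longleftrightarrow> (\<exists>z\<in>\<Lambda>. \<exists>\<tau>\<in>T \<Lambda>. p = z + \<tau> \<and> (\<exists>\<sigma>\<in>T \<Lambda>. z + \<sigma> \<in> Q))"
  unfolding CDC_def perp_lattice_0 by blast

lemma mem_DC: "p \<in> DC V \<Lambda> T Q \<longleftrightarrow> (\<exists>z\<in>\<Lambda>. \<exists>\<tau>\<in>T \<Lambda>. p = z + \<tau> \<and> z \<in> Q)"
  unfolding DC_def perp_lattice_0 set_plus_def by blast

lemma T_V: "T \<Lambda> \<subseteq> V" and zero_T: "0 \<in> T \<Lambda>"
  using domain_L span_L by (auto simp: fundamental_domain_def)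

lemma DC_subset_CDC: "DC V \<Lambda> T Q \<subseteq> CDC V \<Lambda> T Q"
  using zero_T unfolding mem_DC mem_CDC subset_iff by (metis add_0_right)

lemma CDC_V: "CDC V \<Lambda> T Q \<subseteq> V"
  using T_V L_V V by (auto simp: mem_CDC subspace_add subset_iff)

lemma CDC_mono: "Q \<subseteq> Q' \<Longrightarrow> CDC V \<Lambda> T Q \<subseteq> CDC V \<Lambda> T Q'"
  unfolding mem_CDC subset_iff by blast

lemma subset_CDC:
  assumes "Q \<subseteq> V" shows "Q \<subseteq> CDC V \<Lambda> T Q"
proof
  fix q assume q: "q \<in> Q"
  then obtain z d where "z \<in> \<Lambda>" "d \<in> T \<Lambda>" "q = z + d"
    using fundamental_domain_cover[OF domain_L] assms span_L by blast
  then show "q \<in> CDC V \<Lambda> T Q" unfolding mem_CDC using q by blast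
qed

lemma CDC_translation:
  assumes x: "x \<in> \<Lambda>" and Q: "\<And>q. q \<in> Q \<Longrightarrow> q - x \<in> Q'" and p: "p \<in> CDC V \<Lambda> T Q"
  shows "p - x \<in> CDC V \<Lambda> T Q'"
proof -
  obtain z \<tau> \<sigma> where z: "z \<in> \<Lambda>" "\<tau> \<in> T \<Lambda>" "p = z + \<tau>" "\<sigma> \<in> T \<Lambda>" "z + \<sigma> \<in> Q"
    using p unfolding mem_CDC by blast
  have "z - x \<in> \<Lambda>" using L_closed(2) z x by blast
  moreover have "p - x = (z - x) + \<tau>" using z by simp
  moreover have "(z - x) + \<sigma> \<in> Q'" using Q[OF z(5)] by (simp add: algebra_simps)
  ultimately show ?thesis unfolding mem_CDC using z(2,4) by blast
qed

end

text \<open>The common properties of the face set of one pointed rational cone and of a normal fan.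
  By \<open>subset_face\<close>, inclusion between members is the face relation, which is why
  \<open>\<subseteq>\<close> takes the place of \<open>face_le\<close>. The last axiom says that
  \<open>L(K)\<close> has full rank.\<close>

locale lattice_fan = lattice_tiling V \<Lambda> T
  for V \<Lambda> :: "'a::euclidean_space set" and T +
  fixes F :: "'a set set"
  assumes finite_F: "finite F"
    and rational: "K \<in> F \<Longrightarrow> rational_cone \<Lambda> K"
    and pointed: "K \<in> F \<Longrightarrow> pointed K"
    and faces: "K \<in> F \<Longrightarrow> face_le J K \<Longrightarrow> J \<in> F"
    and subset_face: "J \<in> F \<Longrightarrow> K \<in> F \<Longrightarrow> J \<subseteq> K \<Longrightarrow> J face_of K"
    and span_perp_lattice: "K \<in> F \<Longrightarrow> span (perp_lattice V \<Lambda> K) = perp V K"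
begin

lemma F_cone:
  assumes "K \<in> F"
  shows "closed K" "convex K" "conic K" "0 \<in> K" "K \<subseteq> V"
  using rational_cone_basic[OF rational[OF assms]] span_L by auto

lemma face_le_iff: "J \<in> F \<Longrightarrow> K \<in> F \<Longrightarrow> face_le J K \<longleftrightarrow> J \<subseteq> K"
  by (metis F_cone(4) empty_iff face_le_def face_of_imp_subset subset_face)

lemma zero_F:
  assumes K: "K \<in> F" shows "{0} \<in> F"
proof -
  have "{0} face_of K"
  proof (rule face_of_coneI)
    fix x y assume xy: "x \<in> K" "y \<in> K" "x + y \<in> {0}"
    then have "- x \<in> K" by (auto simp: add_eq_0_iff)
    then have "x = 0" using pointedD[OF pointed[OF K] F_cone(2,3)[OF K]] xy by blast
    then show "x \<in> {0} \<and> y \<in> {0}" using xy by simp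
  qed (use F_cone[OF K] in \<open>auto simp: conic_def\<close>)
  then show ?thesis using faces[OF K] by (simp add: face_le_def)
qed

lemma ray_generator:
  assumes M: "M \<in> F" "aff_dim M = 1"
  obtains m where "m \<noteq> 0" "M = (\<lambda>r. r *\<^sub>R m) ` {0..}" "m \<in> V"
proof -
  obtain m where m: "m \<noteq> 0" "M = (\<lambda>r. r *\<^sub>R m) ` {0..}"
    using pointed_ray[OF F_cone(2,3)[OF M(1)] pointed[OF M(1)] M(2)] by blast
  moreover have "m \<in> M" unfolding m(2) by (rule image_eqI[of _ _ 1]) auto
  then have "m \<in> V" using F_cone(5)[OF M(1)] by blast
  ultimately show ?thesis using that by blast
qed

lemma ray_nonzero:
  assumes M: "M \<in> F" "aff_dim M = 1"
  obtains m where "m \<in> M" "m \<noteq> 0"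
proof -
  obtain m where m: "m \<noteq> 0" "M = (\<lambda>r. r *\<^sub>R m) ` {0..}" using ray_generator[OF M] by blast
  have "m \<in> M" unfolding m(2) by (rule image_eqI[of _ _ 1]) auto
  then show ?thesis using that m by blast
qed

lemma rays_generate:
  assumes "C \<in> F" "convex S" "conic S" "0 \<in> S"
    "\<And>M. M \<in> F \<Longrightarrow> aff_dim M = 1 \<Longrightarrow> M \<subseteq> C \<Longrightarrow> M \<subseteq> S"
  shows "C \<subseteq> S"
proof (rule pointed_cone_subset_of_rays)
  fix M assume M: "M edge_of C"
  then have "M face_of C" "aff_dim M = 1" by (auto simp: edge_of_def)
  moreover have "M \<noteq> {}" using \<open>aff_dim M = 1\<close> by auto
  ultimately show "M \<subseteq> S" using assms(5) faces[OF assms(1), of M] face_of_imp_subset by (auto simp: face_le_def)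
qed (use assms F_cone pointed in auto)

text \<open>A cone is generated by its rays. The ray obtained is the usual witness to which
  condition (I) is applied.\<close>

lemma ray_not_subset:
  assumes "J \<in> F" "K \<in> F" "\<not> J \<subseteq> K"
  obtains M where "M \<in> F" "aff_dim M = 1" "M \<subseteq> J" "\<not> M \<subseteq> K"
  using rays_generate[of J K] F_cone[OF assms(2)] assms by blast

lemma mem_polar_rays:
  assumes "C \<in> F"
  shows "x \<in> polar V C \<longleftrightarrow> x \<in> V \<and> (\<forall>M\<in>F. aff_dim M = 1 \<and> M \<subseteq> C \<longrightarrow> (\<forall>m\<in>M. x \<bullet> m \<le> 0))"
proof
  assume r: "x \<in> V \<and> (\<forall>M\<in>F. aff_dim M = 1 \<and> M \<subseteq> C \<longrightarrow> (\<forall>m\<in>M. x \<bullet> m \<le> 0))"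
  have "C \<subseteq> {y. x \<bullet> y \<le> 0}"
    by (rule rays_generate[OF assms])
      (use r in \<open>auto simp: conic_halfspace_le intro: convex_halfspace_le\<close>)
  then show "x \<in> polar V C" using r by (auto simp: mem_polar)
qed (auto simp: mem_polar)

abbreviation "X F' a \<equiv> anchored_translations V \<Lambda> R F' a"

abbreviation "below C \<equiv> {J \<in> F. J \<subseteq> C}"

lemma region_V:
  assumes "C \<in> F" shows "R C \<subseteq> V"
  using rational[OF assms] pointed[OF assms] T_V by (subst region.simps) auto

text \<open>Edges and proper faces of \<open>C\<close> are members of the fan, and the interior in
  (I) becomes strict inequalities by \<open>interior_polar_ray\<close>. From here on, the regions
  are only accessed through the set on the right.\<close>

lemma translation_set_eq:
  assumes C: "C \<in> F" and K: "K \<in> F" "K \<subset> C"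
  shows "translation_set V \<Lambda> R C K = X (below C) (\<lambda>_. 0) K"
proof -
  have I: "((\<forall>M. M edge_of C \<and> \<not> face_le M K \<longrightarrow> (+) x ` R K \<subseteq> (top_of_set V) interior_of (polar V M)))
     \<longleftrightarrow> (\<forall>M\<in>below C. aff_dim M = 1 \<and> \<not> M \<subseteq> K \<longrightarrow> (\<forall>y\<in>R K. \<forall>m\<in>M - {0}. (x + y - 0) \<bullet> m < 0))" (is "?l \<longleftrightarrow> ?r")
    if x: "x \<in> perp V K" for x
  proof -
    have int: "(+) x ` R K \<subseteq> (top_of_set V) interior_of (polar V M) \<longleftrightarrow> (\<forall>y\<in>R K. \<forall>m\<in>M - {0}. (x + y - 0) \<bullet> m < 0)"
      if M: "M \<in> F" "aff_dim M = 1" for M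
    proof -
      obtain m where m: "m \<noteq> 0" "M = (\<lambda>r. r *\<^sub>R m) ` {0..}" using ray_generator[OF M] by blast
      have "x + y \<in> V" if "y \<in> R K" for y
        using that x region_V[OF K(1)] V by (auto simp: mem_perp subspace_add)
      then show ?thesis using interior_polar_ray[OF V F_cone(5)[OF M(1)] m(2,1)] by auto
    qed
    have edge: "M edge_of C \<longleftrightarrow> M \<in> F \<and> M \<subseteq> C \<and> aff_dim M = 1" for M
      using faces[OF C, of M] subset_face[OF _ C, of M] face_of_imp_subset[of M C]
      by (cases "M = {}") (auto simp: edge_of_def face_le_def)
    have "?l \<longleftrightarrow> (\<forall>M. M \<in> F \<and> aff_dim M = 1 \<and> M \<subseteq> C \<and> \<not> M \<subseteq> K \<longrightarrow>
        (+) x ` R K \<subseteq> (top_of_set V) interior_of (polar V M))"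
    proof -
      have "M edge_of C \<and> \<not> face_le M K \<longleftrightarrow> M \<in> F \<and> aff_dim M = 1 \<and> M \<subseteq> C \<and> \<not> M \<subseteq> K" for M
        using face_le_iff[OF _ K(1), of M] edge[of M] by auto
      then show ?thesis by (simp only:)
    qed
    also have "\<dots> \<longleftrightarrow> (\<forall>M. M \<in> F \<and> aff_dim M = 1 \<and> M \<subseteq> C \<and> \<not> M \<subseteq> K \<longrightarrow>
        (\<forall>y\<in>R K. \<forall>m\<in>M - {0}. (x + y - 0) \<bullet> m < 0))"
      using int by (intro iff_allI imp_cong refl) simp
    also have "\<dots> \<longleftrightarrow> ?r" by blast
    finally show ?thesis .
  qed
  have less: "face_less K' C \<longleftrightarrow> K' \<in> F \<and> K' \<subset> C" for K'
    using faces[OF C, of K'] face_le_iff[OF _ C, of K'] by (auto simp: face_less_def)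
  have II: "(\<forall>K'. face_less K' C \<and> \<not> face_le K' K \<and> \<not> face_le K K' \<longrightarrow>
           (\<forall>x' \<in> perp_lattice V \<Lambda> K'. (+) x ` R K \<inter> (+) x' ` R K' = {})) \<longleftrightarrow>
     (\<forall>K'\<in>below C. \<not> K' \<subseteq> K \<and> \<not> K \<subseteq> K' \<longrightarrow>
           (\<forall>x'\<in>\<Lambda>. x' - 0 \<in> perp V K' \<longrightarrow> (\<forall>p. \<not> (p - x \<in> R K \<and> p - x' \<in> R K'))))" for x
  proof -
    define D where "D K' x' \<longleftrightarrow> (\<forall>p. \<not> (p - x \<in> R K \<and> p - x' \<in> R K'))" for K' x'
    have *: "p \<in> (+) y ` A \<longleftrightarrow> p - y \<in> A" for p y and A :: "'a set"
      by (auto simp: image_iff intro!: bexI[of _ "p - y"])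
    have dis: "(+) x ` R K \<inter> (+) x' ` R K' = {} \<longleftrightarrow> D K' x'" for x' K'
      unfolding D_def disjoint_iff * by simp
    have cond: "face_less K' C \<and> \<not> face_le K' K \<and> \<not> face_le K K' \<longleftrightarrow> K' \<in> below C \<and> \<not> K' \<subseteq> K \<and> \<not> K \<subseteq> K'" for K'
      using less[of K'] face_le_iff[OF _ K(1), of K'] face_le_iff[OF K(1), of K'] K(2) by auto
    have "(\<forall>K'. K' \<in> below C \<and> \<not> K' \<subseteq> K \<and> \<not> K \<subseteq> K' \<longrightarrow> (\<forall>x' \<in> perp_lattice V \<Lambda> K'. D K' x')) \<longleftrightarrow>
      (\<forall>K'\<in>below C. \<not> K' \<subseteq> K \<and> \<not> K \<subseteq> K' \<longrightarrow> (\<forall>x'\<in>\<Lambda>. x' - 0 \<in> perp V K' \<longrightarrow> D K' x'))"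
      unfolding perp_lattice_def diff_0_right by blast
    then show ?thesis unfolding dis cond D_def[symmetric] .
  qed
  show ?thesis
    unfolding translation_set_def anchored_translations_def perp_lattice_def[of V \<Lambda> K]
    by (intro Collect_cong) (simp only: I II Int_iff diff_0_right conj_assoc cong: conj_cong)
qed

text \<open>The base case \<open>R {0} = T \<Lambda>\<close> fits the general formula: no member
  lies strictly below \<open>{0}\<close>, its span is trivial, its lattice is
  \<open>\<Lambda>\<close>, and \<open>CDC\<close> of \<open>V\<close> contains
  \<open>T \<Lambda>\<close>.\<close>

lemma region_iff:
  assumes C: "C \<in> F"
  shows "p \<in> R C \<longleftrightarrow> p \<in> V \<and> (\<forall>K\<in>F. K \<subset> C \<longrightarrow> (\<forall>x\<in>X (below C) (\<lambda>_. 0) K. p - x \<notin> R K)) \<and>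
     (\<exists>t\<in>T (perp_lattice V \<Lambda> C). \<exists>s\<in>span C. p = t + s) \<and> p \<in> CDC V \<Lambda> T (polar V C)"
proof (cases "C = {0}")
  case True
  have "R C = T \<Lambda>" using rational[OF C] pointed[OF C] True by (subst region.simps) simp
  moreover have "\<not> K \<subset> {0}" if "K \<in> F" for K using F_cone(4)[OF that] by auto
  moreover have "T \<Lambda> \<subseteq> CDC V \<Lambda> T V" using subset_CDC[of V] T_V by blast
  moreover have "polar V {0} = V" by (auto simp: mem_polar)
  ultimately show ?thesis using True T_V by auto
next
  case False
  have less: "face_less K' C \<longleftrightarrow> K' \<in> F \<and> K' \<subset> C" for K'
    using faces[OF C, of K'] face_le_iff[OF _ C, of K'] by (auto simp: face_less_def)
  have notin: "p \<notin> A + B \<longleftrightarrow> (\<forall>x\<in>A. p - x \<notin> B)" for A B :: "'a set"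
  proof -
    have "p \<in> A + B \<longleftrightarrow> (\<exists>x\<in>A. p - x \<in> B)"
    proof
      assume "p \<in> A + B"
      then obtain x y where "x \<in> A" "y \<in> B" "p = x + y" by (auto simp: set_plus_def)
      then show "\<exists>x\<in>A. p - x \<in> B" by (intro bexI[of _ x]) auto
    next
      assume "\<exists>x\<in>A. p - x \<in> B"
      then obtain x where "x \<in> A" "p - x \<in> B" by blast
      then have "x + (p - x) \<in> A + B" by (rule set_plus_intro)
      then show "p \<in> A + B" by simp
    qed
    then show ?thesis by blast
  qed
  have "p \<in> R C \<longleftrightarrow> p \<in> (V - (\<Union>K\<in>{K. face_less K C}. translation_set V \<Lambda> R C K + R K))
               \<inter> (T (perp_lattice V \<Lambda> C) + span C) \<inter> CDC V \<Lambda> T (polar V C)"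
    using rational[OF C] pointed[OF C] False by (subst region.simps) simp
  also have "(\<Union>K\<in>{K. face_less K C}. translation_set V \<Lambda> R C K + R K) =
      (\<Union>K\<in>{K\<in>F. K \<subset> C}. X (below C) (\<lambda>_. 0) K + R K)"
    using translation_set_eq[OF C] by (intro SUP_cong) (auto simp: less)
  also have "p \<in> (V - (\<Union>K\<in>{K\<in>F. K \<subset> C}. X (below C) (\<lambda>_. 0) K + R K))
               \<inter> (T (perp_lattice V \<Lambda> C) + span C) \<inter> CDC V \<Lambda> T (polar V C) \<longleftrightarrow>
     p \<in> V \<and> (\<forall>K\<in>F. K \<subset> C \<longrightarrow> p \<notin> X (below C) (\<lambda>_. 0) K + R K) \<and>
     (\<exists>t\<in>T (perp_lattice V \<Lambda> C). \<exists>s\<in>span C. p = t + s) \<and> p \<in> CDC V \<Lambda> T (polar V C)"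
    unfolding set_plus_def by blast
  finally show ?thesis unfolding notin .
qed

lemma translations_top: "C \<in> F \<Longrightarrow> X (below C) (\<lambda>_. 0) C = perp_lattice V \<Lambda> C"
  by (auto simp: anchored_translations_def perp_lattice_def)

text \<open>\<open>L(C)\<close> is orthogonal to \<open>C\<close>: adding \<open>x\<close> leaves
  the inner products in (I) with rays of \<open>C\<close> unchanged, and in (II) it permutes the
  translates of each \<open>R K'\<close>. So the part of the space taken by the proper faces of
  \<open>C\<close> is periodic under \<open>L(C)\<close>.\<close>

lemma translations_add:
  assumes C: "C \<in> F" and K: "K \<in> F" "K \<subseteq> C" and x: "x \<in> perp_lattice V \<Lambda> C" and y: "y \<in> X (below C) (\<lambda>_. 0) K"
  shows "x + y \<in> X (below C) (\<lambda>_. 0) K"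
  unfolding anchored_translations_def
proof (intro CollectI conjI ballI impI)
  have xC: "x \<in> \<Lambda>" "x \<in> perp V C" using x by (auto simp: perp_lattice_def)
  have y': "y \<in> \<Lambda>" "y - 0 \<in> perp V K" using y by (auto simp: anchored_translations_def)
  show "x + y \<in> \<Lambda>" using L_closed(3) xC y' by blast
  show "x + y - 0 \<in> perp V K"
    using xC(2) y'(2) perp_antimono[OF K(2), of V] subspace_add[OF subspace_perp[OF V], of x K y] by auto
  show "(x + y + z - 0) \<bullet> m < 0"
    if "M \<in> below C" "aff_dim M = 1 \<and> \<not> M \<subseteq> K" "z \<in> R K" "m \<in> M - {0}" for M z m
  proof -
    have "(y + z - 0) \<bullet> m < 0" using y that unfolding anchored_translations_def by blast
    moreover have "x \<bullet> m = 0" using xC that by (auto simp: mem_perp)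
    ultimately show ?thesis by (simp add: inner_add_left)
  qed
  show "\<forall>p. \<not> (p - (x + y) \<in> R K \<and> p - x' \<in> R K')"
    if K': "K' \<in> below C" "\<not> K' \<subseteq> K \<and> \<not> K \<subseteq> K'" and x': "x' \<in> \<Lambda>" "x' - 0 \<in> perp V K'" for K' x'
  proof (intro allI notI)
    fix p assume p: "p - (x + y) \<in> R K \<and> p - x' \<in> R K'"
    have "x' - x \<in> \<Lambda>" using L_closed(2) x' xC by blast
    moreover have "x' - x - 0 \<in> perp V K'"
      using xC(2) x'(2) K'(1) perp_antimono[of K' C V] subspace_diff[OF subspace_perp[OF V], of x' K' x] by auto
    moreover have "(p - x) - y \<in> R K" "(p - x) - (x' - x) \<in> R K'" using p by (auto simp: algebra_simps)
    ultimately show False using y K' unfolding anchored_translations_def by blast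
  qed
qed

lemma CDC_polar_diff:
  assumes "x \<in> perp_lattice V \<Lambda> C" "p \<in> CDC V \<Lambda> T (polar V C)"
  shows "p - x \<in> CDC V \<Lambda> T (polar V C)"
proof (rule CDC_translation[OF _ _ assms(2)])
  show "x \<in> \<Lambda>" using assms by (auto simp: perp_lattice_def)
  show "q - x \<in> polar V C" if "q \<in> polar V C" for q
    using assms(1) that V by (auto simp: perp_lattice_def mem_perp mem_polar inner_diff_left subspace_diff)
qed

text \<open>If no proper face takes \<open>p\<close>, shift it by a vector of \<open>L(C)\<close>
  that brings its component orthogonal to \<open>C\<close> into \<open>T(C)\<close>. By periodicity
  no proper face takes the shifted point either, so it meets all conditions defining
  \<open>R C\<close>.\<close>

lemma cone_cover:
  assumes C: "C \<in> F" and p: "p \<in> CDC V \<Lambda> T (polar V C)"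
  obtains K x where "K \<in> F" "K \<subseteq> C" "x \<in> X (below C) (\<lambda>_. 0) K" "p - x \<in> R K"
proof (cases "\<exists>K\<in>F. K \<subset> C \<and> (\<exists>x\<in>X (below C) (\<lambda>_. 0) K. p - x \<in> R K)")
  case True
  then show ?thesis using that by blast
next
  case False
  have pV: "p \<in> V" using p CDC_V by blast
  obtain s u where su: "s \<in> span C" "\<And>w. w \<in> span C \<Longrightarrow> orthogonal u w" "p = s + u"
    using orthogonal_subspace_decomp_exists by blast
  have sV: "s \<in> V" using su(1) F_cone(5)[OF C] V span_minimal by blast
  then have "u \<in> V" using subspace_diff[OF V pV sV] su(3) by simp
  then have "u \<in> perp V C" using su(2) by (auto simp: mem_perp orthogonal_def span_base)
  then have "u \<in> span (perp_lattice V \<Lambda> C)" using span_perp_lattice[OF C] by simp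
  then obtain x t where xt: "x \<in> perp_lattice V \<Lambda> C" "t \<in> T (perp_lattice V \<Lambda> C)" "u = x + t"
    using fundamental_domain_cover[OF domain_perp] by metis
  have "p - x \<in> R C"
    unfolding region_iff[OF C]
  proof (intro conjI ballI impI)
    have "x \<in> V" using xt L_V by (auto simp: perp_lattice_def)
    then show "p - x \<in> V" using pV V by (simp add: subspace_diff)
    show "\<exists>t\<in>T (perp_lattice V \<Lambda> C). \<exists>s\<in>span C. p - x = t + s"
      using xt su by (intro bexI[of _ t] bexI[of _ s]) auto
    show "p - x \<in> CDC V \<Lambda> T (polar V C)" using CDC_polar_diff[OF xt(1) p] .
    fix K y assume K: "K \<in> F" "K \<subset> C" and y: "y \<in> X (below C) (\<lambda>_. 0) K"
    have "x + y \<in> X (below C) (\<lambda>_. 0) K" using translations_add[OF C K(1) _ xt(1) y] K by auto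
    then have "p - (x + y) \<notin> R K" using False K by blast
    then show "p - x - y \<notin> R K" by (simp add: algebra_simps)
  qed
  then show ?thesis using that[of C x] C xt(1) translations_top[OF C] by simp
qed

lemma perp_span_inter:
  assumes "u \<in> perp V C" "u \<in> span C" shows "u = 0"
proof -
  have "C \<subseteq> {y. u \<bullet> y = 0}" using assms(1) by (auto simp: mem_perp)
  moreover have "subspace {y. u \<bullet> y = 0}" by (rule subspace_hyperplane)
  ultimately have "u \<bullet> u = 0" using span_minimal assms(2) by blast
  then show ?thesis by simp
qed

lemma T_perp:
  assumes "C \<in> F" shows "T (perp_lattice V \<Lambda> C) \<subseteq> perp V C"
  using domain_perp[of C] span_perp_lattice[OF assms] by (auto simp: fundamental_domain_def)

text \<open>The component orthogonal to \<open>C\<close> of a point of \<open>R C\<close> lies in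
  the fundamental domain \<open>T(C)\<close>, which determines the translate.\<close>

lemma region_translates_unique:
  assumes C: "C \<in> F" and x: "x \<in> perp_lattice V \<Lambda> C" "x' \<in> perp_lattice V \<Lambda> C"
    and p: "p - x \<in> R C" "p - x' \<in> R C"
  shows "x = x'"
proof -
  obtain t s where ts: "t \<in> T (perp_lattice V \<Lambda> C)" "s \<in> span C" "p - x = t + s"
    using p(1) region_iff[OF C] by blast
  obtain t' s' where ts': "t' \<in> T (perp_lattice V \<Lambda> C)" "s' \<in> span C" "p - x' = t' + s'"
    using p(2) region_iff[OF C] by blast
  note sub = subspace_add[OF subspace_perp[OF V]] subspace_diff[OF subspace_perp[OF V]]
  have tp: "t \<in> perp V C" "t' \<in> perp V C" "x \<in> perp V C" "x' \<in> perp V C"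
    using ts ts' x T_perp[OF C] by (auto simp: perp_lattice_def)
  have "p = x + t + s" "p = x' + t' + s'" using ts(3) ts'(3) by (simp_all add: algebra_simps)
  then have "(x + t) - (x' + t') = s' - s" by (simp add: algebra_simps)
  moreover have "s' - s \<in> span C" using ts ts' by (simp add: span_diff)
  moreover have "(x + t) - (x' + t') \<in> perp V C" using tp by (intro sub)
  ultimately have "(x + t) - (x' + t') = 0" by (metis perp_span_inter)
  then show ?thesis using fundamental_domain_unique[OF domain_perp x ts(1) ts'(1)] by simp
qed

text \<open>A point of \<open>perp V C\<close> is orthogonal to all rays of \<open>C\<close>,
  whereas by (I) an admissible translate of \<open>R K\<close> is strictly negative on a ray of
  \<open>C\<close> outside \<open>K\<close>. So nothing is removed from \<open>T(C)\<close>; in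
  particular 0 always stays in \<open>R C\<close>.\<close>

lemma region_Int_perp:
  assumes C: "C \<in> F"
  shows "R C \<inter> perp V C = T (perp_lattice V \<Lambda> C)"
proof
  show "R C \<inter> perp V C \<subseteq> T (perp_lattice V \<Lambda> C)"
  proof
    fix p assume p: "p \<in> R C \<inter> perp V C"
    then obtain t s where ts: "t \<in> T (perp_lattice V \<Lambda> C)" "s \<in> span C" "p = t + s"
      using region_iff[OF C] by blast
    then have "s \<in> perp V C" using p T_perp[OF C] subspace_diff[OF subspace_perp[OF V], of p C t] by auto
    then have "s = 0" using ts perp_span_inter by blast
    then show "p \<in> T (perp_lattice V \<Lambda> C)" using ts by simp
  qed
  show "T (perp_lattice V \<Lambda> C) \<subseteq> R C \<inter> perp V C"
  proof
    fix p assume pT: "p \<in> T (perp_lattice V \<Lambda> C)"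
    then have p: "p \<in> perp V C" using T_perp[OF C] by blast
    have "p \<in> R C"
      unfolding region_iff[OF C]
    proof (intro conjI ballI impI)
      show "p \<in> V" using p by (simp add: mem_perp)
      show "\<exists>t\<in>T (perp_lattice V \<Lambda> C). \<exists>s\<in>span C. p = t + s"
        using pT by (intro bexI[of _ p] bexI[of _ 0]) (auto simp: span_0)
      have "polar V C \<subseteq> CDC V \<Lambda> T (polar V C)" by (rule subset_CDC) (auto simp: mem_polar)
      then show "p \<in> CDC V \<Lambda> T (polar V C)" using p by (auto simp: mem_perp mem_polar)
      fix K x assume K: "K \<in> F" "K \<subset> C" and x: "x \<in> X (below C) (\<lambda>_. 0) K"
      obtain M where M: "M \<in> F" "aff_dim M = 1" "M \<subseteq> C" "\<not> M \<subseteq> K"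
        using ray_not_subset[OF C K(1)] K(2) by blast
      obtain m where m: "m \<in> M" "m \<noteq> 0" using ray_nonzero[OF M(1,2)] by blast
      show "p - x \<notin> R K"
      proof
        assume "p - x \<in> R K"
        then have "(x + (p - x) - 0) \<bullet> m < 0" using x M m unfolding anchored_translations_def by blast
        moreover have "p \<bullet> m = 0" using p m M by (auto simp: mem_perp)
        ultimately show False by simp
      qed
    qed
    then show "p \<in> R C \<inter> perp V C" using p by blast
  qed
qed

lemma sub_fan:
  assumes "C \<in> F" shows "lattice_fan V \<Lambda> T (below C)"
proof
  show "finite (below C)" using finite_F by simp
  fix K assume K: "K \<in> below C"
  then show "rational_cone \<Lambda> K" "pointed K" "span (perp_lattice V \<Lambda> K) = perp V K"
    using rational pointed span_perp_lattice by auto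
  show "J \<in> below C" if "face_le J K" for J
    using K faces[of K J] that face_of_imp_subset[of J K] by (auto simp: face_le_def)
  show "J face_of K" if "J \<in> below C" "J \<subseteq> K" for J
    using subset_face K that by blast
qed

end

section \<open>Tilings attached to an anchored fan\<close>

text \<open>\<open>a K\<close> stands for a lattice point of the face with normal cone
  \<open>K\<close>; only its coset modulo \<open>perp V K\<close> matters. For
  \<open>J \<subseteq> K\<close> the face of \<open>K\<close> lies in the face of \<open>J\<close>,
  which gives \<open>anchor_perp\<close>.\<close>

locale anchored_fan = lattice_fan V \<Lambda> T F
  for V \<Lambda> :: "'a::euclidean_space set" and T F +
  fixes a :: "'a set \<Rightarrow> 'a"
  assumes anchor_L: "K \<in> F \<Longrightarrow> a K \<in> \<Lambda>"
    and anchor_perp: "J \<in> F \<Longrightarrow> K \<in> F \<Longrightarrow> J \<subseteq> K \<Longrightarrow> a K - a J \<in> perp V J"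
begin

lemmas perp_add = subspace_add[OF subspace_perp[OF V]]
lemmas perp_diff = subspace_diff[OF subspace_perp[OF V]]

lemma translationsD:
  assumes "x \<in> X F a K"
  shows "x \<in> \<Lambda>" "x - a K \<in> perp V K"
    "M \<in> F \<Longrightarrow> aff_dim M = 1 \<Longrightarrow> \<not> M \<subseteq> K \<Longrightarrow> y \<in> R K \<Longrightarrow> m \<in> M \<Longrightarrow> m \<noteq> 0 \<Longrightarrow> (x + y - a M) \<bullet> m < 0"
    "J \<in> F \<Longrightarrow> \<not> J \<subseteq> K \<Longrightarrow> \<not> K \<subseteq> J \<Longrightarrow> x' \<in> \<Lambda> \<Longrightarrow> x' - a J \<in> perp V J \<Longrightarrow> p - x \<in> R K \<Longrightarrow> p - x' \<in> R J \<Longrightarrow> False"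
  using assms unfolding anchored_translations_def by blast+

text \<open>\<open>x - a M\<close> is orthogonal to \<open>M\<close>, being the sum of
  \<open>x - a K\<close> and \<open>a K - a M\<close>. So inequalities of rays inside
  \<open>K\<close> can be read relative to any point of the coset of \<open>K\<close>.\<close>

lemma anchor_inner:
  assumes "K \<in> F" "M \<in> F" "M \<subseteq> K" "x - a K \<in> perp V K" "m \<in> M"
  shows "(y - a M) \<bullet> m = (y - x) \<bullet> m"
proof -
  have "(x - a K) \<bullet> m = 0" "(a K - a M) \<bullet> m = 0"
    using assms anchor_perp[OF assms(2,1,3)] by (auto simp: mem_perp)
  then show ?thesis by (simp add: inner_diff_left)
qed

lemma anchor_coset_mono:
  assumes "J \<in> F" "K \<in> F" "J \<subseteq> K" "x - a K \<in> perp V K"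
  shows "x - a J \<in> perp V J"
  using perp_add[of "x - a K" J "a K - a J"] anchor_perp[OF assms(1-3)] assms(4) perp_antimono[OF assms(3), of V]
  by auto

text \<open>Seen from \<open>x\<close>, the conditions of the whole fan include those of the cone
  \<open>K\<close>, because \<open>x\<close> belongs to the cosets of all faces of \<open>K\<close>.
  This links tiles of the fan to the sets removed in the definition of \<open>R K\<close>.\<close>

lemma translations_relative:
  assumes K: "K \<in> F" and J: "J \<in> F" "J \<subseteq> K"
    and x: "x \<in> \<Lambda>" "x - a K \<in> perp V K" and x': "x' \<in> X F a J"
  shows "x' - x \<in> X (below K) (\<lambda>_. 0) J"
  unfolding anchored_translations_def
proof (intro CollectI conjI ballI impI)
  note x' = translationsD[OF x']
  show "x' - x \<in> \<Lambda>" using L_closed(2) x x' by blast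
  show "x' - x - 0 \<in> perp V J"
    using perp_diff[OF x'(2) anchor_coset_mono[OF J(1) K J(2) x(2)]] by simp
  show "(x' - x + y - 0) \<bullet> m < 0"
    if M: "M \<in> below K" "aff_dim M = 1 \<and> \<not> M \<subseteq> J" "y \<in> R J" "m \<in> M - {0}" for M y m
    using x'(3)[of M y m] anchor_inner[OF K _ _ x(2), of M m "x' + y"] M by (simp add: algebra_simps)
  show "\<forall>p. \<not> (p - (x' - x) \<in> R J \<and> p - x'' \<in> R J')"
    if J': "J' \<in> below K" "\<not> J' \<subseteq> J \<and> \<not> J \<subseteq> J'" and x'': "x'' \<in> \<Lambda>" "x'' - 0 \<in> perp V J'" for J' x''
  proof (intro allI notI)
    fix p assume p: "p - (x' - x) \<in> R J \<and> p - x'' \<in> R J'"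
    have "x + x'' \<in> \<Lambda>" using L_closed(3) x x'' by blast
    moreover have "(x + x'') - a J' \<in> perp V J'"
      using perp_add[OF anchor_coset_mono[OF _ K _ x(2)], of J' x''] x'' J' by (auto simp: algebra_simps)
    moreover have "(p + x) - x' \<in> R J" "(p + x) - (x + x'') \<in> R J'" using p by (auto simp: algebra_simps)
    ultimately show False using x'(4)[of J' "x + x''" "p + x"] J' by blast
  qed
qed

lemma translates_disjoint_less:
  assumes K: "K \<in> F" and J: "J \<in> F" "J \<subset> K" and x: "x \<in> X F a K" and x': "x' \<in> X F a J"
    and p: "p - x \<in> R K" "p - x' \<in> R J"
  shows False
proof -
  have "x' - x \<in> X (below K) (\<lambda>_. 0) J"
    using translations_relative[OF K J(1) _ _ _ x'] J(2) translationsD(1,2)[OF x] by auto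
  then have "(p - x) - (x' - x) \<notin> R J" using p(1) J unfolding region_iff[OF K] by blast
  then show False using p(2) by simp
qed

text \<open>Tiles of equal cones are separated by the fundamental domain \<open>T(K)\<close>, those
  of comparable cones because the tile of the smaller cone is removed when the region of the larger
  one is formed, and those of incomparable cones by (II).\<close>

lemma translates_disjoint:
  assumes K: "K \<in> F" and J: "J \<in> F" and x: "x \<in> X F a K" and x': "x' \<in> X F a J"
    and p: "p - x \<in> R K" "p - x' \<in> R J"
  shows "K = J \<and> x = x'"
proof -
  consider "K = J" | "J \<subset> K" | "K \<subset> J" | "\<not> J \<subseteq> K" "\<not> K \<subseteq> J" by blast
  then show ?thesis
  proof cases
    case 1
    have "x - x' \<in> perp V K" using perp_diff[OF translationsD(2)[OF x] translationsD(2)[OF x'[folded 1]]] by simp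
    then have "x - x' \<in> perp_lattice V \<Lambda> K"
      using L_closed(2) translationsD(1)[OF x] translationsD(1)[OF x'] by (simp add: perp_lattice_def)
    moreover have "0 \<in> perp_lattice V \<Lambda> K"
      using L_closed(1) subspace_0[OF subspace_perp[OF V]] by (simp add: perp_lattice_def)
    moreover have "(p - x') - (x - x') \<in> R K" "(p - x') - 0 \<in> R K" using p 1 by simp_all
    ultimately have "x - x' = 0" using region_translates_unique[OF K] by blast
    then show ?thesis using 1 by simp
  next
    case 2
    then show ?thesis using translates_disjoint_less[OF K J _ x x' p] by blast
  next
    case 3
    then show ?thesis using translates_disjoint_less[OF J K _ x' x p(2,1)] by blast
  next
    case 4
    then show ?thesis
      using translationsD(4)[OF x J 4 translationsD(1,2)[OF x'] p] by blast
  qed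
qed

text \<open>For \<open>below C\<close> with zero anchors this is the polar of \<open>C\<close>; for
  the normal fan with anchors \<open>t\<close> times a point of the face it is
  \<open>tP\<close>.\<close>

definition anchored_polyhedron :: "'a set" where
  "anchored_polyhedron = {y \<in> V. \<forall>M\<in>F. aff_dim M = 1 \<longrightarrow> (\<forall>m\<in>M. (y - a M) \<bullet> m \<le> 0)}"

text \<open>The inequalities of rays inside \<open>K\<close> describe the tangent cone
  \<open>x + polar V K\<close>; those of the other rays have to be supplied separately.\<close>

lemma anchored_polyhedron_local:
  assumes K: "K \<in> F" and x: "x \<in> X F a K"
  shows "y \<in> anchored_polyhedron \<Longrightarrow> y - x \<in> polar V K"
    and "y \<in> V \<Longrightarrow> y - x \<in> polar V K \<Longrightarrow>
      (\<And>M m. M \<in> F \<Longrightarrow> aff_dim M = 1 \<Longrightarrow> \<not> M \<subseteq> K \<Longrightarrow> m \<in> M \<Longrightarrow> m \<noteq> 0 \<Longrightarrow> (y - a M) \<bullet> m \<le> 0) \<Longrightarrow> y \<in> anchored_polyhedron"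
proof -
  have eq: "(y - a M) \<bullet> m = (y - x) \<bullet> m" if "M \<in> F" "M \<subseteq> K" "m \<in> M" for M m y
    using anchor_inner[OF K that(1,2) translationsD(2)[OF x] that(3)] .
  have xV: "x \<in> V" using translationsD(1)[OF x] L_V by blast
  show "y - x \<in> polar V K" if y: "y \<in> anchored_polyhedron"
    unfolding mem_polar_rays[OF K]
    using y eq xV V by (auto simp: anchored_polyhedron_def subspace_diff)
  show "y \<in> anchored_polyhedron" if y: "y \<in> V" "y - x \<in> polar V K"
    "\<And>M m. M \<in> F \<Longrightarrow> aff_dim M = 1 \<Longrightarrow> \<not> M \<subseteq> K \<Longrightarrow> m \<in> M \<Longrightarrow> m \<noteq> 0 \<Longrightarrow> (y - a M) \<bullet> m \<le> 0"
    unfolding anchored_polyhedron_def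
  proof (intro CollectI conjI ballI impI y(1))
    fix M m assume M: "M \<in> F" "aff_dim M = 1" "m \<in> M"
    show "(y - a M) \<bullet> m \<le> 0"
    proof (cases "M \<subseteq> K")
      case True
      then show ?thesis using eq[OF M(1) True M(3), of y] y(2) M(3) by (auto simp: mem_polar)
    next
      case False
      then show ?thesis using y(3)[OF M(1,2) False M(3)] by (cases "m = 0") auto
    qed
  qed
qed

text \<open>On the tile \<open>x + R K\<close> the inequalities of all rays outside \<open>K\<close>
  hold strictly by (I).\<close>

lemma polyhedron_region_iff:
  assumes K: "K \<in> F" and x: "x \<in> X F a K" and p: "p - x \<in> R K"
  shows "p \<in> anchored_polyhedron \<longleftrightarrow> p - x \<in> polar V K"
proof
  assume r: "p - x \<in> polar V K"
  have xV: "x \<in> V" using translationsD(1)[OF x] L_V by blast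
  then have pV: "p \<in> V" using r subspace_add[OF V, of "p - x" x] by (simp add: mem_polar)
  have "(p - a M) \<bullet> m \<le> 0" if "M \<in> F" "aff_dim M = 1" "\<not> M \<subseteq> K" "m \<in> M" "m \<noteq> 0" for M m
    using translationsD(3)[OF x that(1,2,3) p that(4,5)] by simp
  then show "p \<in> anchored_polyhedron" using anchored_polyhedron_local(2)[OF K x pV r] by blast
qed (rule anchored_polyhedron_local(1)[OF K x])

text \<open>
  If a tile meeting \<open>x + R K\<close> had its lattice point beyond the hyperplane of a ray \<open>M\<close> not in \<open>K\<close>,
  it would be covered by translates of \<open>R M\<close>, against condition (II) for \<open>K\<close> and \<open>M\<close>.
\<close>

lemma DC_region_iff:
  assumes K: "K \<in> F" and x: "x \<in> X F a K" and p: "p - x \<in> R K"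
  shows "p \<in> DC V \<Lambda> T anchored_polyhedron \<longleftrightarrow> p - x \<in> DC V \<Lambda> T (polar V K)"
proof
  note x' = translationsD[OF x]
  assume "p \<in> DC V \<Lambda> T anchored_polyhedron"
  then obtain z \<tau> where z: "z \<in> \<Lambda>" "\<tau> \<in> T \<Lambda>" "p = z + \<tau>" "z \<in> anchored_polyhedron"
    unfolding mem_DC by blast
  have "z - x \<in> \<Lambda>" using L_closed(2) z x' by blast
  moreover have "z - x \<in> polar V K" by (rule anchored_polyhedron_local(1)[OF K x z(4)])
  moreover have "p - x = (z - x) + \<tau>" using z by simp
  ultimately show "p - x \<in> DC V \<Lambda> T (polar V K)" unfolding mem_DC using z(2) by blast
next
  note x' = translationsD[OF x]
  assume "p - x \<in> DC V \<Lambda> T (polar V K)"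
  then obtain w \<tau> where w: "w \<in> \<Lambda>" "\<tau> \<in> T \<Lambda>" "p - x = w + \<tau>" "w \<in> polar V K"
    unfolding mem_DC by blast
  define z where "z = w + x"
  have z: "z \<in> \<Lambda>" "p = z + \<tau>" "z - x \<in> polar V K"
    using w L_closed(3) x'(1) by (auto simp: z_def algebra_simps)
  have "(z - a M) \<bullet> m \<le> 0" if M: "M \<in> F" "aff_dim M = 1" "\<not> M \<subseteq> K" "m \<in> M" "m \<noteq> 0" for M m
  proof (rule ccontr)
    assume "\<not> (z - a M) \<bullet> m \<le> 0"
    then have zm: "(z - a M) \<bullet> m > 0" by simp
    have pM: "(p - a M) \<bullet> m' < 0" if "m' \<in> M" "m' \<noteq> 0" for m'
      using x'(3)[OF M(1-3) p that] by simp
    have zM: "z - a M \<in> \<Lambda>" using L_closed(2) z anchor_L[OF M(1)] by blast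
    have pz: "p - a M = (z - a M) + \<tau>" using z by simp
    have T0: "R {0} = T \<Lambda>"
    proof -
      have "perp V {0} = V" by (auto simp: mem_perp)
      then show ?thesis using region_Int_perp[OF zero_F[OF K]] region_V[OF zero_F[OF K]] by auto
    qed
    show False
    proof (cases "K = {0}")
      \<comment> \<open>For \<open>K = {0}\<close> condition (II) says nothing about
        \<open>M\<close>, as the two are comparable. But then \<open>z\<close> is \<open>x\<close>
        itself, and (I) applies to it.\<close>
      case True
      then have "p - x \<in> T \<Lambda>" using p T0 by simp
      then have "x = z" using fundamental_domain_unique[OF domain_L x'(1) z(1) _ w(2), of "p - x"] z by simp
      moreover have "(x + 0 - a M) \<bullet> m < 0"
        by (rule x'(3)[OF M(1-3) _ M(4,5)]) (use True T0 zero_T in simp)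
      ultimately show False using zm by simp
    next
      case False
      have "\<not> K \<subseteq> M"
      proof
        assume KM: "K \<subseteq> M"
        have "M \<noteq> K" using M by blast
        then have "aff_dim K < aff_dim M"
          using subset_face[OF K M(1) KM] F_cone(2)[OF M(1)] by (intro face_of_aff_dim_lt) auto
        moreover have "aff_dim K \<noteq> -1" using F_cone(4)[OF K] aff_dim_empty[of K] by auto
        ultimately have "aff_dim K = 0" using M(2) aff_dim_geq[of K] by linarith
        then obtain k where "K = {k}" using aff_dim_eq_0 by blast
        then show False using False F_cone(4)[OF K] by simp
      qed
      have "p \<in> V" using z w(2) L_V T_V subspace_add[OF V] by auto
      then have "p - a M \<in> polar V M"
        using pM anchor_L[OF M(1)] L_V subspace_diff[OF V] unfolding mem_polar by force
      then have "p - a M \<in> CDC V \<Lambda> T (polar V M)"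
        unfolding mem_CDC using zM w(2) pz by metis
      \<comment> \<open>In the tiling of the cone at \<open>M\<close>, the point lies in a tile of
        \<open>M\<close> or of \<open>{0}\<close>. The former is excluded by (II) for
        \<open>K\<close> and \<open>M\<close>; the latter forces \<open>y = z - a M\<close>, and (I)
        at \<open>0 \<in> R {0}\<close> contradicts \<open>zm\<close>.\<close>
      then obtain J y where J: "J \<in> F" "J \<subseteq> M" and y: "y \<in> X (below M) (\<lambda>_. 0) J" "p - a M - y \<in> R J"
        using cone_cover[OF M(1)] by blast
      show False
      proof (cases "J = M")
        case True
        then have "y \<in> perp_lattice V \<Lambda> M" using y translations_top[OF M(1)] by simp
        then have "a M + y \<in> \<Lambda>" "(a M + y) - a M \<in> perp V M"
          using anchor_L[OF M(1)] L_closed(3) by (auto simp: perp_lattice_def)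
        then show False using x'(4)[OF M(1,3) \<open>\<not> K \<subseteq> M\<close> _ _ p, of "a M + y"] y True by (simp add: algebra_simps)
      next
        case False
        have "J = {0}"
        proof -
          have "aff_dim J < aff_dim M"
            using subset_face[OF J(1) M(1) J(2)] F_cone(2)[OF M(1)] False by (intro face_of_aff_dim_lt) auto
          moreover have "aff_dim J \<noteq> -1" using F_cone(4)[OF J(1)] aff_dim_empty[of J] by auto
          ultimately have "aff_dim J = 0" using M(2) aff_dim_geq[of J] by linarith
          then obtain k where "J = {k}" using aff_dim_eq_0 by blast
          then show ?thesis using F_cone(4)[OF J(1)] by simp
        qed
        then have "p - a M - y \<in> T \<Lambda>" using y T0 by simp
        moreover have yL: "y \<in> \<Lambda>" using y by (simp add: anchored_translations_def)
        ultimately have "y = z - a M"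
          using fundamental_domain_unique[OF domain_L yL zM _ w(2), of "p - a M - y"] pz by simp
        moreover have "(y + 0 - 0) \<bullet> m < 0"
        proof -
          have "0 \<in> R J" using \<open>J = {0}\<close> T0 zero_T by simp
          moreover have "\<not> M \<subseteq> J" using M(4,5) \<open>J = {0}\<close> by auto
          ultimately show ?thesis using y(1) M unfolding anchored_translations_def by blast
        qed
        ultimately show False using zm by simp
      qed
    qed
  qed
  moreover have "z \<in> V" using z L_V by blast
  ultimately have "z \<in> anchored_polyhedron" using anchored_polyhedron_local(2)[OF K x _ z(3)] by blast
  then show "p \<in> DC V \<Lambda> T anchored_polyhedron" unfolding mem_DC using z w(2) by blast
qed

text \<open>
  A point far from the hyperplanes of all rays outside \<open>K\<close> only sees the faces of \<open>K\<close>: the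
  translate covering it with respect to \<open>K\<close> is admissible for the whole fan.
\<close>

lemma cover_near_face:
  assumes K: "K \<in> F" and p: "p - a K \<in> CDC V \<Lambda> T (polar V K)"
    and bd: "\<And>J y. J \<in> F \<Longrightarrow> \<not> K \<subset> J \<Longrightarrow> y \<in> R J \<Longrightarrow> norm y \<le> r"
    and far: "\<And>M m. M \<in> F \<Longrightarrow> aff_dim M = 1 \<Longrightarrow> \<not> M \<subseteq> K \<Longrightarrow> m \<in> M \<Longrightarrow> m \<noteq> 0 \<Longrightarrow> (p - a M) \<bullet> m < - 3 * r * norm m"
  obtains J x where "J \<in> F" "J \<subseteq> K" "x \<in> X F a J" "p - x \<in> R J"
proof -
  obtain J x0 where J: "J \<in> F" "J \<subseteq> K" and x0: "x0 \<in> X (below K) (\<lambda>_. 0) J" "p - a K - x0 \<in> R J"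
    by (rule cone_cover[OF K p])
  define x where "x = x0 + a K"
  have x0': "x0 \<in> \<Lambda>" "x0 \<in> perp V J" using x0 by (auto simp: anchored_translations_def)
  have pJ: "p - x \<in> R J" using x0 by (simp add: x_def algebra_simps)
  \<comment> \<open>The bounds \<open>bd\<close> cover only cones that do not strictly contain
    \<open>K\<close>, so that the lemma can be used inside the induction that proves the regions
    bounded.\<close>
  have nJ: "norm y \<le> r" if "y \<in> R J" for y using bd[OF J(1) _ that] J(2) by blast
  have r: "0 \<le> r" using nJ[OF pJ] norm_ge_zero order_trans by blast
  have inner_le: "y \<bullet> m \<le> r * norm m" "- (y \<bullet> m) \<le> r * norm m" if "norm y \<le> r" for y m :: 'a
  proof -
    have "\<bar>y \<bullet> m\<bar> \<le> norm y * norm m" by (rule Cauchy_Schwarz_ineq2)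
    also have "\<dots> \<le> r * norm m" using that by (rule mult_right_mono) simp
    finally show "y \<bullet> m \<le> r * norm m" "- (y \<bullet> m) \<le> r * norm m" by auto
  qed
  \<comment> \<open>Of the margin \<open>3 * r\<close>, one \<open>r\<close> pays for
    \<open>p - x\<close> and one for \<open>y\<close>; the last is kept for \<open>q - x'\<close> in
    condition (II).\<close>
  have far': "(x + y - a M) \<bullet> m < - r * norm m"
    if M: "M \<in> F" "aff_dim M = 1" "\<not> M \<subseteq> K" "m \<in> M" "m \<noteq> 0" and y: "y \<in> R J" for M m y
  proof -
    have "(x + y - a M) \<bullet> m = (p - a M) \<bullet> m - (p - x) \<bullet> m + y \<bullet> m" by (simp add: inner_diff_left inner_add_left)
    then show ?thesis using far[OF M] inner_le(2)[OF nJ[OF pJ], of m] inner_le(1)[OF nJ[OF y], of m] by simp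
  qed
  have "x \<in> X F a J"
    unfolding anchored_translations_def
  proof (intro CollectI conjI ballI impI)
    show "x \<in> \<Lambda>" using x0' anchor_L[OF K] L_closed(3) by (simp add: x_def)
    show "x - a J \<in> perp V J" using perp_add[OF x0'(2) anchor_perp[OF J(1) K J(2)]] by (simp add: x_def algebra_simps)
    show "(x + y - a M) \<bullet> m < 0"
      if M: "M \<in> F" "aff_dim M = 1 \<and> \<not> M \<subseteq> J" "y \<in> R J" "m \<in> M - {0}" for M y m
    proof (cases "M \<subseteq> K")
      case True
      then have "(x0 + y - 0) \<bullet> m < 0" using x0(1) M unfolding anchored_translations_def by blast
      moreover have "(a K - a M) \<bullet> m = 0" using anchor_perp[OF M(1) K True] M(4) by (auto simp: mem_perp)
      ultimately show ?thesis by (simp add: x_def inner_diff_left inner_add_left)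
    next
      case False
      moreover have "r * norm m \<ge> 0" using r by simp
      ultimately show ?thesis using far'[of M m y] M by auto
    qed
    show "\<forall>q. \<not> (q - x \<in> R J \<and> q - x' \<in> R J')"
      if J': "J' \<in> F" "\<not> J' \<subseteq> J \<and> \<not> J \<subseteq> J'" and x': "x' \<in> \<Lambda>" "x' - a J' \<in> perp V J'" for J' x'
    proof (intro allI notI)
      fix q assume q: "q - x \<in> R J \<and> q - x' \<in> R J'"
      show False
      proof (cases "J' \<subseteq> K")
        case True
        have "x' - a K \<in> \<Lambda>" using x' L_closed(2) anchor_L[OF K] by blast
        moreover have "x' - a K - 0 \<in> perp V J'"
          using perp_diff[OF x'(2) anchor_perp[OF J'(1) K True]] by simp
        moreover have "(q - a K) - x0 \<in> R J" "(q - a K) - (x' - a K) \<in> R J'"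
          using q by (auto simp: x_def algebra_simps)
        moreover have "J' \<in> below K" using J' True by simp
        ultimately show False using x0(1) J'(2) unfolding anchored_translations_def by blast
      next
        case False
        \<comment> \<open>\<open>J'\<close> has a ray outside \<open>K\<close>. Its hyperplane is
          within \<open>r\<close> of every point of \<open>x' + R J'\<close>, but all points of
          \<open>x + R J\<close> are beyond distance \<open>r\<close> from it on the inner
          side.\<close>
        obtain M where M: "M \<in> F" "aff_dim M = 1" "M \<subseteq> J'" "\<not> M \<subseteq> K"
          using ray_not_subset[OF J'(1) K False] by blast
        obtain m where m: "m \<in> M" "m \<noteq> 0" using ray_nonzero[OF M(1,2)] by blast
        have "(x + (q - x) - a M) \<bullet> m < - r * norm m" using far'[OF M(1,2,4) m] q by blast
        moreover have "(q - a M) \<bullet> m = (q - x') \<bullet> m" by (rule anchor_inner[OF J'(1) M(1,3) x'(2) m(1)])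
        moreover have "\<not> K \<subset> J'" using J(2) J'(2) by blast
        then have "norm (q - x') \<le> r" using bd[OF J'(1)] q by blast
        ultimately show False using inner_le(2)[of "q - x'" m] by simp
      qed
    qed
  qed
  then show ?thesis using that J pJ by blast
qed

end

text \<open>\<open>\<pi>\<close> is the projection along \<open>S\<close>, that is, onto its
  orthogonal complement: one Gram-Schmidt step.\<close>

lemma orthogonal_projection_exists:
  fixes S :: "'a::euclidean_space set"
  assumes "subspace S"
  obtains \<pi> :: "'a \<Rightarrow> 'a" where "linear \<pi>" "\<And>p. p - \<pi> p \<in> S" "\<And>p w. w \<in> S \<Longrightarrow> \<pi> p \<bullet> w = 0"
proof -
  obtain B where B: "B \<subseteq> S" "pairwise orthogonal B" "span B = S" "finite B"
    using orthonormal_basis_subspace[OF assms] finiteI_independent by metis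
  define \<pi> where "\<pi> = (\<lambda>p. p - (\<Sum>b\<in>B. (b \<bullet> p / (b \<bullet> b)) *\<^sub>R b))"
  have "linear \<pi>"
    unfolding \<pi>_def
    by (rule linearI) (simp_all add: inner_add_right add_divide_distrib scaleR_add_left sum.distrib
        algebra_simps scaleR_sum_right)
  moreover have "p - \<pi> p \<in> S" for p
    using assms B(1) by (auto simp: \<pi>_def intro!: subspace_sum subspace_scale)
  moreover have "\<pi> p \<bullet> w = 0" if "w \<in> S" for p w
    using Gram_Schmidt_step[OF B(2), of w p] that B(3) by (simp add: \<pi>_def orthogonal_def inner_commute)
  ultimately show ?thesis using that by blast
qed

section \<open>Boundedness and measurability of the regions\<close>

context lattice_fan
begin

lemma sub_anchored_fan:
  assumes "C \<in> F" shows "anchored_fan V \<Lambda> T (below C) (\<lambda>_. 0)"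
proof -
  interpret sub: lattice_fan V \<Lambda> T "below C" by (rule sub_fan[OF assms])
  show ?thesis
    by unfold_locales (use L_closed(1) subspace_0[OF subspace_perp[OF V]] in auto)
qed

lemma ray_unit:
  assumes M: "M \<in> F" "aff_dim M = 1"
  obtains g where "norm g = 1" "M = (\<lambda>r. r *\<^sub>R g) ` {0..}"
proof -
  obtain m where m: "m \<noteq> 0" "M = (\<lambda>r. r *\<^sub>R m) ` {0..}" using ray_generator[OF M] by blast
  let ?g = "(1 / norm m) *\<^sub>R m"
  have "r *\<^sub>R m \<in> (\<lambda>r. r *\<^sub>R ?g) ` {0..}" if "r \<ge> 0" for r
    using that m(1) by (intro image_eqI[of _ _ "r * norm m"]) auto
  moreover have "r *\<^sub>R ?g \<in> M" if "r \<ge> 0" for r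
    unfolding m(2) using that m(1) by (intro image_eqI[of _ _ "r / norm m"]) auto
  ultimately have "M = (\<lambda>r. r *\<^sub>R ?g) ` {0..}" using m(2) by auto
  moreover have "norm ?g = 1" using m(1) by simp
  ultimately show ?thesis using that by blast
qed

lemma unit_generators:
  obtains g where "\<forall>M\<in>F. aff_dim M = 1 \<longrightarrow> norm (g M) = 1 \<and> M = (\<lambda>r. r *\<^sub>R g M) ` {0..} \<and> g M \<in> M"
proof -
  have "\<forall>M\<in>{M\<in>F. aff_dim M = 1}. \<exists>g. norm g = 1 \<and> M = (\<lambda>r. r *\<^sub>R g) ` {0..}"
    using ray_unit by blast
  from bchoice[OF this] obtain g
    where "\<forall>M\<in>{M\<in>F. aff_dim M = 1}. norm (g M) = 1 \<and> M = (\<lambda>r. r *\<^sub>R g M) ` {0..}" by (rule exE)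
  then have g: "norm (g M) = 1 \<and> M = (\<lambda>r. r *\<^sub>R g M) ` {0..}" if "M \<in> F" "aff_dim M = 1" for M
    using that by blast
  have gM: "g M \<in> M" if "M \<in> F" "aff_dim M = 1" for M
  proof -
    have "1 *\<^sub>R g M \<in> (\<lambda>r. r *\<^sub>R g M) ` {0..}" by (intro imageI) simp
    then show ?thesis using g[OF that] by simp
  qed
  show ?thesis by (rule that[of g]) (use g gM in blast)
qed

lemma closed_polar: "closed (polar V C)"
proof -
  have "polar V C = V \<inter> (\<Inter>m\<in>C. {x. m \<bullet> x \<le> 0})" by (auto simp: mem_polar inner_commute)
  then show ?thesis using closed_subspace[OF V] by (simp add: closed_INT closed_halfspace_le closed_Int)
qed

lemma region_induct [consumes 1, case_names less]:
  assumes "C \<in> F" "\<And>C. C \<in> F \<Longrightarrow> (\<And>K. K \<in> F \<Longrightarrow> K \<subset> C \<Longrightarrow> P K) \<Longrightarrow> P C"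
  shows "P C"
  using assms(1)
proof (induction "card (below C)" arbitrary: C rule: less_induct)
  case less
  show ?case
  proof (rule assms(2)[OF less.prems])
    fix K assume K: "K \<in> F" "K \<subset> C"
    have "below K \<subset> below C" using K less.prems by blast
    then have "card (below K) < card (below C)" using finite_F by (intro psubset_card_mono) auto
    then show "P K" using less.hyps K by blast
  qed
qed

text \<open>
  By compactness, a point of the polar of \<open>C\<close> whose projection to \<open>span C\<close> is large is far from the
  hyperplanes of all rays outside some proper face, hence already covered by a smaller region.
\<close>

lemma bounded_region:
  assumes "C \<in> F" shows "bounded (R C)"
  using assms
proof (induction C rule: region_induct)
  case (less C)
  interpret sub: anchored_fan V \<Lambda> T "below C" "\<lambda>_. 0" by (rule sub_anchored_fan[OF less.hyps])
  have "bounded (\<Union>K\<in>{K\<in>F. K \<subset> C}. R K)" using finite_F less.IH by (intro bounded_UN) auto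
  then obtain r where r: "r > 0" "\<And>K y. K \<in> F \<Longrightarrow> K \<subset> C \<Longrightarrow> y \<in> R K \<Longrightarrow> norm y \<le> r"
    unfolding bounded_pos by blast
  obtain c where c: "c > 0" "\<And>y. y \<in> T \<Lambda> \<Longrightarrow> norm y \<le> c"
    using domain_L unfolding fundamental_domain_def bounded_pos by blast
  obtain c1 where c1: "\<And>y. y \<in> T (perp_lattice V \<Lambda> C) \<Longrightarrow> norm y \<le> c1"
    using domain_perp[of C] unfolding fundamental_domain_def bounded_pos by blast
  obtain g where unit: "\<forall>M\<in>F. aff_dim M = 1 \<longrightarrow> norm (g M) = 1 \<and> M = (\<lambda>r. r *\<^sub>R g M) ` {0..} \<and> g M \<in> M"
    by (rule unit_generators)
  then have g: "norm (g M) = 1 \<and> M = (\<lambda>r. r *\<^sub>R g M) ` {0..}" and gM: "g M \<in> M"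
    if "M \<in> F" "aff_dim M = 1" for M using that by blast+
  let ?S = "polar V C \<inter> span C \<inter> sphere 0 1"
  let ?G = "\<lambda>K. {M \<in> below C. aff_dim M = 1 \<and> \<not> M \<subseteq> K}"
  have "\<exists>\<delta>>0. \<forall>q\<in>?S. \<exists>K\<in>{K\<in>F. K \<subset> C}. \<forall>M\<in>?G K. - (q \<bullet> g M) \<ge> \<delta>"
  proof -
    have cpt: "compact ?S" by (intro closed_Int_compact closed_Int closed_polar closed_span compact_sphere)
    have pos: "\<exists>K\<in>{K\<in>F. K \<subset> C}. \<forall>M\<in>?G K. - (q \<bullet> g M) > 0" if q: "q \<in> ?S" for q
    proof -
      \<comment> \<open>The margin at \<open>q\<close> comes from the face of \<open>C\<close> on
        which \<open>q\<close> vanishes. It is proper because \<open>q\<close> is a nonzero vector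
        of \<open>span C\<close>.\<close>
      let ?K = "{m \<in> C. q \<bullet> m = 0}"
      note Cc = F_cone[OF less.hyps]
      have neg: "q \<bullet> m \<le> 0" if "m \<in> C" for m using q that by (auto simp: mem_polar)
      have Keq: "?K = C \<inter> {m. q \<bullet> m = 0}" by blast
      have cK: "conic ?K" using Cc(3) by (auto simp: conic_def)
      have "?K face_of C"
      proof (rule face_of_coneI[OF Cc(3) _ _ cK])
        show "convex ?K" unfolding Keq by (intro convex_Int Cc(2) convex_hyperplane)
        show "x \<in> ?K \<and> y \<in> ?K" if "x \<in> C" "y \<in> C" "x + y \<in> ?K" for x y
          using neg[OF that(1)] neg[OF that(2)] that by (auto simp: inner_add_right)
      qed blast
      moreover have "0 \<in> ?K" using Cc(4) by simp
      ultimately have "?K \<in> F" using faces[OF less.hyps, of ?K] unfolding face_le_def by blast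
      moreover have "?K \<noteq> C"
      proof
        assume "?K = C"
        then have "q \<in> perp V C" using q by (auto simp: mem_perp mem_polar)
        then have "q = 0" using perp_span_inter q by blast
        then show False using q by simp
      qed
      moreover have "- (q \<bullet> g M) > 0" if M: "M \<in> ?G ?K" for M
      proof -
        have "M = (\<lambda>r. r *\<^sub>R g M) ` {0..}" using g M by simp
        then have "g M \<notin> ?K" using M cK by (metis (no_types, lifting) atLeast_iff conicD image_subsetI mem_Collect_eq)
        moreover have "g M \<in> C" using gM[of M] M by auto
        ultimately show ?thesis using neg[of "g M"] by auto
      qed
      ultimately show ?thesis by (intro bexI[of _ ?K]) auto
    qed
    have cont: "continuous_on ?S (\<lambda>q. - (q \<bullet> g M))" for M by (intro continuous_intros)
    have fin: "finite {K\<in>F. K \<subset> C}" "\<And>K. K \<in> {K\<in>F. K \<subset> C} \<Longrightarrow> finite (?G K)" using finite_F by auto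
    show ?thesis
      by (rule compact_uniform_margin[OF cpt fin cont pos]) blast+
  qed
  then obtain \<delta> where \<delta>: "\<delta> > 0" "\<And>q. q \<in> ?S \<Longrightarrow> \<exists>K\<in>{K\<in>F. K \<subset> C}. \<forall>M\<in>?G K. - (q \<bullet> g M) \<ge> \<delta>" by blast
  \<comment> \<open>\<open>\<delta> * B\<close> is the \<open>3 * r\<close> demanded by
    \<open>cover_near_face\<close> plus \<open>2 * c\<close>, which bounds the distance from
    \<open>s\<close> to \<open>q0\<close>.\<close>
  define B where "B = (3 * r + 2 * c) / \<delta>"
  have "norm y \<le> c1 + B + 2 * c" if y: "y \<in> R C" for y
  proof -
    obtain t s where ts: "t \<in> T (perp_lattice V \<Lambda> C)" "s \<in> span C" "y = t + s"
      using y region_iff[OF less.hyps] by blast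
    have yCDC: "y \<in> CDC V \<Lambda> T (polar V C)" using y region_iff[OF less.hyps] by blast
    then obtain z \<tau> \<sigma> where z: "\<tau> \<in> T \<Lambda>" "y = z + \<tau>" "\<sigma> \<in> T \<Lambda>" "z + \<sigma> \<in> polar V C"
      unfolding mem_CDC by blast
    define q where "q = z + \<sigma>"
    obtain q0 u where q0: "q0 \<in> span C" "\<And>w. w \<in> span C \<Longrightarrow> orthogonal u w" "q = q0 + u"
      using orthogonal_subspace_decomp_exists by blast
    have "span C \<subseteq> V" using F_cone(5)[OF less.hyps] V by (rule span_minimal)
    then have q0V: "q0 \<in> V" using q0 by blast
    have tp: "t \<in> perp V C" using ts T_perp[OF less.hyps] by blast
    have "norm (y - q) \<le> 2 * c"
      using c(2)[OF z(1)] c(2)[OF z(3)] norm_triangle_ineq4[of \<tau> \<sigma>] by (simp add: z q_def)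
    \<comment> \<open>\<open>s\<close> and \<open>q0\<close> are the projections of \<open>y\<close>
      and \<open>q\<close> to \<open>span C\<close>, and projections do not increase
      distances.\<close>
    moreover have "norm (s - q0) \<le> norm (y - q)"
    proof -
      have "C \<subseteq> {w. t \<bullet> w = 0}" using tp by (auto simp: mem_perp)
      then have "span C \<subseteq> {w. t \<bullet> w = 0}" by (rule span_minimal) (rule subspace_hyperplane)
      moreover have d: "s - q0 \<in> span C" using ts q0 by (simp add: span_diff)
      ultimately have "orthogonal (s - q0) (t - u)"
        using q0(2)[OF d] by (auto simp: orthogonal_def inner_diff_right inner_commute[of "s - q0"])
      then have "(norm ((s - q0) + (t - u)))\<^sup>2 = (norm (s - q0))\<^sup>2 + (norm (t - u))\<^sup>2"
        by (rule norm_add_Pythagorean)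
      moreover have "y - q = (s - q0) + (t - u)" by (simp add: ts q0)
      ultimately have "(norm (s - q0))\<^sup>2 \<le> (norm (y - q))\<^sup>2" by simp
      then show ?thesis by (rule power2_le_imp_le) simp
    qed
    ultimately have sq: "norm (s - q0) \<le> 2 * c" by simp
    have q0pol: "q0 \<in> polar V C"
    proof -
      have "q0 \<bullet> m = q \<bullet> m" if "m \<in> C" for m
        using q0(2)[of m] span_base[OF that] by (simp add: q0(3) inner_add_left orthogonal_def)
      then show ?thesis using q0V z(4) unfolding mem_polar q_def by simp
    qed
    have "norm q0 \<le> B"
    proof (rule ccontr)
      assume "\<not> norm q0 \<le> B"
      then have nB: "norm q0 > B" by simp
      moreover have "B \<ge> 0" using r c \<delta> by (simp add: B_def)
      ultimately have n0: "norm q0 > 0" by linarith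
      let ?q1 = "(1 / norm q0) *\<^sub>R q0"
      have "?q1 \<in> ?S"
        using q0pol q0(1) n0 V by (auto simp: mem_polar span_scale subspace_scale mult_nonneg_nonpos divide_nonpos_nonneg)
      then obtain K where K: "K \<in> F" "K \<subset> C" "\<And>M. M \<in> ?G K \<Longrightarrow> - (?q1 \<bullet> g M) \<ge> \<delta>"
        using \<delta>(2)[of ?q1] by blast
      have "polar V C \<subseteq> polar V K" using K(2) unfolding subset_iff mem_polar by blast
      then have near: "y - 0 \<in> CDC V \<Lambda> T (polar V K)"
        using yCDC CDC_mono[of "polar V C" "polar V K"] by auto
      have bd: "norm w \<le> r" if "J \<in> below C" "\<not> K \<subset> J" "w \<in> R J" for J w
        using r(2)[of J w] that K(2) by blast
      have far: "(y - 0) \<bullet> m < - 3 * r * norm m"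
        if M: "M \<in> below C" "aff_dim M = 1" "\<not> M \<subseteq> K" "m \<in> M" "m \<noteq> 0" for M m
      proof -
        obtain \<rho> where \<rho>: "m = \<rho> *\<^sub>R g M" "\<rho> \<ge> 0" using g[of M] M by auto
        then have nm: "norm m = \<rho>" "\<rho> > 0" using g[of M] M by auto
        have "- ((1 / norm q0) * (q0 \<bullet> g M)) \<ge> \<delta>" using K(3)[of M] M by simp
        then have "q0 \<bullet> g M \<le> - \<delta> * norm q0" using n0 by (simp add: field_simps)
        moreover have "\<delta> * norm q0 > \<delta> * B" using nB \<delta>(1) by simp
        then have "\<delta> * norm q0 > 3 * r + 2 * c" using \<delta>(1) by (simp add: B_def)
        ultimately have 1: "q0 \<bullet> g M < - (3 * r + 2 * c)" by simp
        have "(s - q0) \<bullet> g M \<le> norm (s - q0) * norm (g M)" by (rule norm_cauchy_schwarz)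
        then have 2: "(s - q0) \<bullet> g M \<le> 2 * c" using sq g[of M] M by simp
        have "g M \<in> C" using gM[of M] M by auto
        then have 3: "t \<bullet> g M = 0" using tp by (simp add: mem_perp)
        have "y \<bullet> g M < - 3 * r" using 1 2 3 by (simp add: ts inner_add_left inner_diff_left)
        then have "\<rho> * (y \<bullet> g M) < \<rho> * (- 3 * r)" using nm(2) by (rule mult_strict_left_mono)
        then show ?thesis by (simp add: nm(1)) (simp add: \<rho>(1) mult.commute mult.left_commute)
      qed
      have "K \<in> below C" using K by auto
      \<comment> \<open>\<open>y\<close> would lie in an admissible translate of the region of a
        proper face, and all of these are removed from \<open>R C\<close>.\<close>
      then obtain J x where J: "J \<in> below C" "J \<subseteq> K" "x \<in> X (below C) (\<lambda>_. 0) J" "y - x \<in> R J"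
        by (rule sub.cover_near_face[OF _ near bd far])
      then have "J \<in> F" "J \<subset> C" using K(2) by auto
      then show False using J(3,4) y unfolding region_iff[OF less.hyps] by blast
    qed
    moreover have "norm s \<le> norm q0 + norm (s - q0)" using norm_triangle_ineq[of q0 "s - q0"] by simp
    ultimately show ?thesis using c1[OF ts(1)] sq norm_triangle_ineq[of t s] by (simp add: ts(3))
  qed
  then show ?case unfolding bounded_iff by blast
qed

lemma lebesgue_sliced_domain: "fundamental_domain L D \<Longrightarrow> lebesgue_sliced D"
  by (simp add: fundamental_domain_def lebesgue_sliced_def)

lemma lebesgue_sliced_CDC: "lebesgue_sliced (CDC V \<Lambda> T Q)"
  unfolding CDC_def perp_lattice_0
proof (rule lebesgue_sliced_UN)
  show "countable {x \<in> \<Lambda>. (+) x ` T \<Lambda> \<inter> Q \<noteq> {}}" using L_closed(5) by (rule countable_subset[rotated]) auto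
qed (intro lebesgue_sliced_translation lebesgue_sliced_domain[OF domain_L])

lemma lebesgue_sliced_DC: "lebesgue_sliced (DC V \<Lambda> T Q)"
proof -
  have "DC V \<Lambda> T Q = (\<Union>z\<in>\<Lambda> \<inter> Q. (+) z ` T \<Lambda>)" unfolding set_eq_iff mem_DC by blast
  moreover have "countable (\<Lambda> \<inter> Q)" using L_closed(5) by (rule countable_subset[rotated]) auto
  ultimately show ?thesis
    by (auto intro!: lebesgue_sliced_UN lebesgue_sliced_translation lebesgue_sliced_domain[OF domain_L])
qed

text \<open>By induction the removed translates are countably many measurable sets, and
  \<open>T(C) + span C\<close> is the preimage of \<open>T(C)\<close> under the projection along
  \<open>span C\<close>.\<close>

lemma lebesgue_sliced_region:
  assumes "C \<in> F" shows "lebesgue_sliced (R C)"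
  using assms
proof (induction C rule: region_induct)
  case (less C)
  obtain \<pi> :: "'a \<Rightarrow> 'a" where \<pi>: "linear \<pi>" "\<And>p. p - \<pi> p \<in> span C" "\<And>p w. w \<in> span C \<Longrightarrow> \<pi> p \<bullet> w = 0"
    using orthogonal_projection_exists[OF subspace_span] by metis
  let ?D = "T (perp_lattice V \<Lambda> C)"
  let ?U = "\<lambda>K. \<Union>x\<in>X (below C) (\<lambda>_. 0) K. (+) x ` R K"
  have proj: "(\<exists>t\<in>?D. \<exists>s\<in>span C. p = t + s) \<longleftrightarrow> p \<in> \<pi> -` ?D" for p
  proof
    assume "\<exists>t\<in>?D. \<exists>s\<in>span C. p = t + s"
    then obtain t s where ts: "t \<in> ?D" "s \<in> span C" "p = t + s" by blast
    have "C \<subseteq> {w. t \<bullet> w = 0}" using ts T_perp[OF less.hyps] by (auto simp: mem_perp)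
    then have "span C \<subseteq> {w. t \<bullet> w = 0}" by (rule span_minimal) (rule subspace_hyperplane)
    moreover have d: "t - \<pi> p \<in> span C" using span_diff[OF \<pi>(2)[of p] ts(2)] by (simp add: ts(3))
    ultimately have "(t - \<pi> p) \<bullet> (t - \<pi> p) = 0" using \<pi>(3)[OF d] by (auto simp: inner_diff_left)
    then show "p \<in> \<pi> -` ?D" using ts by simp
  next
    assume p: "p \<in> \<pi> -` ?D"
    show "\<exists>t\<in>?D. \<exists>s\<in>span C. p = t + s"
      by (rule bexI[of _ "\<pi> p"], rule bexI[of _ "p - \<pi> p"]) (use p \<pi>(2) in auto)
  qed
  have img: "p \<in> (+) x ` A \<longleftrightarrow> p - x \<in> A" for p x and A :: "'a set"
    by (auto simp: image_iff intro!: bexI[of _ "p - x"])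
  have "R C = (V - (\<Union>K\<in>{K\<in>F. K \<subset> C}. ?U K)) \<inter> \<pi> -` ?D \<inter> CDC V \<Lambda> T (polar V C)"
    unfolding set_eq_iff region_iff[OF less.hyps] proj Int_iff Diff_iff UN_iff img by blast
  moreover have "lebesgue_sliced ((V - (\<Union>K\<in>{K\<in>F. K \<subset> C}. ?U K)) \<inter> \<pi> -` ?D \<inter> CDC V \<Lambda> T (polar V C))"
  proof (intro lebesgue_sliced_Int lebesgue_sliced_Diff lebesgue_sliced_CDC)
    show "lebesgue_sliced V" using closed_subspace[OF V] by (intro lebesgue_sliced_borel) auto
    show "lebesgue_sliced (\<pi> -` ?D)"
      by (rule lebesgue_sliced_linear_vimage[OF \<pi>(1) lebesgue_sliced_domain[OF domain_perp]])
    show "lebesgue_sliced (\<Union>K\<in>{K\<in>F. K \<subset> C}. ?U K)"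
    proof (rule lebesgue_sliced_UN)
      show "countable {K\<in>F. K \<subset> C}" using finite_F by (intro countable_finite) auto
      fix K assume "K \<in> {K\<in>F. K \<subset> C}"
      then have K: "lebesgue_sliced (R K)" using less.IH by blast
      show "lebesgue_sliced (?U K)"
      proof (rule lebesgue_sliced_UN)
        show "countable (X (below C) (\<lambda>_. 0) K)"
          using L_closed(5) by (rule countable_subset[rotated]) (auto simp: anchored_translations_def)
      qed (rule lebesgue_sliced_translation[OF K])
    qed
  qed
  ultimately show ?case by simp
qed

end

section \<open>Counting lattice points by volumes\<close>

lemma mem_translation: "p \<in> (+) x ` A \<longleftrightarrow> p - x \<in> (A :: 'a::ab_group_add set)"
  by (auto simp: image_iff intro!: bexI[of _ "p - x"])

context anchored_fan
begin

abbreviation "Q \<equiv> anchored_polyhedron"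

lemma lattice_subspace_perp:
  assumes "K \<in> F" shows "lattice_subspace \<Lambda> (perp V K)"
  using is_lattice_perp_lattice[of K] span_perp_lattice[OF assms] subspace_perp[OF V]
  by (simp add: lattice_subspace_def perp_lattice_def)

lemma lattice_subspace_V: "lattice_subspace \<Lambda> V"
  using V L span_L L_V by (simp add: lattice_subspace_def Int_absorb2)

lemma rel_vol_perp:
  assumes "K \<in> F" "lebesgue_sliced A"
  shows "rel_vol \<Lambda> (perp V K) A = subspace_vol \<Lambda> (perp V K) A"
proof -
  have "perp V K = (+) 0 ` perp V K" by simp
  then show ?thesis
    using rel_vol_eq_subspace_vol[OF lattice_subspace_perp[OF assms(1)] L assms(2) L_closed(1)] by simp
qed

lemma rel_vol_V:
  assumes "lebesgue_sliced A"
  shows "rel_vol \<Lambda> V A = subspace_vol \<Lambda> V A"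
  using rel_vol_eq_subspace_vol[OF lattice_subspace_V L assms L_closed(1), of V] by simp

lemma sliced_polar: "lebesgue_sliced (polar V K)"
  using closed_polar by (intro lebesgue_sliced_borel) auto

lemma sliced_perp: "lebesgue_sliced (perp V K)"
  using closed_subspace[OF subspace_perp[OF V]] by (intro lebesgue_sliced_borel) auto

text \<open>
  The correction volumes \<open>w\<^sup>K\<^sub>J\<close>, extended by \<open>w\<^sup>K\<^sub>K = 1\<close>.
\<close>

definition weight :: "'a set \<Rightarrow> 'a set \<Rightarrow> real" where
  "weight K J = subspace_vol \<Lambda> (perp V J) (R K \<inter> perp V J \<inter> polar V K)"

lemma weight_self:
  assumes K: "K \<in> F" shows "weight K K = 1"
proof -
  have "R K \<inter> perp V K \<inter> polar V K = T (perp_lattice V \<Lambda> K)"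
  proof -
    have "perp V K \<subseteq> polar V K" by (auto simp: mem_perp mem_polar)
    then show ?thesis using region_Int_perp[OF K] by blast
  qed
  then show ?thesis
    using subspace_vol_fundamental_domain[OF lattice_subspace_perp[OF K]] domain_perp[of K]
    by (simp add: weight_def perp_lattice_def)
qed

lemma zero_region: "K \<in> F \<Longrightarrow> 0 \<in> R K"
  using region_Int_perp[of K] domain_perp[of K] by (auto simp: fundamental_domain_def)

lemma region_0: "{0} \<in> F \<Longrightarrow> R {0} = T \<Lambda>"
proof -
  assume z: "{0} \<in> F"
  have "perp V {0} = V" by (auto simp: mem_perp)
  then show ?thesis using region_Int_perp[OF z] region_V[OF z] by auto
qed

text \<open>The recursion for \<mu> solved for the DC-volume; \<open>weight K K = 1\<close> supplies
  the top term. At \<open>{0}\<close> both sides are 1, the volume of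
  \<open>T \<Lambda>\<close>.\<close>

lemma dc_volume_eq:
  assumes K: "K \<in> F"
  shows "dc_volume V \<Lambda> T K = (\<Sum>J\<in>below K. weight K J * mu_pointed V \<Lambda> T J)"
proof (cases "K = {0}")
  case True
  have "below K = {K}" using F_cone(4) True K by auto
  have "polar V {0} = V" by (auto simp: mem_polar)
  moreover have "DC V \<Lambda> T V \<inter> T \<Lambda> = T \<Lambda>"
  proof -
    have "T \<Lambda> \<subseteq> DC V \<Lambda> T V"
      using L_closed(1) subspace_0[OF V] unfolding subset_iff mem_DC by (metis add_0)
    then show ?thesis by blast
  qed
  ultimately have "dc_volume V \<Lambda> T K = subspace_vol \<Lambda> V (T \<Lambda>)"
    using True region_0 K rel_vol_V[OF lebesgue_sliced_domain[OF domain_L]]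
    by (simp add: dc_volume_def Int_commute)
  also have "\<dots> = 1"
    using subspace_vol_fundamental_domain[OF lattice_subspace_V] domain_L L_V by (simp add: Int_absorb2)
  also have "mu_pointed V \<Lambda> T K = 1"
    using True rational[OF K] pointed[OF K] by (subst mu_pointed.simps) simp
  then have "1 = (\<Sum>J\<in>below K. weight K J * mu_pointed V \<Lambda> T J)"
    unfolding \<open>below K = {K}\<close> using weight_self[OF K] by simp
  finally show ?thesis .
next
  case False
  have less: "{J. face_less J K} = below K - {K}"
    using faces[OF K] face_le_iff[OF _ K] by (auto simp: face_less_def)
  have corr: "correction_volume V \<Lambda> T K J = weight K J" if "J \<in> F" for J
    unfolding correction_volume_def weight_def using that K
    by (intro rel_vol_perp lebesgue_sliced_Int lebesgue_sliced_region sliced_perp sliced_polar)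
  have "mu_pointed V \<Lambda> T K = dc_volume V \<Lambda> T K - (\<Sum>J\<in>{J. face_less J K}. correction_volume V \<Lambda> T K J * mu_pointed V \<Lambda> T J)"
    using False rational[OF K] pointed[OF K] by (subst mu_pointed.simps) simp
  also have "(\<Sum>J\<in>{J. face_less J K}. correction_volume V \<Lambda> T K J * mu_pointed V \<Lambda> T J) =
      (\<Sum>J\<in>below K - {K}. weight K J * mu_pointed V \<Lambda> T J)"
    unfolding less by (intro sum.cong) (auto simp: corr)
  finally have "dc_volume V \<Lambda> T K = weight K K * mu_pointed V \<Lambda> T K + (\<Sum>J\<in>below K - {K}. weight K J * mu_pointed V \<Lambda> T J)"
    using weight_self[OF K] by simp
  also have "\<dots> = (\<Sum>J\<in>below K. weight K J * mu_pointed V \<Lambda> T J)"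
    using finite_F K by (intro sum.remove[symmetric]) auto
  finally show ?thesis .
qed

text \<open>\<open>R K\<close> contains 0, so \<open>x\<close> lies in its own tile, and 0 lies in
  the polar of \<open>K\<close>. A bounded polyhedron therefore has only finitely many
  tiles.\<close>

lemma translations_subset_polyhedron:
  assumes K: "K \<in> F" shows "X F a K \<subseteq> \<Lambda> \<inter> Q"
proof
  fix x assume x: "x \<in> X F a K"
  have "x - x \<in> R K" using zero_region[OF K] by simp
  from polyhedron_region_iff[OF K x this] have "x \<in> Q" using subspace_0[OF V] by (simp add: mem_polar)
  then show "x \<in> \<Lambda> \<inter> Q" using translationsD(1)[OF x] by simp
qed

lemma finite_translations: "bounded Q \<Longrightarrow> K \<in> F \<Longrightarrow> finite (X F a K)"
  by (rule finite_subset[OF translations_subset_polyhedron finite_lattice_Int_bounded[OF L]])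

lemma vol_DC:
  assumes Q: "bounded Q" shows "subspace_vol \<Lambda> V (DC V \<Lambda> T Q) = real (card (\<Lambda> \<inter> Q))"
proof -
  have fin: "finite (\<Lambda> \<inter> Q)" using finite_lattice_Int_bounded[OF L Q] .
  have "DC V \<Lambda> T Q = (\<Union>z\<in>\<Lambda> \<inter> Q. (+) z ` T \<Lambda>)" unfolding set_eq_iff mem_DC by blast
  also have "subspace_vol \<Lambda> V \<dots> = (\<Sum>z\<in>\<Lambda> \<inter> Q. subspace_vol \<Lambda> V ((+) z ` T \<Lambda>))"
  proof (rule subspace_vol_UN[OF lattice_subspace_V fin])
    show "disjoint_family_on (\<lambda>z. (+) z ` T \<Lambda>) (\<Lambda> \<inter> Q)"
      using domain_L unfolding fundamental_domain_def by (auto intro: disjoint_family_on_mono[of "\<Lambda> \<inter> Q" \<Lambda>])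
    show "bounded ((+) z ` T \<Lambda>)" for z
      using domain_L by (auto simp: fundamental_domain_def intro: bounded_translation)
  qed (intro lebesgue_sliced_translation lebesgue_sliced_domain[OF domain_L])
  also have "\<dots> = (\<Sum>z\<in>\<Lambda> \<inter> Q. 1)"
  proof (rule sum.cong[OF refl])
    fix z assume "z \<in> \<Lambda> \<inter> Q"
    then have "z \<in> V" using L_V by blast
    then have "subspace_vol \<Lambda> V ((+) z ` T \<Lambda>) = subspace_vol \<Lambda> V (T \<Lambda>)"
      by (intro subspace_vol_translation lattice_subspace_V lebesgue_sliced_domain[OF domain_L])
    also have "\<dots> = 1"
      using subspace_vol_fundamental_domain[OF lattice_subspace_V] domain_L L_V by (simp add: Int_absorb2)
    finally show "subspace_vol \<Lambda> V ((+) z ` T \<Lambda>) = 1" .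
  qed
  finally show ?thesis by simp
qed

text \<open>Pieces of different tiles are disjoint. The shift by \<open>-c\<close> carries the
  affine space through \<open>c\<close> to \<open>S\<close>; the cases used are
  \<open>S = V\<close>, \<open>c = 0\<close> for counting lattice points and
  \<open>S = perp V J\<close>, \<open>c = a J\<close> for the face of \<open>J\<close>.\<close>

lemma vol_translates_sum:
  assumes Q: "bounded Q" and G: "G \<subseteq> F" and S: "lattice_subspace \<Lambda> S"
    and A: "\<And>K. K \<in> G \<Longrightarrow> lebesgue_sliced (A K)" "\<And>K. K \<in> G \<Longrightarrow> A K \<subseteq> R K"
    and B: "B = (\<Union>K\<in>G. \<Union>x\<in>X F a K. (+) x ` A K)"
    and c: "\<And>K x. K \<in> G \<Longrightarrow> x \<in> X F a K \<Longrightarrow> x - c \<in> S"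
  shows "subspace_vol \<Lambda> S ((+) (- c) ` B) = (\<Sum>K\<in>G. real (card (X F a K)) * subspace_vol \<Lambda> S (A K))"
proof -
  let ?I = "Sigma G (X F a)" and ?f = "\<lambda>(K, x). (+) (x - c) ` A K"
  have fin: "finite G" "\<And>K. K \<in> G \<Longrightarrow> finite (X F a K)"
    using finite_translations[OF Q] G finite_F finite_subset by auto
  then have finI: "finite ?I" by (intro finite_SigmaI)
  have union: "(+) (- c) ` B = (\<Union>i\<in>?I. ?f i)"
    unfolding B by (auto simp: image_UN image_image algebra_simps)
  have "subspace_vol \<Lambda> S ((+) (- c) ` B) = (\<Sum>i\<in>?I. subspace_vol \<Lambda> S (?f i))"
    unfolding union
  proof (rule subspace_vol_UN[OF S finI])
    show "lebesgue_sliced (?f i)" if "i \<in> ?I" for i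
      using that A(1) by (auto intro: lebesgue_sliced_translation)
    show "bounded (?f i)" if "i \<in> ?I" for i
    proof -
      obtain K x where i: "i = (K, x)" "K \<in> G" using \<open>i \<in> ?I\<close> by blast
      have "bounded (A K)" using bounded_region[of K] A(2)[OF i(2)] i(2) G bounded_subset by blast
      then show ?thesis using i by (simp add: bounded_translation)
    qed
    show "disjoint_family_on ?f ?I"
      unfolding disjoint_family_on_def
    proof (intro ballI impI, rule ccontr)
      fix i j assume ij: "i \<in> ?I" "j \<in> ?I" "i \<noteq> j" "?f i \<inter> ?f j \<noteq> {}"
      obtain K x J y where e: "i = (K, x)" "j = (J, y)" by (cases i, cases j) auto
      have m: "K \<in> G" "x \<in> X F a K" "J \<in> G" "y \<in> X F a J" using ij(1,2) e by auto
      obtain p where p: "p \<in> ?f i" "p \<in> ?f j" using ij(4) by blast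
      have "p - (x - c) \<in> A K" "p - (y - c) \<in> A J"
        using p unfolding e prod.case mem_translation by auto
      then have "(p + c) - x \<in> R K" "(p + c) - y \<in> R J"
        using A(2)[OF m(1)] A(2)[OF m(3)] by (auto simp: algebra_simps)
      then have "K = J \<and> x = y" using translates_disjoint m G by (meson subsetD)
      then show False using ij(3) e by simp
    qed
  qed
  also have "\<dots> = (\<Sum>(K, x)\<in>?I. subspace_vol \<Lambda> S (?f (K, x)))"
    by (rule sum.cong) auto
  also have "\<dots> = (\<Sum>K\<in>G. \<Sum>x\<in>X F a K. subspace_vol \<Lambda> S (?f (K, x)))"
    by (rule sum.Sigma[symmetric]) (use fin in auto)
  also have "\<dots> = (\<Sum>K\<in>G. \<Sum>x\<in>X F a K. subspace_vol \<Lambda> S (A K))"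
    using A(1) c by (intro sum.cong refl) (auto intro!: subspace_vol_translation[OF S])
  also have "\<dots> = (\<Sum>K\<in>G. real (card (X F a K)) * subspace_vol \<Lambda> S (A K))" by simp
  finally show ?thesis .
qed

text \<open>For the normal fan this is the dilate of the face whose normal cone is
  \<open>J\<close>.\<close>

definition anchored_face :: "'a set \<Rightarrow> 'a set" where
  "anchored_face J = {y \<in> Q. y - a J \<in> perp V J}"

theorem card_lattice_points_eq:
  assumes Q: "bounded Q"
    and cov: "\<And>p. p \<in> CDC V \<Lambda> T Q \<Longrightarrow> \<exists>K\<in>F. \<exists>x\<in>X F a K. p - x \<in> R K"
  shows "real (card (\<Lambda> \<inter> Q)) =
    (\<Sum>J\<in>F. mu_pointed V \<Lambda> T J * subspace_vol \<Lambda> (perp V J) ((+) (- a J) ` anchored_face J))"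
proof -
  let ?c = "\<lambda>K. real (card (X F a K))" and ?\<mu> = "mu_pointed V \<Lambda> T"
  have QV: "Q \<subseteq> V" by (auto simp: anchored_polyhedron_def)
  have face: "subspace_vol \<Lambda> (perp V J) ((+) (- a J) ` anchored_face J) =
      (\<Sum>K\<in>{K \<in> F. J \<subseteq> K}. ?c K * weight K J)" if J: "J \<in> F" for J
    unfolding weight_def
  proof (rule vol_translates_sum[OF Q _ lattice_subspace_perp[OF J]])
    fix K assume K: "K \<in> {K \<in> F. J \<subseteq> K}"
    show "lebesgue_sliced (R K \<inter> perp V J \<inter> polar V K)"
      using K by (intro lebesgue_sliced_Int lebesgue_sliced_region sliced_perp sliced_polar) auto
    show "x - a J \<in> perp V J" if "x \<in> X F a K" for x
      using anchor_coset_mono[OF J _ _ translationsD(2)[OF that]] K by blast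
  next
    show "anchored_face J = (\<Union>K\<in>{K \<in> F. J \<subseteq> K}. \<Union>x\<in>X F a K. (+) x ` (R K \<inter> perp V J \<inter> polar V K))"
    proof (intro set_eqI iffI)
      fix p assume p: "p \<in> anchored_face J"
      then have pQ: "p \<in> Q" and pJ: "p - a J \<in> perp V J" by (auto simp: anchored_face_def)
      obtain K x where K: "K \<in> F" and x: "x \<in> X F a K" "p - x \<in> R K"
        using cov[of p] pQ subset_CDC[OF QV] by blast
      have "J \<subseteq> K"
      proof (rule ccontr)
        \<comment> \<open>On the face of \<open>J\<close> the inequality of each ray of
          \<open>J\<close> is an equality, but by (I) it is strict on the tiles of cones that miss
          this ray.\<close>
        assume nJK: "\<not> J \<subseteq> K"
        obtain M where M: "M \<in> F" "aff_dim M = 1" "M \<subseteq> J" "\<not> M \<subseteq> K"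
          using ray_not_subset[OF J K nJK] by blast
        obtain m where m: "m \<in> M" "m \<noteq> 0" using ray_nonzero[OF M(1,2)] by blast
        have "(x + (p - x) - a M) \<bullet> m < 0" by (rule translationsD(3)[OF x(1) M(1,2,4) x(2) m])
        moreover have "(p - a M) \<bullet> m = (p - p) \<bullet> m" by (rule anchor_inner[OF J M(1,3) pJ m(1)])
        ultimately show False by simp
      qed
      moreover have "p - x \<in> perp V J"
        using perp_diff[OF pJ anchor_coset_mono[OF J K \<open>J \<subseteq> K\<close> translationsD(2)[OF x(1)]]] by simp
      moreover have "p - x \<in> polar V K" using polyhedron_region_iff[OF K x] pQ by blast
      ultimately show "p \<in> (\<Union>K\<in>{K \<in> F. J \<subseteq> K}. \<Union>x\<in>X F a K. (+) x ` (R K \<inter> perp V J \<inter> polar V K))"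
        using K x unfolding UN_iff mem_translation by blast
    next
      fix p assume "p \<in> (\<Union>K\<in>{K \<in> F. J \<subseteq> K}. \<Union>x\<in>X F a K. (+) x ` (R K \<inter> perp V J \<inter> polar V K))"
      then obtain K x where K: "K \<in> F" "J \<subseteq> K" and x: "x \<in> X F a K" "p - x \<in> R K" "p - x \<in> perp V J" "p - x \<in> polar V K"
        unfolding UN_iff mem_translation by blast
      have "p \<in> Q" using polyhedron_region_iff[OF K(1) x(1,2)] x(4) by blast
      moreover have "p - a J \<in> perp V J"
        using perp_add[OF x(3) anchor_coset_mono[OF J K translationsD(2)[OF x(1)]]] by simp
      ultimately show "p \<in> anchored_face J" by (simp add: anchored_face_def)
    qed
  qed auto
  have "real (card (\<Lambda> \<inter> Q)) = subspace_vol \<Lambda> V ((+) (- 0) ` DC V \<Lambda> T Q)" using vol_DC[OF Q] by simp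
  also have "\<dots> = (\<Sum>K\<in>F. ?c K * subspace_vol \<Lambda> V (R K \<inter> DC V \<Lambda> T (polar V K)))"
  proof (rule vol_translates_sum[OF Q subset_refl lattice_subspace_V])
    fix K assume K: "K \<in> F"
    show "lebesgue_sliced (R K \<inter> DC V \<Lambda> T (polar V K))"
      using K by (intro lebesgue_sliced_Int lebesgue_sliced_region lebesgue_sliced_DC)
    show "x - 0 \<in> V" if "x \<in> X F a K" for x using translationsD(1)[OF that] L_V by auto
  next
    show "DC V \<Lambda> T Q = (\<Union>K\<in>F. \<Union>x\<in>X F a K. (+) x ` (R K \<inter> DC V \<Lambda> T (polar V K)))"
    proof (intro set_eqI iffI)
      fix p assume p: "p \<in> DC V \<Lambda> T Q"
      then obtain K x where K: "K \<in> F" and x: "x \<in> X F a K" "p - x \<in> R K"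
        using cov[of p] DC_subset_CDC by blast
      then show "p \<in> (\<Union>K\<in>F. \<Union>x\<in>X F a K. (+) x ` (R K \<inter> DC V \<Lambda> T (polar V K)))"
        using DC_region_iff[OF K x] p unfolding UN_iff mem_translation by blast
    next
      fix p assume "p \<in> (\<Union>K\<in>F. \<Union>x\<in>X F a K. (+) x ` (R K \<inter> DC V \<Lambda> T (polar V K)))"
      then obtain K x where K: "K \<in> F" and x: "x \<in> X F a K" "p - x \<in> R K" "p - x \<in> DC V \<Lambda> T (polar V K)"
        unfolding UN_iff mem_translation by blast
      then show "p \<in> DC V \<Lambda> T Q" using DC_region_iff[OF K x(1,2)] by blast
    qed
  qed auto
  also have "\<dots> = (\<Sum>K\<in>F. ?c K * dc_volume V \<Lambda> T K)"
  proof (rule sum.cong[OF refl])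
    fix K assume "K \<in> F"
    then have "lebesgue_sliced (R K \<inter> DC V \<Lambda> T (polar V K))"
      by (intro lebesgue_sliced_Int lebesgue_sliced_region lebesgue_sliced_DC)
    then show "?c K * subspace_vol \<Lambda> V (R K \<inter> DC V \<Lambda> T (polar V K)) = ?c K * dc_volume V \<Lambda> T K"
      by (simp add: dc_volume_def rel_vol_V)
  qed
  also have "\<dots> = (\<Sum>K\<in>F. \<Sum>J\<in>below K. ?\<mu> J * (?c K * weight K J))"
    by (intro sum.cong refl) (simp add: dc_volume_eq sum_distrib_left mult_ac)
  \<comment> \<open>Collected by \<open>J\<close> instead of \<open>K\<close>, the inner sums are
    the volumes of the faces.\<close>
  also have "\<dots> = (\<Sum>J\<in>F. \<Sum>K\<in>{K \<in> F. J \<subseteq> K}. ?\<mu> J * (?c K * weight K J))"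
    by (rule sum.swap_restrict[OF finite_F finite_F])
  also have "\<dots> = (\<Sum>J\<in>F. ?\<mu> J * subspace_vol \<Lambda> (perp V J) ((+) (- a J) ` anchored_face J))"
    by (intro sum.cong refl) (simp only: face sum_distrib_left)
  finally show ?thesis .
qed

end

section \<open>Normal fans of lattice polytopes\<close>

text \<open>The polytope is full-dimensional in the linear subspace \<open>V\<close>, which makes
  its normal cones pointed. The last assumption is the outcome of the rank condition, in a form that
  is inherited by sublattices.\<close>

locale normal_fan = lattice_tiling V \<Lambda> T
  for V \<Lambda> :: "'a::euclidean_space set" and T +
  fixes S :: "'a set"
  assumes finite_S: "finite S" and S_ne: "S \<noteq> {}" and S_L: "S \<subseteq> \<Lambda>"
    and affine_hull_S: "affine hull S = V"
    and rational_inner: "\<And>w. w \<in> \<Lambda> \<Longrightarrow> \<exists>k>0. \<forall>z\<in>\<Lambda>. z \<bullet> w / k \<in> \<rat>"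
begin

definition P :: "'a set" where "P = convex hull S"

definition maximizers :: "'a \<Rightarrow> 'a set" where
  "maximizers x = {s \<in> P. \<forall>y\<in>P. x \<bullet> y \<le> x \<bullet> s}"

text \<open>Normal cones without reference to relative interiors; \<open>normal_cone_Int\<close>
  connects them with \<open>normal_cone\<close>.\<close>

definition normals :: "'a set \<Rightarrow> 'a set" where
  "normals f = {x \<in> V. f \<subseteq> maximizers x}"

definition fan :: "'a set set" where
  "fan = normals ` {f. face_le f P}"

lemma P_props: "polytope P" "convex P" "compact P" "polyhedron P" "P \<subseteq> V" "affine hull P = V" "S \<subseteq> P" "P \<noteq> {}"
proof -
  show p: "polytope P" unfolding P_def polytope_def using finite_S by blast
  show "convex P" "compact P" "polyhedron P"
    using polytope_imp_convex[OF p] polytope_imp_compact[OF p] polytope_imp_polyhedron[OF p] .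
  show "affine hull P = V" unfolding P_def using affine_hull_S by simp
  then show "P \<subseteq> V" using hull_subset[of P affine] by simp
  show "S \<subseteq> P" unfolding P_def by (rule hull_subset)
  then show "P \<noteq> {}" using S_ne by blast
qed

lemma finite_faces: "finite {f. face_le f P}"
  using finite_polytope_faces[OF P_props(1)] by (rule finite_subset[rotated]) (auto simp: face_le_def)

lemma finite_fan: "finite fan"
  unfolding fan_def using finite_faces by simp

lemma faceD:
  assumes "face_le f P"
  shows "f face_of P" "f \<noteq> {}" "f \<subseteq> P" "convex f"
  using assms face_of_imp_subset face_of_imp_convex by (auto simp: face_le_def)

lemma inner_le_S:
  assumes "\<And>v. v \<in> S \<Longrightarrow> x \<bullet> v \<le> c" "y \<in> P"
  shows "x \<bullet> y \<le> c"
proof -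
  have "S \<subseteq> {y. x \<bullet> y \<le> c}" using assms(1) by blast
  then have "P \<subseteq> {y. x \<bullet> y \<le> c}" unfolding P_def by (rule hull_minimal) (rule convex_halfspace_le)
  then show ?thesis using assms(2) by blast
qed

lemma maximizers_face: "face_le (maximizers x) P"
proof -
  have "continuous_on P (\<lambda>y. x \<bullet> y)" by (intro continuous_intros)
  then obtain s where s: "s \<in> P" "\<And>y. y \<in> P \<Longrightarrow> x \<bullet> y \<le> x \<bullet> s"
    using continuous_attains_sup[OF P_props(3,8)] by blast
  have "maximizers x = P \<inter> {y. x \<bullet> y = x \<bullet> s}"
    unfolding maximizers_def using s by (auto intro: order_antisym)
  moreover have "P \<inter> {y. x \<bullet> y = x \<bullet> s} face_of P"
    using s P_props(2) by (intro face_of_Int_supporting_hyperplane_le)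
  ultimately show ?thesis using s by (auto simp: face_le_def)
qed

text \<open>Faces of polyhedra are exposed. The exposing functional is replaced by its projection to
  \<open>V\<close>, which has the same values on \<open>P\<close>.\<close>

lemma face_exposed:
  assumes f: "face_le f P"
  obtains x where "x \<in> V" "maximizers x = f"
proof -
  have "f exposed_face_of P" using exposed_face_of_polyhedron[OF P_props(4)] faceD(1)[OF f] by blast
  then obtain a b where ab: "P \<subseteq> {x. a \<bullet> x \<le> b}" "f = P \<inter> {x. a \<bullet> x = b}"
    unfolding exposed_face_of_def by blast
  obtain x u where xu: "x \<in> span V" "\<And>w. w \<in> span V \<Longrightarrow> orthogonal u w" "a = x + u"
    using orthogonal_subspace_decomp_exists by blast
  have eq: "a \<bullet> y = x \<bullet> y" if "y \<in> P" for y
    using xu(2)[of y] that P_props(5) span_base[of y V] by (auto simp: xu(3) inner_add_left orthogonal_def)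
  obtain s where s: "s \<in> f" using faceD(2)[OF f] by blast
  have "maximizers x = f"
  proof (intro set_eqI iffI)
    fix y assume "y \<in> maximizers x"
    then have "y \<in> P" "a \<bullet> s \<le> a \<bullet> y" using s ab(2) eq by (auto simp: maximizers_def)
    then show "y \<in> f" using s ab by (auto intro!: order_antisym)
  next
    fix y assume "y \<in> f"
    then show "y \<in> maximizers x" using ab eq by (auto simp: maximizers_def)
  qed
  moreover have "x \<in> V" using xu(1) V by (metis span_eq_iff)
  ultimately show ?thesis using that by blast
qed

text \<open>A vector exposing \<open>g\<close> lies in \<open>normals g\<close>; once it lies in
  \<open>normals f\<close> too, its maximizers contain \<open>f\<close>.\<close>

lemma normals_antimono_iff:
  assumes "face_le f P" "face_le g P"
  shows "normals g \<subseteq> normals f \<longleftrightarrow> f \<subseteq> g"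
proof
  obtain x where x: "x \<in> V" "maximizers x = g" using face_exposed[OF assms(2)] by blast
  assume "normals g \<subseteq> normals f"
  then have "x \<in> normals f" using x by (auto simp: normals_def)
  then show "f \<subseteq> g" using x by (simp add: normals_def)
qed (auto simp: normals_def)

lemma inj_normals: "inj_on normals {f. face_le f P}"
proof (rule inj_onI)
  fix f g assume fg: "f \<in> {f. face_le f P}" "g \<in> {f. face_le f P}" "normals f = normals g"
  then have f: "face_le f P" and g: "face_le g P" by auto
  show "f = g" using normals_antimono_iff[OF f g] normals_antimono_iff[OF g f] fg(3) by simp
qed

lemma face_hull:
  assumes "face_le f P" shows "f = convex hull (S \<inter> f)"
proof
  obtain S' where S': "S' \<subseteq> S" "f = convex hull S'"
    by (rule face_of_convex_hull_subset[OF finite_imp_compact[OF finite_S] faceD(1)[OF assms, unfolded P_def]])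
  have "S' \<subseteq> f" unfolding S'(2) by (rule hull_subset)
  then have "S' \<subseteq> S \<inter> f" using S'(1) by blast
  then show "f \<subseteq> convex hull (S \<inter> f)" by (subst S'(2)) (rule hull_mono)
  show "convex hull (S \<inter> f) \<subseteq> f" using faceD(4)[OF assms] by (intro hull_minimal) auto
qed

lemma face_vertex:
  assumes "face_le f P" shows "S \<inter> f \<noteq> {}"
  using face_hull[OF assms] faceD(2)[OF assms] by auto

lemma mem_normals:
  "x \<in> normals f \<longleftrightarrow> x \<in> V \<and> f \<subseteq> P \<and> (\<forall>s\<in>f. \<forall>y\<in>P. x \<bullet> y \<le> x \<bullet> s)"
  by (auto simp: normals_def maximizers_def)

lemma normals_const: "m \<in> normals f \<Longrightarrow> u \<in> f \<Longrightarrow> u' \<in> f \<Longrightarrow> m \<bullet> u = m \<bullet> u'"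
  unfolding mem_normals by (meson order_antisym subsetD)

text \<open>By convexity it is enough to compare values at points of \<open>S\<close>. The resulting
  normals \<open>v - u\<close> are lattice vectors, as rationality of the cone requires.\<close>

lemma normals_eq_halfspaces:
  assumes f: "face_le f P"
  shows "normals f = {x \<in> span \<Lambda>. \<forall>w\<in>(\<lambda>(v, u). v - u) ` (S \<times> (S \<inter> f)). x \<bullet> w \<le> 0}"
proof (intro set_eqI iffI)
  fix x assume "x \<in> normals f"
  then show "x \<in> {x \<in> span \<Lambda>. \<forall>w\<in>(\<lambda>(v, u). v - u) ` (S \<times> (S \<inter> f)). x \<bullet> w \<le> 0}"
    using P_props(7) span_L by (auto simp: mem_normals inner_diff_right)
next
  fix x assume x: "x \<in> {x \<in> span \<Lambda>. \<forall>w\<in>(\<lambda>(v, u). v - u) ` (S \<times> (S \<inter> f)). x \<bullet> w \<le> 0}"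
  have "S \<inter> f \<subseteq> maximizers x"
  proof
    fix u assume u: "u \<in> S \<inter> f"
    have "x \<bullet> v \<le> x \<bullet> u" if "v \<in> S" for v using x u that by (force simp: inner_diff_right)
    then show "u \<in> maximizers x" using inner_le_S[of x "x \<bullet> u"] u P_props(7) by (auto simp: maximizers_def)
  qed
  then have "convex hull (S \<inter> f) \<subseteq> maximizers x"
    using faceD(4)[OF maximizers_face] by (rule hull_minimal)
  then show "x \<in> normals f" using face_hull[OF f] x span_L by (auto simp: normals_def)
qed

lemma rational_normals:
  assumes f: "face_le f P" shows "rational_cone \<Lambda> (normals f)"
proof (rule rational_coneI[OF L _ normals_eq_halfspaces[OF f]])
  show "finite ((\<lambda>(v, u). v - u) ` (S \<times> (S \<inter> f)))" using finite_S by simp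
  show "\<exists>k>0. \<forall>z\<in>\<Lambda>. z \<bullet> w / k \<in> \<rat>" if "w \<in> (\<lambda>(v, u). v - u) ` (S \<times> (S \<inter> f))" for w
    using that S_L L_closed(2) by (intro rational_inner) auto
qed

lemmas normals_cone = rational_cone_basic[OF rational_normals]

text \<open>If \<open>x\<close> and \<open>-x\<close> are normal, \<open>x\<close> is constant on
  \<open>P\<close> and hence on the affine hull \<open>V\<close>, which contains both 0 and
  \<open>x\<close>.\<close>

lemma pointed_normals:
  assumes f: "face_le f P" shows "pointed (normals f)"
  unfolding pointed_def
proof (intro allI impI)
  fix U assume U: "subspace U \<and> U \<subseteq> normals f"
  have "x = 0" if x: "x \<in> U" for x
  proof -
    obtain s where s: "s \<in> f" using faceD(2)[OF f] by blast
    have "- x \<in> U" using U x subspace_neg by blast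
    then have xn: "x \<in> normals f" "- x \<in> normals f" using U x by auto
    have "x \<bullet> y = x \<bullet> s" if "y \<in> P" for y
      using xn s that unfolding mem_normals by (force intro: order_antisym)
    then have "P \<subseteq> {y. x \<bullet> y = x \<bullet> s}" by blast
    then have "V \<subseteq> {y. x \<bullet> y = x \<bullet> s}"
      unfolding P_props(6)[symmetric] by (rule hull_minimal) (rule affine_hyperplane)
    moreover have "x \<in> V" "0 \<in> V" using xn V by (auto simp: mem_normals subspace_0)
    ultimately have "x \<bullet> x = x \<bullet> s" "x \<bullet> 0 = x \<bullet> s" by blast+
    then show "x = 0" by simp
  qed
  then show "U = {0}" using U subspace_0 by blast
qed

text \<open>\<open>y\<close> is constant on the face maximizing \<open>x\<close>, and the finitely
  many points of \<open>S\<close> off this face lie below the maximum by a positive gap that a small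
  perturbation preserves.\<close>

lemma maximizers_perturb:
  assumes "\<And>u u'. u \<in> maximizers x \<Longrightarrow> u' \<in> maximizers x \<Longrightarrow> y \<bullet> u = y \<bullet> u'"
  obtains \<epsilon> where "\<epsilon> > 0" "maximizers x \<subseteq> maximizers (x + \<epsilon> *\<^sub>R y)"
proof -
  obtain s where s: "s \<in> maximizers x" using faceD(2)[OF maximizers_face] by blast
  have "\<forall>\<^sub>F \<epsilon> in at_right 0. (x + \<epsilon> *\<^sub>R y) \<bullet> v \<le> (x + \<epsilon> *\<^sub>R y) \<bullet> s" if v: "v \<in> S" for v
  proof (cases "v \<in> maximizers x")
    case True
    then have "x \<bullet> v = x \<bullet> s" "y \<bullet> v = y \<bullet> s"
      using s assms[OF True s] by (auto simp: maximizers_def intro: order_antisym)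
    then show ?thesis by (simp add: inner_add_left)
  next
    case False
    have vP: "v \<in> P" using v P_props(7) by blast
    obtain y' where "y' \<in> P" "x \<bullet> y' > x \<bullet> v" using False vP by (auto simp: maximizers_def not_le)
    then have "x \<bullet> v < x \<bullet> s" using s by (force simp: maximizers_def)
    moreover have "((\<lambda>\<epsilon>. (x + \<epsilon> *\<^sub>R y) \<bullet> v - (x + \<epsilon> *\<^sub>R y) \<bullet> s) \<longlongrightarrow> (x + 0 *\<^sub>R y) \<bullet> v - (x + 0 *\<^sub>R y) \<bullet> s) (at_right 0)"
      by (intro tendsto_intros)
    ultimately have "\<forall>\<^sub>F \<epsilon> in at_right 0. (x + \<epsilon> *\<^sub>R y) \<bullet> v - (x + \<epsilon> *\<^sub>R y) \<bullet> s < 0"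
      by (intro order_tendstoD(2)) auto
    then show ?thesis by (rule eventually_mono) simp
  qed
  then have "\<forall>\<^sub>F \<epsilon> in at_right 0. \<forall>v\<in>S. (x + \<epsilon> *\<^sub>R y) \<bullet> v \<le> (x + \<epsilon> *\<^sub>R y) \<bullet> s"
    using finite_S by (simp add: eventually_ball_finite_distrib)
  moreover have "\<forall>\<^sub>F \<epsilon> in at_right (0::real). \<epsilon> > 0" by (simp add: eventually_at_right_less)
  ultimately have "\<forall>\<^sub>F \<epsilon> in at_right 0. \<epsilon> > 0 \<and> (\<forall>v\<in>S. (x + \<epsilon> *\<^sub>R y) \<bullet> v \<le> (x + \<epsilon> *\<^sub>R y) \<bullet> s)"
    by eventually_elim simp
  from eventually_happens[OF this] obtain \<epsilon> :: real
    where \<epsilon>: "\<epsilon> > 0" "\<And>v. v \<in> S \<Longrightarrow> (x + \<epsilon> *\<^sub>R y) \<bullet> v \<le> (x + \<epsilon> *\<^sub>R y) \<bullet> s"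
    using trivial_limit_at_right_real[of 0] by auto
  have "u \<in> maximizers (x + \<epsilon> *\<^sub>R y)" if u: "u \<in> maximizers x" for u
  proof -
    have "x \<bullet> u = x \<bullet> s" "y \<bullet> u = y \<bullet> s"
      using s u assms[OF u s] by (auto simp: maximizers_def intro: order_antisym)
    then have "(x + \<epsilon> *\<^sub>R y) \<bullet> u = (x + \<epsilon> *\<^sub>R y) \<bullet> s" by (simp add: inner_add_left)
    then show ?thesis using inner_le_S[OF \<epsilon>(2)] u by (auto simp: maximizers_def)
  qed
  then show ?thesis using that \<epsilon>(1) by blast
qed

lemma normals_face:
  assumes f: "face_le f P" and g: "face_le g P" and fg: "f \<subseteq> g"
  shows "normals g face_of normals f"
proof (rule face_of_coneI[OF normals_cone(3)[OF f]])
  show "normals g \<subseteq> normals f" using normals_antimono_iff[OF f g] fg by blast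
  show "convex (normals g)" "conic (normals g)" using normals_cone(2,3)[OF g] by auto
  have mem: "x \<in> normals g" if xy: "x \<in> normals f" "y \<in> normals f" "x + y \<in> normals g" for x y
    unfolding mem_normals
  proof (intro conjI ballI)
    show "x \<in> V" using xy by (simp add: mem_normals)
    show "g \<subseteq> P" by (rule faceD(3)[OF g])
    fix u z assume u: "u \<in> g" and z: "z \<in> P"
    obtain s where s: "s \<in> f" using faceD(2)[OF f] by blast
    then have "s \<in> P" "u \<in> P" using f g u faceD(3) by auto
    then have "(x + y) \<bullet> s \<le> (x + y) \<bullet> u" "y \<bullet> u \<le> y \<bullet> s" "x \<bullet> z \<le> x \<bullet> s"
      using xy s u z unfolding mem_normals by blast+
    then show "x \<bullet> z \<le> x \<bullet> u" by (simp add: inner_add_left)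
  qed
  show "x \<in> normals g \<and> y \<in> normals g" if "x \<in> normals f" "y \<in> normals f" "x + y \<in> normals g" for x y
    using mem[OF that] mem[of y x] that by (simp add: add.commute)
qed

text \<open>For \<open>x\<close> in the relative interior of \<open>J\<close> and
  \<open>g = maximizers x\<close> one has \<open>J = normals g\<close>. A face containing a relative
  interior point of \<open>J\<close> contains \<open>J\<close>. Conversely, if \<open>y\<close> is
  in \<open>normals g\<close>, then \<open>x - \<epsilon> y\<close> stays in
  \<open>normals f\<close> for some \<open>\<epsilon> > 0\<close>, and as \<open>x\<close> is the
  sum of it and \<open>\<epsilon> y\<close>, the face \<open>J\<close> contains
  \<open>\<epsilon> y\<close>.\<close>

lemma face_of_normals:
  assumes f: "face_le f P" and J: "face_le J (normals f)"
  shows "J \<in> fan"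
proof -
  have J': "J face_of normals f" "J \<noteq> {}" using J by (auto simp: face_le_def)
  have "convex J" using J'(1) by (rule face_of_imp_convex)
  then obtain x where x: "x \<in> rel_interior J" using J'(2) rel_interior_eq_empty by blast
  then have xJ: "x \<in> J" using rel_interior_subset by blast
  then have xf: "x \<in> normals f" using face_of_imp_subset[OF J'(1)] by blast
  let ?g = "maximizers x"
  note g = maximizers_face[of x]
  have fg: "f \<subseteq> ?g" using xf by (simp add: normals_def)
  have xg: "x \<in> normals ?g" using xf by (simp add: normals_def)
  have gf: "normals ?g \<subseteq> normals f" using normals_antimono_iff[OF f g] fg by blast
  have "J \<subseteq> normals ?g"
    using subset_of_face_of[OF normals_face[OF f g fg] face_of_imp_subset[OF J'(1)]] x xg by blast
  moreover have "normals ?g \<subseteq> J"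
  proof
    fix y assume y: "y \<in> normals ?g"
    have "(- y) \<bullet> u = (- y) \<bullet> u'" if "u \<in> ?g" "u' \<in> ?g" for u u'
      using normals_const[OF y that] by simp
    then obtain \<epsilon> where \<epsilon>: "\<epsilon> > 0" "?g \<subseteq> maximizers (x + \<epsilon> *\<^sub>R (- y))"
      using maximizers_perturb[of x "- y"] by blast
    have "x + \<epsilon> *\<^sub>R (- y) \<in> V" using xf y V by (simp add: mem_normals subspace_diff subspace_scale)
    then have "x - \<epsilon> *\<^sub>R y \<in> normals f" using \<epsilon>(2) gf by (auto simp: normals_def)
    moreover have "\<epsilon> *\<^sub>R y \<in> normals f" using y gf \<epsilon>(1) conicD[OF normals_cone(3)[OF f]] by auto
    ultimately have "\<epsilon> *\<^sub>R y \<in> J"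
      using face_of_cone(3)[OF normals_cone(2,3)[OF f] J', of "\<epsilon> *\<^sub>R y" "x - \<epsilon> *\<^sub>R y"] xJ by simp
    from conicD[OF face_of_cone(2)[OF normals_cone(2,3)[OF f] J'] this, where c = "1 / \<epsilon>"]
    show "y \<in> J" using \<epsilon>(1) by simp
  qed
  ultimately have "J = normals ?g" by blast
  then show ?thesis unfolding fan_def using g by blast
qed

section \<open>Directions of faces and the axioms of a fan\<close>

definition direction :: "'a set \<Rightarrow> 'a \<Rightarrow> 'a set" where
  "direction f s = span ((\<lambda>x. - s + x) ` (S \<inter> f - {s}))"

lemma affine_hull_face:
  assumes f: "face_le f P" and s: "s \<in> S \<inter> f"
  shows "affine hull f = (+) s ` direction f s"
proof -
  have "affine hull f = affine hull (S \<inter> f)" using face_hull[OF f] affine_hull_convex_hull by metis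
  then show ?thesis using affine_hull_span2[OF s] by (simp add: direction_def)
qed

text \<open>For the harder inclusion, let \<open>z'\<close> be the component of \<open>z\<close>
  orthogonal to the direction of \<open>f\<close>, and let \<open>x\<close> expose \<open>f\<close>.
  As \<open>z'\<close> is constant on \<open>f\<close>, some \<open>x + \<epsilon> z'\<close> is
  normal to \<open>f\<close> as well; but \<open>z'\<close> is orthogonal to all normals, so it is
  0.\<close>

lemma perp_normals:
  assumes f: "face_le f P" and s: "s \<in> S \<inter> f"
  shows "perp V (normals f) = direction f s"
proof
  let ?D = "direction f s"
  have SV: "S \<subseteq> V" using S_L L_V by blast
  have DV: "?D \<subseteq> V"
  proof -
    have "u - s \<in> V" if "u \<in> S" for u using that s SV subspace_diff[OF V] by blast
    then show ?thesis unfolding direction_def using V by (intro span_minimal) auto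
  qed
  show "?D \<subseteq> perp V (normals f)"
    unfolding direction_def
  proof (rule span_minimal[OF _ subspace_perp[OF V]])
    show "(\<lambda>x. - s + x) ` (S \<inter> f - {s}) \<subseteq> perp V (normals f)"
    proof (rule image_subsetI)
      fix u assume u: "u \<in> S \<inter> f - {s}"
      have "u \<bullet> m = s \<bullet> m" if "m \<in> normals f" for m
        using normals_const[OF that, of u s] u s by (simp add: inner_commute)
      moreover have "u - s \<in> V" using u s SV subspace_diff[OF V] by blast
      ultimately show "- s + u \<in> perp V (normals f)" by (simp add: mem_perp inner_diff_left)
    qed
  qed
  show "perp V (normals f) \<subseteq> ?D"
  proof
    fix z assume z: "z \<in> perp V (normals f)"
    obtain d z' where dz: "d \<in> span ?D" "\<And>w. w \<in> span ?D \<Longrightarrow> orthogonal z' w" "z = d + z'"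
      using orthogonal_subspace_decomp_exists by blast
    have spD: "span ?D = ?D" by (simp add: direction_def span_span)
    have dD: "d \<in> ?D" using dz(1) spD by simp
    then have "d \<in> perp V (normals f)" using \<open>?D \<subseteq> perp V (normals f)\<close> by blast
    then have z': "z' \<in> perp V (normals f)"
      using subspace_diff[OF subspace_perp[OF V] z, of d] dz(3) by simp
    obtain x where x: "x \<in> V" "maximizers x = f" using face_exposed[OF f] by blast
    have const: "z' \<bullet> u = z' \<bullet> s" if "u \<in> f" for u
    proof -
      have "u \<in> affine hull f" using that hull_inc by metis
      then obtain w where "w \<in> ?D" "u = s + w" using affine_hull_face[OF f s] by auto
      then show ?thesis using dz(2)[of w] spD by (simp add: inner_add_right orthogonal_def)
    qed
    obtain \<epsilon> where \<epsilon>: "\<epsilon> > 0" "maximizers x \<subseteq> maximizers (x + \<epsilon> *\<^sub>R z')"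
      using maximizers_perturb[of x z'] const x(2) by metis
    have z'V: "z' \<in> V" using z' by (simp add: mem_perp)
    then have "x + \<epsilon> *\<^sub>R z' \<in> normals f" "x \<in> normals f"
      using \<epsilon>(2) x V by (auto simp: normals_def subspace_add subspace_scale)
    then have "z' \<bullet> (x + \<epsilon> *\<^sub>R z') = 0" "z' \<bullet> x = 0" using z' by (auto simp: mem_perp)
    then have "z' = 0" using \<epsilon>(1) by (simp add: inner_add_right)
    then show "z \<in> ?D" using dD dz(3) by simp
  qed
qed

lemma span_perp_lattice_normals:
  assumes f: "face_le f P"
  shows "span (perp_lattice V \<Lambda> (normals f)) = perp V (normals f)"
proof
  show "span (perp_lattice V \<Lambda> (normals f)) \<subseteq> perp V (normals f)"
    using subspace_perp[OF V] by (intro span_minimal) (auto simp: perp_lattice_def)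
  obtain s where s: "s \<in> S \<inter> f" using face_vertex[OF f] by blast
  have "(\<lambda>x. - s + x) ` (S \<inter> f - {s}) \<subseteq> perp_lattice V \<Lambda> (normals f)"
  proof
    fix w assume w: "w \<in> (\<lambda>x. - s + x) ` (S \<inter> f - {s})"
    then have "w \<in> perp V (normals f)" unfolding perp_normals[OF f s] direction_def by (rule span_base)
    moreover have "w \<in> \<Lambda>" using w s S_L L_closed(2) by auto
    ultimately show "w \<in> perp_lattice V \<Lambda> (normals f)" by (simp add: perp_lattice_def)
  qed
  then show "perp V (normals f) \<subseteq> span (perp_lattice V \<Lambda> (normals f))"
    unfolding perp_normals[OF f s] direction_def by (rule span_mono)
qed

lemma fan_lattice_fan: "lattice_fan V \<Lambda> T fan"
proof
  show "finite fan" by (rule finite_fan)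
  fix K assume "K \<in> fan"
  then obtain f where f: "face_le f P" "K = normals f" by (auto simp: fan_def)
  show "rational_cone \<Lambda> K" "pointed K" "span (perp_lattice V \<Lambda> K) = perp V K"
    using f rational_normals pointed_normals span_perp_lattice_normals by auto
  show "J \<in> fan" if "face_le J K" for J using face_of_normals f that by blast
next
  fix J K assume "J \<in> fan" "K \<in> fan" "J \<subseteq> K"
  then show "J face_of K" using normals_face normals_antimono_iff by (auto simp: fan_def)
qed

section \<open>Anchors, and the dilated polytope as an anchored polyhedron\<close>

definition associated_face :: "'a set \<Rightarrow> 'a set" where
  "associated_face K = the_inv_into {f. face_le f P} normals K"

text \<open>Any point of \<open>S\<close> on the face will do; despite the name it need not be an
  extreme point of \<open>P\<close>.\<close>

definition vertex :: "'a set \<Rightarrow> 'a" where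
  "vertex K = (SOME s. s \<in> S \<inter> associated_face K)"

lemma associated_face_normals: "face_le f P \<Longrightarrow> associated_face (normals f) = f"
  unfolding associated_face_def using inj_normals by (intro the_inv_into_f_f) auto

lemma vertex_normals:
  assumes f: "face_le f P" shows "vertex (normals f) \<in> S \<inter> f"
proof -
  have "\<exists>s. s \<in> S \<inter> f" using face_vertex[OF f] by blast
  then show ?thesis unfolding vertex_def associated_face_normals[OF f] by (rule someI_ex)
qed

lemma vertex_inner:
  assumes "face_le f P" "m \<in> normals f" "y \<in> P"
  shows "y \<bullet> m \<le> vertex (normals f) \<bullet> m"
proof -
  have "m \<bullet> y \<le> m \<bullet> vertex (normals f)"
    using vertex_normals[OF assms(1)] assms(2,3) unfolding mem_normals by blast
  then show ?thesis by (simp add: inner_commute)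
qed

text \<open>For \<open>J \<subseteq> K\<close> both anchors lie on the dilated face with normal cone
  \<open>J\<close>, where every member of \<open>J\<close> is constant.\<close>

lemma fan_anchored_fan: "anchored_fan V \<Lambda> T fan (\<lambda>K. real t *\<^sub>R vertex K)"
proof -
  interpret lattice_fan V \<Lambda> T fan by (rule fan_lattice_fan)
  show ?thesis
  proof
    fix K assume "K \<in> fan"
    then have "vertex K \<in> \<Lambda>" using vertex_normals S_L by (auto simp: fan_def)
    then show "real t *\<^sub>R vertex K \<in> \<Lambda>"
      using scaleR_int_closed[of \<Lambda> "vertex K" "int t"] L_closed by simp
  next
    fix J K assume JK: "J \<in> fan" "K \<in> fan" "J \<subseteq> K"
    then obtain f g where fg: "face_le f P" "K = normals f" "face_le g P" "J = normals g" by (auto simp: fan_def)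
    then have "f \<subseteq> g" using JK(3) normals_antimono_iff by blast
    then have v: "vertex K \<in> S \<inter> g" "vertex J \<in> S \<inter> g"
      using vertex_normals[OF fg(1)] vertex_normals[OF fg(3)] fg by auto
    have "(vertex K - vertex J) \<bullet> m = 0" if "m \<in> J" for m
      using normals_const[of m g "vertex K" "vertex J"] that v fg(4)
      by (simp add: inner_diff_right inner_commute[of _ m])
    moreover have "vertex K \<in> V" "vertex J \<in> V" using v S_L L_V by auto
    then have "vertex K - vertex J \<in> V" by (rule subspace_diff[OF V])
    ultimately have "vertex K - vertex J \<in> perp V J" by (simp add: mem_perp)
    then show "real t *\<^sub>R vertex K - real t *\<^sub>R vertex J \<in> perp V J"
      using subspace_scale[OF subspace_perp[OF V]] by (metis scaleR_diff_right)
  qed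
qed

text \<open>Only rays occur in the definition of the polyhedron. This suffices, because a functional
  separating a point from \<open>P\<close> is normal to its maximizing face, and that normal cone is
  generated by its rays.\<close>

lemma anchored_polyhedron_eq:
  assumes t: "t > 0"
  shows "anchored_fan.anchored_polyhedron V fan (\<lambda>K. real t *\<^sub>R vertex K) = (*\<^sub>R) (real t) ` P"
proof -
  interpret anchored_fan V \<Lambda> T fan "\<lambda>K. real t *\<^sub>R vertex K" by (rule fan_anchored_fan)
  show ?thesis
  proof (intro set_eqI iffI)
    fix y assume "y \<in> (*\<^sub>R) (real t) ` P"
    then obtain y' where y': "y' \<in> P" "y = real t *\<^sub>R y'" by blast
    have "(y - real t *\<^sub>R vertex M) \<bullet> m \<le> 0" if M: "M \<in> fan" "m \<in> M" for M m
    proof -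
      have "y' \<bullet> m \<le> vertex M \<bullet> m" using M vertex_inner y' by (auto simp: fan_def)
      then have "real t * (y' \<bullet> m) \<le> real t * (vertex M \<bullet> m)" by (rule mult_left_mono) simp
      then show ?thesis by (simp add: y' inner_diff_left)
    qed
    moreover have "y \<in> V" using y' P_props(5) V by (auto simp: subspace_scale)
    ultimately show "y \<in> anchored_polyhedron" by (simp add: anchored_polyhedron_def)
  next
    fix y assume y: "y \<in> anchored_polyhedron"
    let ?y = "(1 / real t) *\<^sub>R y"
    have yt: "y = real t *\<^sub>R ?y" using t by simp
    have yV: "?y \<in> V" using y V by (simp add: anchored_polyhedron_def subspace_scale)
    have "?y \<in> P"
    proof (rule ccontr)
      assume "?y \<notin> P"
      then obtain a b where ab: "a \<bullet> ?y < b" "\<And>x. x \<in> P \<Longrightarrow> b < a \<bullet> x"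
        using separating_hyperplane_closed_point[OF P_props(2) compact_imp_closed[OF P_props(3)], of ?y] by blast
      \<comment> \<open>\<open>- a\<close> is projected to \<open>V\<close>, where the normal cones
        live; the projection \<open>x\<close> takes a larger value at \<open>?y\<close> than
        anywhere on \<open>P\<close>.\<close>
      obtain x u where xu: "x \<in> span V" "\<And>w. w \<in> span V \<Longrightarrow> orthogonal u w" "- a = x + u"
        using orthogonal_subspace_decomp_exists by blast
      have eq: "x \<bullet> w = - (a \<bullet> w)" if "w \<in> V" for w
        using xu(2)[of w] span_base[OF that] arg_cong[OF xu(3), of "\<lambda>v. v \<bullet> w"]
        by (simp add: inner_add_left orthogonal_def)
      have xV: "x \<in> V" using xu(1) V by (metis span_eq_iff)
      define f where "f = maximizers x"
      have f: "face_le f P" unfolding f_def by (rule maximizers_face)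
      have xf: "x \<in> normals f" using xV by (simp add: normals_def f_def)
      have K: "normals f \<in> fan" using f by (auto simp: fan_def)
      have "normals f \<subseteq> {m. (?y - vertex (normals f)) \<bullet> m \<le> 0}"
      proof (rule rays_generate[OF K])
        show "convex {m. (?y - vertex (normals f)) \<bullet> m \<le> 0}" by (rule convex_halfspace_le)
        show "conic {m. (?y - vertex (normals f)) \<bullet> m \<le> 0}" by (rule conic_halfspace_le)
        show "0 \<in> {m. (?y - vertex (normals f)) \<bullet> m \<le> 0}" by simp
        fix M assume M: "M \<in> fan" "aff_dim M = 1" "M \<subseteq> normals f"
        show "M \<subseteq> {m. (?y - vertex (normals f)) \<bullet> m \<le> 0}"
        proof
          fix m assume m: "m \<in> M"
          have "(y - real t *\<^sub>R vertex M) \<bullet> m \<le> 0" using y M m by (auto simp: anchored_polyhedron_def)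
          moreover have "(real t *\<^sub>R vertex (normals f) - real t *\<^sub>R vertex M) \<bullet> m = 0"
            using anchor_perp[OF M(1) K M(3)] m by (auto simp: mem_perp)
          ultimately have "real t * ((?y - vertex (normals f)) \<bullet> m) \<le> 0"
            using t by (simp add: inner_diff_left right_diff_distrib)
          then show "m \<in> {m. (?y - vertex (normals f)) \<bullet> m \<le> 0}" using t by (simp add: mult_le_0_iff)
        qed
      qed
      then have 1: "(?y - vertex (normals f)) \<bullet> x \<le> 0" using xf by blast
      have vP: "vertex (normals f) \<in> P" using vertex_normals[OF f] P_props(7) by blast
      have "x \<bullet> ?y > x \<bullet> vertex (normals f)"
        using ab(1) ab(2)[OF vP] eq[OF yV] eq[of "vertex (normals f)"] vP P_props(5) by auto
      then show False using 1 by (simp only: inner_commute[of _ x] inner_diff_right)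
    qed
    then show "y \<in> (*\<^sub>R) (real t) ` P" using yt by blast
  qed
qed

text \<open>\<open>f\<close> is a minimal face containing \<open>q\<close>, so intersecting it with
  the face \<open>maximizers x\<close> cannot shrink it.\<close>

lemma minimal_face:
  assumes q: "q \<in> P"
  obtains f where "face_le f P" "\<And>x. x \<in> V \<Longrightarrow> q \<in> maximizers x \<Longrightarrow> x \<in> normals f" "q \<in> f"
proof -
  let ?A = "{f. face_le f P \<and> q \<in> f}"
  have "finite ?A" using finite_faces by (rule finite_subset[rotated]) auto
  moreover have "P \<in> ?A" using q P_props(2,8) by (auto simp: face_le_def face_of_refl)
  ultimately obtain f where f: "f \<in> ?A" "\<And>g. g \<in> ?A \<Longrightarrow> g \<subseteq> f \<Longrightarrow> f = g"
    using finite_has_minimal[of ?A] by blast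
  have "x \<in> normals f" if x: "x \<in> V" "q \<in> maximizers x" for x
  proof -
    have "f \<inter> maximizers x face_of P"
      using f(1) faceD(1)[OF maximizers_face] by (intro face_of_Int) (auto simp: face_le_def)
    then have "f \<inter> maximizers x \<in> ?A" using x f(1) by (auto simp: face_le_def)
    then have "f = f \<inter> maximizers x" using f(2) by blast
    then show ?thesis using x by (auto simp: normals_def)
  qed
  then show ?thesis using that f(1) by blast
qed

text \<open>At a point \<open>q\<close> of \<open>P\<close> take for \<open>K\<close> the normal
  cone of the minimal face containing \<open>q\<close>: the inequalities of all rays outside
  \<open>K\<close> have slack at \<open>q\<close>. By compactness the slack is at least some
  \<open>\<delta>\<close> for a suitable \<open>K\<close> at each point, and dilation multiplies it
  by \<open>t\<close> while the regions keep their size.\<close>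

lemma eventually_cover:
  obtains t0 :: nat where "\<And>t p. t \<ge> t0 \<Longrightarrow> p \<in> CDC V \<Lambda> T ((*\<^sub>R) (real t) ` P) \<Longrightarrow>
    \<exists>K\<in>fan. \<exists>x\<in>anchored_translations V \<Lambda> R fan (\<lambda>K. real t *\<^sub>R vertex K) K. p - x \<in> R K"
proof -
  interpret fan: lattice_fan V \<Lambda> T fan by (rule fan_lattice_fan)
  have "bounded (\<Union>K\<in>fan. R K)" using finite_fan fan.bounded_region by (intro bounded_UN) auto
  then obtain r where r: "\<And>K y. K \<in> fan \<Longrightarrow> y \<in> R K \<Longrightarrow> norm y \<le> r"
    unfolding bounded_pos by blast
  obtain c where c: "\<And>y. y \<in> T \<Lambda> \<Longrightarrow> norm y \<le> c"
    using domain_L unfolding fundamental_domain_def bounded_pos by blast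
  obtain g where unit: "\<forall>M\<in>fan. aff_dim M = 1 \<longrightarrow> norm (g M) = 1 \<and> M = (\<lambda>r. r *\<^sub>R g M) ` {0..} \<and> g M \<in> M"
    by (rule fan.unit_generators)
  then have g: "norm (g M) = 1 \<and> M = (\<lambda>r. r *\<^sub>R g M) ` {0..}" and gM: "g M \<in> M"
    if "M \<in> fan" "aff_dim M = 1" for M using that by blast+
  let ?G = "\<lambda>K. {M \<in> fan. aff_dim M = 1 \<and> \<not> M \<subseteq> K}"
  have pos: "\<exists>K\<in>fan. \<forall>M\<in>?G K. (vertex M - q) \<bullet> g M > 0" if q: "q \<in> P" for q
  proof -
    obtain f where f: "face_le f P" "\<And>x. x \<in> V \<Longrightarrow> q \<in> maximizers x \<Longrightarrow> x \<in> normals f"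
      using minimal_face[OF q] by blast
    have "(vertex M - q) \<bullet> g M > 0" if M: "M \<in> ?G (normals f)" for M
    proof -
      obtain e where e: "face_le e P" "M = normals e" using M by (auto simp: fan_def)
      have gm: "g M \<in> M" using gM M by blast
      have "g M \<notin> normals f"
      proof
        assume "g M \<in> normals f"
        then have "r *\<^sub>R g M \<in> normals f" if "r \<ge> 0" for r
          using conicD[OF normals_cone(3)[OF f(1)]] that by blast
        then have "(\<lambda>r. r *\<^sub>R g M) ` {0..} \<subseteq> normals f" by auto
        then show False using g[of M] M by auto
      qed
      then have "q \<notin> maximizers (g M)" using f(2) gm e by (auto simp: mem_normals)
      then obtain y where y: "y \<in> P" "g M \<bullet> q < g M \<bullet> y" using q by (auto simp: maximizers_def not_le)
      then have "q \<bullet> g M < y \<bullet> g M" by (simp add: inner_commute)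
      moreover have "y \<bullet> g M \<le> vertex M \<bullet> g M" using vertex_inner[OF e(1) _ y(1)] gm e(2) by simp
      ultimately show ?thesis by (simp add: inner_diff_left)
    qed
    then show ?thesis using f(1) by (auto simp: fan_def)
  qed
  have cont: "continuous_on P (\<lambda>q. (vertex M - q) \<bullet> g M)" for M by (intro continuous_intros)
  have finG: "finite (?G K)" for K using finite_fan by simp
  obtain \<delta> where \<delta>: "\<delta> > 0" "\<And>q. q \<in> P \<Longrightarrow> \<exists>K\<in>fan. \<forall>M\<in>?G K. (vertex M - q) \<bullet> g M \<ge> \<delta>"
    by (rule compact_uniform_margin[OF P_props(3) finite_fan finG cont pos]) blast+
  \<comment> \<open>\<open>3 * r\<close> is the margin required by \<open>cover_near_face\<close>,
    and \<open>2 * c\<close> bounds the distance from a point of the \<open>CDC\<close> to a point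
    of \<open>tP\<close> in the same tile.\<close>
  obtain t0 :: nat where t0: "real t0 > (3 * r + 2 * c) / \<delta>" using reals_Archimedean2 by blast
  show ?thesis
  proof (rule that[of t0])
    fix t p assume t: "t \<ge> t0" and p: "p \<in> CDC V \<Lambda> T ((*\<^sub>R) (real t) ` P)"
    interpret A: anchored_fan V \<Lambda> T fan "\<lambda>K. real t *\<^sub>R vertex K" by (rule fan_anchored_fan)
    have "real t > (3 * r + 2 * c) / \<delta>" using t t0 by linarith
    then have t\<delta>: "real t * \<delta> > 3 * r + 2 * c" using \<delta>(1) by (simp add: field_simps)
    obtain z \<tau> \<sigma> where z: "\<tau> \<in> T \<Lambda>" "p = z + \<tau>" "\<sigma> \<in> T \<Lambda>" "z + \<sigma> \<in> (*\<^sub>R) (real t) ` P"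
      using p unfolding mem_CDC by blast
    obtain q where q: "q \<in> P" "z + \<sigma> = real t *\<^sub>R q" using z(4) by blast
    have "p - real t *\<^sub>R q = \<tau> - \<sigma>" using z(2) q(2) by (metis add_diff_cancel_left)
    then have pq: "norm (p - real t *\<^sub>R q) \<le> 2 * c"
      using c[OF z(1)] c[OF z(3)] norm_triangle_ineq4[of \<tau> \<sigma>] by simp
    obtain K where K: "K \<in> fan" "\<And>M. M \<in> ?G K \<Longrightarrow> (vertex M - q) \<bullet> g M \<ge> \<delta>" using \<delta>(2)[OF q(1)] by blast
    obtain f where f: "face_le f P" "K = normals f" using K by (auto simp: fan_def)
    have near: "p - real t *\<^sub>R vertex K \<in> CDC V \<Lambda> T (polar V K)"
    proof (rule CDC_translation[OF A.anchor_L[OF K(1)] _ p])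
      fix y assume "y \<in> (*\<^sub>R) (real t) ` P"
      then obtain y' where y': "y' \<in> P" "y = real t *\<^sub>R y'" by blast
      have "(y - real t *\<^sub>R vertex K) \<bullet> m \<le> 0" if m: "m \<in> K" for m
      proof -
        have "real t * (y' \<bullet> m) \<le> real t * (vertex K \<bullet> m)"
          using vertex_inner[OF f(1) _ y'(1)] m f(2) by (intro mult_left_mono) auto
        then show ?thesis by (simp add: y' inner_diff_left)
      qed
      moreover have "y \<in> V" "real t *\<^sub>R vertex K \<in> V"
        using y' P_props(5) A.anchor_L[OF K(1)] L_V V by (auto simp: subspace_scale)
      then have "y - real t *\<^sub>R vertex K \<in> V" by (rule subspace_diff[OF V])
      ultimately show "y - real t *\<^sub>R vertex K \<in> polar V K" by (simp add: mem_polar)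
    qed
    have bd: "norm y \<le> r" if "J \<in> fan" "\<not> K \<subset> J" "y \<in> R J" for J y using r that by blast
    have far: "(p - real t *\<^sub>R vertex M) \<bullet> m < - 3 * r * norm m"
      if M: "M \<in> fan" "aff_dim M = 1" "\<not> M \<subseteq> K" "m \<in> M" "m \<noteq> 0" for M m
    proof -
      obtain \<rho> where \<rho>: "m = \<rho> *\<^sub>R g M" "\<rho> \<ge> 0" using g[OF M(1,2)] M(4) by auto
      then have nm: "norm m = \<rho>" "\<rho> > 0" using g[OF M(1,2)] M(5) by auto
      have "(vertex M - q) \<bullet> g M \<ge> \<delta>" using K(2)[of M] M by simp
      then have "real t * ((vertex M - q) \<bullet> g M) \<ge> real t * \<delta>" by (rule mult_left_mono) simp
      moreover have "(p - real t *\<^sub>R q) \<bullet> g M \<le> norm (p - real t *\<^sub>R q) * norm (g M)" by (rule norm_cauchy_schwarz)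
      then have "(p - real t *\<^sub>R q) \<bullet> g M \<le> 2 * c" using pq g[OF M(1,2)] by simp
      ultimately have "(p - real t *\<^sub>R vertex M) \<bullet> g M < - 3 * r"
        using t\<delta> by (simp add: inner_diff_left right_diff_distrib)
      then have "\<rho> * ((p - real t *\<^sub>R vertex M) \<bullet> g M) < \<rho> * (- 3 * r)" using nm(2) by (rule mult_strict_left_mono)
      then show ?thesis by (simp add: nm(1)) (simp add: \<rho>(1) mult.commute mult.left_commute)
    qed
    obtain J x where "J \<in> fan" "x \<in> anchored_translations V \<Lambda> R fan (\<lambda>K. real t *\<^sub>R vertex K) J" "p - x \<in> R J"
      by (rule A.cover_near_face[OF K(1) near bd far])
    then show "\<exists>K\<in>fan. \<exists>x\<in>anchored_translations V \<Lambda> R fan (\<lambda>K. real t *\<^sub>R vertex K) K. p - x \<in> R K" by blast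
  qed
qed

lemma anchored_face_eq:
  assumes t: "t > 0" and f: "face_le f P"
  shows "anchored_fan.anchored_face V fan (\<lambda>K. real t *\<^sub>R vertex K) (normals f) = (*\<^sub>R) (real t) ` f"
proof -
  interpret anchored_fan V \<Lambda> T fan "\<lambda>K. real t *\<^sub>R vertex K" by (rule fan_anchored_fan)
  let ?s = "vertex (normals f)"
  have s: "?s \<in> f" "?s \<in> S \<inter> f" using vertex_normals[OF f] by auto
  have iff: "real t *\<^sub>R y - real t *\<^sub>R ?s \<in> perp V (normals f) \<longleftrightarrow> y \<in> f" if y: "y \<in> P" for y
  proof
    assume m: "real t *\<^sub>R y - real t *\<^sub>R ?s \<in> perp V (normals f)"
    obtain x where x: "x \<in> V" "maximizers x = f" using face_exposed[OF f] by blast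
    then have "x \<in> normals f" by (simp add: normals_def)
    then have "(real t *\<^sub>R y - real t *\<^sub>R ?s) \<bullet> x = 0" using m by (simp add: mem_perp)
    then have "x \<bullet> y = x \<bullet> ?s" using t by (simp add: inner_diff_right inner_commute[of _ x])
    then show "y \<in> f" using x(2) s(1) y by (auto simp: maximizers_def)
  next
    assume yf: "y \<in> f"
    have "y \<in> affine hull f" using yf hull_inc by metis
    then obtain w where "w \<in> direction f ?s" "y = ?s + w" using affine_hull_face[OF f s(2)] by auto
    then have "y - ?s \<in> perp V (normals f)" using perp_normals[OF f s(2)] by simp
    then show "real t *\<^sub>R y - real t *\<^sub>R ?s \<in> perp V (normals f)"
      using subspace_scale[OF subspace_perp[OF V]] by (metis scaleR_diff_right)
  qed
  show ?thesis
    unfolding anchored_face_def anchored_polyhedron_eq[OF t] using iff faceD(3)[OF f] by auto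
qed

lemma lattice_subspace_direction:
  assumes f: "face_le f P" and s: "s \<in> S \<inter> f"
  shows "lattice_subspace \<Lambda> (direction f s)"
  using lattice_fan.span_perp_lattice[OF fan_lattice_fan, of "normals f"] f is_lattice_perp_lattice[of "normals f"]
    subspace_perp[OF V, of "normals f"]
  unfolding perp_normals[OF f s, symmetric] by (auto simp: lattice_subspace_def perp_lattice_def fan_def)

lemma lebesgue_sliced_face: "face_le f P \<Longrightarrow> lebesgue_sliced f"
proof -
  assume "face_le f P"
  then have "closed f" using faceD(1) face_of_imp_closed P_props(2,3) compact_imp_closed by blast
  then show ?thesis by (intro lebesgue_sliced_borel) auto
qed

theorem eventually_card_eq:
  obtains t0 :: nat where "\<And>t. t \<ge> t0 \<Longrightarrow> real (card (\<Lambda> \<inter> (*\<^sub>R) (real t) ` P)) =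
    (\<Sum>f\<in>{f. face_le f P}. mu_pointed V \<Lambda> T (normals f) * rel_vol \<Lambda> (affine hull f) f * real t ^ nat (aff_dim f))"
proof -
  obtain t0 :: nat where t0: "\<And>t p. t \<ge> t0 \<Longrightarrow> p \<in> CDC V \<Lambda> T ((*\<^sub>R) (real t) ` P) \<Longrightarrow>
    \<exists>K\<in>fan. \<exists>x\<in>anchored_translations V \<Lambda> R fan (\<lambda>K. real t *\<^sub>R vertex K) K. p - x \<in> R K"
    using eventually_cover by blast
  show ?thesis
  \<comment> \<open>\<open>t = 0\<close> is left out, since identifying \<open>Q\<close> with
    \<open>tP\<close> involves division by \<open>t\<close>.\<close>
  proof (rule that[of "max 1 t0"])
    fix t assume "t \<ge> max 1 t0"
    then have t: "t > 0" "t \<ge> t0" by auto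
    interpret anchored_fan V \<Lambda> T fan "\<lambda>K. real t *\<^sub>R vertex K" by (rule fan_anchored_fan)
    note eq = anchored_polyhedron_eq[OF t(1)]
    have "bounded Q" unfolding eq using compact_imp_bounded[OF P_props(3)] by (rule bounded_scaling)
    then have "real (card (\<Lambda> \<inter> Q)) = (\<Sum>J\<in>fan. mu_pointed V \<Lambda> T J *
        subspace_vol \<Lambda> (perp V J) ((+) (- (real t *\<^sub>R vertex J)) ` anchored_face J))"
      by (rule card_lattice_points_eq) (use t0[OF t(2)] eq in simp)
    also have "\<dots> = (\<Sum>f\<in>{f. face_le f P}. mu_pointed V \<Lambda> T (normals f) *
        subspace_vol \<Lambda> (perp V (normals f)) ((+) (- (real t *\<^sub>R vertex (normals f))) ` anchored_face (normals f)))"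
      unfolding fan_def by (subst sum.reindex[OF inj_normals]) simp
    also have "\<dots> = (\<Sum>f\<in>{f. face_le f P}. mu_pointed V \<Lambda> T (normals f) * rel_vol \<Lambda> (affine hull f) f * real t ^ nat (aff_dim f))"
    proof (rule sum.cong[OF refl])
      fix f assume "f \<in> {f. face_le f P}"
      then have f: "face_le f P" by simp
      let ?s = "vertex (normals f)"
      have s: "?s \<in> S \<inter> f" by (rule vertex_normals[OF f])
      let ?D = "direction f ?s"
      note D = lattice_subspace_direction[OF f s]
      have sl: "lebesgue_sliced ((+) (- ?s) ` f)" by (intro lebesgue_sliced_translation lebesgue_sliced_face[OF f])
      have "(+) (- (real t *\<^sub>R ?s)) ` anchored_face (normals f) = (*\<^sub>R) (real t) ` ((+) (- ?s) ` f)"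
        unfolding anchored_face_eq[OF t(1) f] image_image by (simp add: scaleR_diff_right)
      then have "subspace_vol \<Lambda> (perp V (normals f)) ((+) (- (real t *\<^sub>R ?s)) ` anchored_face (normals f)) =
          real t ^ dim ?D * subspace_vol \<Lambda> ?D ((+) (- ?s) ` f)"
        using subspace_vol_scaleR[OF D sl, of "real t"] t(1) perp_normals[OF f s] by simp
      also have "subspace_vol \<Lambda> ?D ((+) (- ?s) ` f) = rel_vol \<Lambda> (affine hull f) f"
        using s S_L by (intro rel_vol_eq_subspace_vol[symmetric] D L lebesgue_sliced_face[OF f] affine_hull_face[OF f s]) auto
      also have "dim ?D = nat (aff_dim f)"
      proof -
        have "aff_dim f = aff_dim ((+) ?s ` ?D)" using affine_hull_face[OF f s] aff_dim_affine_hull by metis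
        also have "\<dots> = int (dim ?D)"
          using D by (simp add: aff_dim_translation_eq lattice_subspace_def aff_dim_subspace)
        finally show ?thesis by simp
      qed
      finally show "mu_pointed V \<Lambda> T (normals f) * subspace_vol \<Lambda> (perp V (normals f)) ((+) (- (real t *\<^sub>R ?s)) ` anchored_face (normals f)) =
          mu_pointed V \<Lambda> T (normals f) * rel_vol \<Lambda> (affine hull f) f * real t ^ nat (aff_dim f)" by simp
    qed
    finally show "real (card (\<Lambda> \<inter> (*\<^sub>R) (real t) ` P)) =
      (\<Sum>f\<in>{f. face_le f P}. mu_pointed V \<Lambda> T (normals f) * rel_vol \<Lambda> (affine hull f) f * real t ^ nat (aff_dim f))"
      unfolding eq .
  qed
qed

end

section \<open>The local formula\<close>

lemma lineality_space_eqI: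
  assumes "subspace U" "U \<subseteq> C" "\<And>U'. subspace U' \<Longrightarrow> U' \<subseteq> C \<Longrightarrow> U' \<subseteq> U"
  shows "lineality_space C = U"
  unfolding lineality_space_def using assms by (intro Greatest_equality) auto

section \<open>Normal cones in a larger ambient space\<close>

context normal_fan
begin

context
  fixes V\<^sub>0 :: "'a set" and v :: 'a
  assumes V\<^sub>0: "subspace V\<^sub>0" "V \<subseteq> V\<^sub>0"
begin

lemma mem_normal_cone:
  "x \<in> normal_cone V\<^sub>0 ((+) v ` P) ((+) v ` f) \<longleftrightarrow> x \<in> V\<^sub>0 \<and> (\<forall>s\<in>rel_interior f. \<forall>y\<in>P. x \<bullet> (y - s) \<le> 0)"
  unfolding normal_cone_def rel_interior_translation by simp

text \<open>A single relative interior point of \<open>f\<close> decides: the face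
  \<open>maximizers x\<close> contains all of \<open>f\<close> as soon as it contains this
  point.\<close>

lemma normal_cone_Int:
  assumes f: "face_le f P"
  shows "normal_cone V\<^sub>0 ((+) v ` P) ((+) v ` f) \<inter> V = normals f"
proof (intro set_eqI iffI)
  fix x assume x: "x \<in> normal_cone V\<^sub>0 ((+) v ` P) ((+) v ` f) \<inter> V"
  obtain s where s: "s \<in> rel_interior f"
    using rel_interior_eq_empty[OF faceD(4)[OF f]] faceD(2)[OF f] by blast
  then have "s \<in> P" using rel_interior_subset faceD(3)[OF f] by blast
  then have "s \<in> maximizers x"
    using x s unfolding mem_normal_cone Int_iff maximizers_def by (auto simp: inner_diff_right)
  then have "f \<subseteq> maximizers x"
    using subset_of_face_of[OF faceD(1)[OF maximizers_face] faceD(3)[OF f]] s by blast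
  then show "x \<in> normals f" using x by (simp add: normals_def)
next
  fix x assume x: "x \<in> normals f"
  then show "x \<in> normal_cone V\<^sub>0 ((+) v ` P) ((+) v ` f) \<inter> V"
    using V\<^sub>0(2) rel_interior_subset[of f] unfolding mem_normal_cone Int_iff mem_normals
    by (auto simp: inner_diff_right)
qed

lemma perp_perp: "perp V\<^sub>0 (perp V\<^sub>0 V) = V"
proof
  show "V \<subseteq> perp V\<^sub>0 (perp V\<^sub>0 V)"
  proof
    fix x assume x: "x \<in> V"
    have "x \<bullet> m = 0" if "m \<in> perp V\<^sub>0 V" for m
      using that x by (auto simp: mem_perp inner_commute[of x])
    then show "x \<in> perp V\<^sub>0 (perp V\<^sub>0 V)" using x V\<^sub>0(2) unfolding mem_perp[of x] by blast
  qed
  show "perp V\<^sub>0 (perp V\<^sub>0 V) \<subseteq> V"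
  proof
    fix x assume x: "x \<in> perp V\<^sub>0 (perp V\<^sub>0 V)"
    obtain w u where wu: "w \<in> span V" "\<And>y. y \<in> span V \<Longrightarrow> orthogonal u y" "x = w + u"
      using orthogonal_subspace_decomp_exists by blast
    have w: "w \<in> V" using wu(1) V by (metis span_eq_iff)
    then have "x - w \<in> V\<^sub>0" using x V\<^sub>0 subspace_diff[OF V\<^sub>0(1)] by (auto simp: mem_perp)
    then have "u \<in> perp V\<^sub>0 V" using wu(2,3) span_base by (auto simp: mem_perp orthogonal_def)
    then have "x \<bullet> u = 0" using x by (simp add: mem_perp)
    moreover have "w \<bullet> u = 0" using wu(2)[OF wu(1)] by (simp add: orthogonal_def inner_commute)
    ultimately have "u = 0" by (simp add: wu(3) inner_add_left)
    then show "x \<in> V" using w wu(3) by simp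
  qed
qed

text \<open>A vector that lies in the cone together with its negative is constant on
  \<open>P\<close>, hence on the affine hull \<open>V\<close>, which contains 0.\<close>

lemma lineality_space_normal_cone:
  assumes f: "face_le f P"
  shows "lineality_space (normal_cone V\<^sub>0 ((+) v ` P) ((+) v ` f)) = perp V\<^sub>0 V"
proof (rule lineality_space_eqI)
  show "subspace (perp V\<^sub>0 V)" by (rule subspace_perp[OF V\<^sub>0(1)])
  show "perp V\<^sub>0 V \<subseteq> normal_cone V\<^sub>0 ((+) v ` P) ((+) v ` f)"
  proof
    fix x assume x: "x \<in> perp V\<^sub>0 V"
    have "x \<bullet> (y - s) = 0" if "s \<in> rel_interior f" "y \<in> P" for s y
    proof -
      have "s \<in> P" using that(1) rel_interior_subset[of f] faceD(3)[OF f] by blast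
      then have "y - s \<in> V" using that(2) P_props(5) subspace_diff[OF V] by blast
      then show ?thesis using x by (simp add: mem_perp)
    qed
    then show "x \<in> normal_cone V\<^sub>0 ((+) v ` P) ((+) v ` f)"
      using x unfolding mem_normal_cone by (simp add: mem_perp)
  qed
  fix U assume U: "subspace U" "U \<subseteq> normal_cone V\<^sub>0 ((+) v ` P) ((+) v ` f)"
  show "U \<subseteq> perp V\<^sub>0 V"
  proof
    fix x assume x: "x \<in> U"
    then have "- x \<in> U" using U(1) by (rule subspace_neg[rotated])
    then have xx: "x \<in> normal_cone V\<^sub>0 ((+) v ` P) ((+) v ` f)" "- x \<in> normal_cone V\<^sub>0 ((+) v ` P) ((+) v ` f)"
      using U(2) x by auto
    obtain s where s: "s \<in> rel_interior f"
      using rel_interior_eq_empty[OF faceD(4)[OF f]] faceD(2)[OF f] by blast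
    have "x \<bullet> y = x \<bullet> s" if "y \<in> P" for y
      using xx s that unfolding mem_normal_cone by (force simp: inner_diff_right intro: order_antisym)
    then have "P \<subseteq> {y. x \<bullet> y = x \<bullet> s}" by blast
    then have h: "V \<subseteq> {y. x \<bullet> y = x \<bullet> s}"
      unfolding P_props(6)[symmetric] by (rule hull_minimal) (rule affine_hyperplane)
    then have "x \<bullet> 0 = x \<bullet> s" using subspace_0[OF V] by blast
    then show "x \<in> perp V\<^sub>0 V" using h xx(1) unfolding mem_normal_cone mem_perp by auto
  qed
qed

text \<open>For a cone that is not pointed, \<open>mu\<close> passes to the complement of the
  lineality space \<open>perp V\<^sub>0 V\<close>, which is \<open>V\<close> again, with the same
  cone and lattice there. A pointed normal cone forces \<open>V = V\<^sub>0\<close>.\<close>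

lemma mu_normal_cone:
  assumes f: "face_le f P" and \<Lambda>\<^sub>0: "\<Lambda> = \<Lambda>\<^sub>0 \<inter> V" and sub: "\<Lambda>\<^sub>0 \<subseteq> V\<^sub>0"
  shows "mu V\<^sub>0 \<Lambda>\<^sub>0 T (normal_cone V\<^sub>0 ((+) v ` P) ((+) v ` f)) = mu_pointed V \<Lambda> T (normals f)"
proof (cases "pointed (normal_cone V\<^sub>0 ((+) v ` P) ((+) v ` f))")
  case True
  let ?C = "normal_cone V\<^sub>0 ((+) v ` P) ((+) v ` f)"
  have lin: "lineality_space ?C = {0}"
  proof (rule lineality_space_eqI)
    show "{0} \<subseteq> ?C" unfolding mem_normal_cone subset_iff using subspace_0[OF V\<^sub>0(1)] by simp
    show "U' \<subseteq> {0}" if "subspace U'" "U' \<subseteq> ?C" for U'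
      using True that unfolding pointed_def by blast
  qed (simp add: subspace_def)
  have "perp V\<^sub>0 {0} = V\<^sub>0" by (auto simp: mem_perp)
  then have "V = V\<^sub>0" using perp_perp lineality_space_normal_cone[OF f] lin by simp
  moreover have "?C \<inter> V\<^sub>0 = ?C" unfolding set_eq_iff Int_iff mem_normal_cone by blast
  ultimately have "\<Lambda>\<^sub>0 = \<Lambda>" "?C = normals f" using normal_cone_Int[OF f] \<Lambda>\<^sub>0 sub by auto
  then show ?thesis using True \<open>V = V\<^sub>0\<close> by (simp add: mu_def)
next
  case False
  then show ?thesis
    unfolding mu_def lineality_space_normal_cone[OF f] perp_perp Let_def normal_cone_Int[OF f]
    using \<Lambda>\<^sub>0 by simp
qed

end

text \<open>The volume depends only on the lattice vectors in the direction space of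
  \<open>f\<close>, which lies in \<open>V\<close>; they are the same for both lattices.\<close>

lemma rel_vol_face_translation:
  assumes f: "face_le f P" and \<Lambda>\<^sub>0: "\<Lambda> = \<Lambda>\<^sub>0 \<inter> V" "is_lattice \<Lambda>\<^sub>0" and v: "v \<in> \<Lambda>\<^sub>0"
  shows "rel_vol \<Lambda>\<^sub>0 (affine hull ((+) v ` f)) ((+) v ` f) = rel_vol \<Lambda> (affine hull f) f"
proof -
  obtain s where s: "s \<in> S \<inter> f" using face_vertex[OF f] by blast
  let ?D = "direction f s"
  note D = lattice_subspace_direction[OF f s]
  have DV: "?D \<subseteq> V" using perp_normals[OF f s] by (auto simp: mem_perp)
  then have LD: "\<Lambda>\<^sub>0 \<inter> ?D = \<Lambda> \<inter> ?D" using \<Lambda>\<^sub>0(1) by blast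
  then have D0: "lattice_subspace \<Lambda>\<^sub>0 ?D" using D by (simp add: lattice_subspace_def)
  have sL: "s \<in> \<Lambda>" "v + s \<in> \<Lambda>\<^sub>0" using s S_L \<Lambda>\<^sub>0(1) lattice_closed(3)[OF \<Lambda>\<^sub>0(2) v] by auto
  note sl = lebesgue_sliced_face[OF f]
  have "affine hull ((+) v ` f) = (+) (v + s) ` ?D"
    unfolding affine_hull_translation affine_hull_face[OF f s] image_image by (simp add: add.assoc)
  from rel_vol_eq_subspace_vol[OF D0 \<Lambda>\<^sub>0(2) lebesgue_sliced_translation[OF sl] sL(2) this]
  have "rel_vol \<Lambda>\<^sub>0 (affine hull ((+) v ` f)) ((+) v ` f) = subspace_vol \<Lambda>\<^sub>0 ?D ((+) (- (v + s)) ` (+) v ` f)" .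
  also have "(+) (- (v + s)) ` (+) v ` f = (+) (- s) ` f" unfolding image_image by simp
  also have "subspace_vol \<Lambda>\<^sub>0 ?D ((+) (- s) ` f) = subspace_vol \<Lambda> ?D ((+) (- s) ` f)"
    by (simp add: subspace_vol_def subspace_basis_def LD)
  also have "\<dots> = rel_vol \<Lambda> (affine hull f) f"
    by (rule rel_vol_eq_subspace_vol[symmetric, OF D L sl sL(1) affine_hull_face[OF f s]])
  finally show ?thesis .
qed

end

lemma polynomials_eventually_eq:
  fixes e E :: "nat \<Rightarrow> real"
  assumes eq: "\<And>t::nat. t \<ge> t0 \<Longrightarrow> (\<Sum>i\<le>d. e i * real t ^ i) = (\<Sum>i\<le>d. E i * real t ^ i)"
  shows "\<forall>i\<le>d. e i = E i"
proof (rule ccontr)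
  assume "\<not> ?thesis"
  then have "\<exists>i\<le>d. e i - E i \<noteq> 0" by auto
  then have fin: "finite {x. (\<Sum>i\<le>d. (e i - E i) * x ^ i) = 0}"
    using polyfun_finite_roots[of "\<lambda>i. e i - E i" d] by blast
  have "real ` {t0..} \<subseteq> {x. (\<Sum>i\<le>d. (e i - E i) * x ^ i) = 0}"
    using eq by (auto simp: left_diff_distrib sum_subtractf)
  then have "finite (real ` {t0..})" using fin by (rule finite_subset)
  then have "finite {t0..}" by (rule finite_imageD) (simp add: inj_on_def)
  then show False using infinite_Ici by blast
qed

theorem theorem2:
  fixes V \<Lambda> P :: "'a::euclidean_space set"
    and T :: "'a set \<Rightarrow> 'a set"
    and e :: "nat \<Rightarrow> real"
    and d :: nat
  assumes "subspace V"
    and "is_lattice \<Lambda>" and "span \<Lambda> = V"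
    and "\<And>C. rational_cone \<Lambda> C \<Longrightarrow> dim (perp_lattice V \<Lambda> C) = dim (perp V C)"
    and "\<And>L. is_lattice L \<Longrightarrow> L \<subseteq> \<Lambda> \<Longrightarrow> fundamental_domain L (T L)"
    and "lattice_polytope \<Lambda> P" and "aff_dim P = int d"
    and "\<And>t::nat. real (card ((*\<^sub>R) (real t) ` P \<inter> \<Lambda>)) = (\<Sum>i\<le>d. e i * real t ^ i)"
  shows "\<forall>i\<le>d. e i = (\<Sum>f\<in>{f. face_le f P \<and> aff_dim f = int i}.
           mu V \<Lambda> T (normal_cone V P f) * rel_vol \<Lambda> (affine hull f) f)"
proof -
  obtain S\<^sub>0 where S\<^sub>0: "finite S\<^sub>0" "S\<^sub>0 \<noteq> {}" "S\<^sub>0 \<subseteq> \<Lambda>" "P = convex hull S\<^sub>0"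
    using assms(6) by (auto simp: lattice_polytope_def)
  then obtain v where v: "v \<in> S\<^sub>0" by blast
  then have vL: "v \<in> \<Lambda>" using S\<^sub>0 by blast
  \<comment> \<open>Translating by the lattice point \<open>v\<close> puts 0 into \<open>S\<close>,
    so that the affine hull becomes the linear subspace \<open>W\<close>, while lattice points stay
    lattice points.\<close>
  define S where "S = (+) (- v) ` S\<^sub>0"
  define W where "W = span S"
  note L = lattice_closed[OF assms(2)]
  have S_L: "S \<subseteq> \<Lambda>" using S\<^sub>0(3) vL L(2) by (auto simp: S_def)
  have S_W: "S \<subseteq> W" unfolding W_def by (rule span_superset)
  have W_V: "W \<subseteq> V" unfolding W_def assms(3)[symmetric] using S_L by (rule span_mono)
  have "0 \<in> S" unfolding S_def using v by (intro image_eqI[of _ _ v]) auto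
  then have aff: "affine hull S = W" unfolding W_def by (intro affine_hull_span_0 hull_inc)
  interpret nf: normal_fan W "\<Lambda> \<inter> W" T S
  proof
    show "subspace W" by (simp add: W_def)
    then show "is_lattice (\<Lambda> \<inter> W)" using assms(2) by (intro is_lattice_Int_subspace)
    show "span (\<Lambda> \<inter> W) = W"
    proof
      show "span (\<Lambda> \<inter> W) \<subseteq> W" using \<open>subspace W\<close> by (intro span_minimal) auto
      show "W \<subseteq> span (\<Lambda> \<inter> W)" unfolding W_def using S_L S_W W_def by (intro span_mono) auto
    qed
    show "fundamental_domain L (T L)" if "is_lattice L" "L \<subseteq> \<Lambda> \<inter> W" for L using assms(5) that by blast
    show "finite S" "S \<noteq> {}" "S \<subseteq> \<Lambda> \<inter> W" "affine hull S = W" using S\<^sub>0 S_L S_W aff by (auto simp: S_def)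
    show "\<exists>k>0. \<forall>z\<in>\<Lambda> \<inter> W. z \<bullet> w / k \<in> \<rat>" if "w \<in> \<Lambda> \<inter> W" for w
      using inner_lattice_rational[OF assms(1-4), of w] that by blast
  qed
  have P: "P = (+) v ` nf.P"
    unfolding nf.P_def unfolding S_def convex_hull_translation S\<^sub>0(4) image_image by simp
  have v_inj: "inj ((+) v)" by (rule injI) simp
  have faces: "{f. face_le f P} = (`) ((+) v) ` {f. face_le f nf.P}"
  proof (intro set_eqI iffI)
    fix f assume "f \<in> {f. face_le f P}"
    then have f: "face_le f P" by simp
    define g where "g = (+) (- v) ` f"
    have "f = (+) v ` g" unfolding g_def image_image by simp
    moreover have "face_le g nf.P" using f unfolding P \<open>f = (+) v ` g\<close> face_le_def by auto
    ultimately show "f \<in> (`) ((+) v) ` {f. face_le f nf.P}" by blast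
  next
    fix f assume "f \<in> (`) ((+) v) ` {f. face_le f nf.P}"
    then show "f \<in> {f. face_le f P}" unfolding P face_le_def by auto
  qed
  have inj: "inj_on ((`) ((+) v)) A" for A using v_inj by (meson inj_image_eq_iff inj_onI)
  let ?m = "\<lambda>f. mu V \<Lambda> T (normal_cone V P f) * rel_vol \<Lambda> (affine hull f) f"
  obtain t0 :: nat where t0: "\<And>t. t \<ge> t0 \<Longrightarrow> real (card (\<Lambda> \<inter> W \<inter> (*\<^sub>R) (real t) ` nf.P)) =
    (\<Sum>f\<in>{f. face_le f nf.P}. mu_pointed W (\<Lambda> \<inter> W) T (nf.normals f) * rel_vol (\<Lambda> \<inter> W) (affine hull f) f * real t ^ nat (aff_dim f))"
    using nf.eventually_card_eq by blast
  have count: "card ((*\<^sub>R) (real t) ` P \<inter> \<Lambda>) = card (\<Lambda> \<inter> W \<inter> (*\<^sub>R) (real t) ` nf.P)" for t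
  proof -
    have tv: "real t *\<^sub>R v \<in> \<Lambda>" using scaleR_int_closed[of \<Lambda> v "int t"] L vL by simp
    have "(*\<^sub>R) (real t) ` nf.P \<subseteq> W" using nf.P_props(5) nf.V by (auto simp: subspace_scale)
    then have "(*\<^sub>R) (real t) ` P \<inter> \<Lambda> = (+) (real t *\<^sub>R v) ` (\<Lambda> \<inter> W \<inter> (*\<^sub>R) (real t) ` nf.P)"
    proof (intro set_eqI iffI)
      fix y assume W: "(*\<^sub>R) (real t) ` nf.P \<subseteq> W" and y: "y \<in> (*\<^sub>R) (real t) ` P \<inter> \<Lambda>"
      then obtain q where q: "q \<in> nf.P" "y = real t *\<^sub>R v + real t *\<^sub>R q" by (auto simp: P scaleR_add_right)
      then have "real t *\<^sub>R q = y - real t *\<^sub>R v" by simp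
      then have "real t *\<^sub>R q \<in> \<Lambda>" using L(2)[of y "real t *\<^sub>R v"] y tv by simp
      then show "y \<in> (+) (real t *\<^sub>R v) ` (\<Lambda> \<inter> W \<inter> (*\<^sub>R) (real t) ` nf.P)"
        using q W by blast
    next
      fix y assume "y \<in> (+) (real t *\<^sub>R v) ` (\<Lambda> \<inter> W \<inter> (*\<^sub>R) (real t) ` nf.P)"
      then obtain q where q: "q \<in> nf.P" "real t *\<^sub>R q \<in> \<Lambda>" "y = real t *\<^sub>R v + real t *\<^sub>R q" by blast
      then have "y = real t *\<^sub>R (v + q)" "y \<in> \<Lambda>" using L(3) tv by (auto simp: scaleR_add_right)
      moreover have "v + q \<in> P" using q(1) unfolding P by (rule imageI)
      ultimately show "y \<in> (*\<^sub>R) (real t) ` P \<inter> \<Lambda>" by blast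
    qed
    then show ?thesis by (simp add: card_image)
  qed
  have finP: "finite {f. face_le f P}" unfolding faces using nf.finite_faces by simp
  \<comment> \<open>Faces are nonempty, so their affine dimension is never \<open>-1\<close> and
    \<open>nat\<close> loses nothing when they are grouped by dimension.\<close>
  have deg: "nat (aff_dim f) \<le> d \<and> 0 \<le> aff_dim f" if "face_le f P" for f
  proof -
    have "f \<subseteq> P" "f \<noteq> {}" using that face_of_imp_subset by (auto simp: face_le_def)
    then have "aff_dim f \<le> int d" "aff_dim f \<noteq> -1" using aff_dim_subset[of f P] assms(7) by (auto simp: aff_dim_empty)
    then show ?thesis using aff_dim_geq[of f] by linarith
  qed
  show ?thesis
  proof (rule polynomials_eventually_eq)
    fix t :: nat assume t: "t \<ge> t0"
    have "(\<Sum>i\<le>d. e i * real t ^ i) = real (card (\<Lambda> \<inter> W \<inter> (*\<^sub>R) (real t) ` nf.P))"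
      using assms(8)[of t] count[of t] by simp
    also have "\<dots> = (\<Sum>f\<in>{f. face_le f nf.P}. ?m ((+) v ` f) * real t ^ nat (aff_dim ((+) v ` f)))"
      unfolding t0[OF t]
    proof (rule sum.cong[OF refl])
      fix f assume "f \<in> {f. face_le f nf.P}"
      then have f: "face_le f nf.P" by simp
      have "\<Lambda> \<subseteq> V" using assms(3) span_superset by blast
      then have "mu V \<Lambda> T (normal_cone V P ((+) v ` f)) = mu_pointed W (\<Lambda> \<inter> W) T (nf.normals f)"
        unfolding P by (intro nf.mu_normal_cone assms(1) W_V f refl)
      moreover have "rel_vol \<Lambda> (affine hull ((+) v ` f)) ((+) v ` f) = rel_vol (\<Lambda> \<inter> W) (affine hull f) f"
        by (rule nf.rel_vol_face_translation[OF f refl assms(2) vL])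
      ultimately show "mu_pointed W (\<Lambda> \<inter> W) T (nf.normals f) * rel_vol (\<Lambda> \<inter> W) (affine hull f) f * real t ^ nat (aff_dim f) =
          ?m ((+) v ` f) * real t ^ nat (aff_dim ((+) v ` f))"
        by (simp only: aff_dim_translation_eq)
    qed
    also have "\<dots> = (\<Sum>f\<in>{f. face_le f P}. ?m f * real t ^ nat (aff_dim f))"
      unfolding faces by (subst sum.reindex[OF inj]) (simp only: o_def)
    also have "\<dots> = (\<Sum>i\<le>d. \<Sum>f\<in>{f \<in> {f. face_le f P}. nat (aff_dim f) = i}. ?m f * real t ^ nat (aff_dim f))"
      using deg by (intro sum.group[symmetric] finP) auto
    also have "\<dots> = (\<Sum>i\<le>d. (\<Sum>f\<in>{f. face_le f P \<and> aff_dim f = int i}. ?m f) * real t ^ i)"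
    proof (rule sum.cong[OF refl])
      fix i
      have "{f \<in> {f. face_le f P}. nat (aff_dim f) = i} = {f. face_le f P \<and> aff_dim f = int i}"
        using deg by force
      then show "(\<Sum>f\<in>{f \<in> {f. face_le f P}. nat (aff_dim f) = i}. ?m f * real t ^ nat (aff_dim f)) =
          (\<Sum>f\<in>{f. face_le f P \<and> aff_dim f = int i}. ?m f) * real t ^ i"
        by (simp add: sum_distrib_right)
    qed
    finally show "(\<Sum>i\<le>d. e i * real t ^ i) =
      (\<Sum>i\<le>d. (\<Sum>f\<in>{f. face_le f P \<and> aff_dim f = int i}. ?m f) * real t ^ i)" .
  qed
qed

end
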